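(* Let $n\geq 2$ and $m\geq n+1$ be integers, let $\mathbb{K}$ be an infinite field whose characteristic does not divide $m$, and let $R=\mathbb{K}[x_1,\ldots,x_n]$. Let $f=l_1l_2\cdots l_m$ be the defining polynomial of a generic central hyperplane arrangement in $\mathbb{K}^n$, and let $J_f\subset R$ be the ideal generated by the partial derivatives of $f$. Then: (i) ${\rm depth}(R/J_f)=0$. (ii) The minimal graded free resolution of $J_f$ has the following shifts, for suitable integers $b_1,\ldots,b_{n-1}$: $$0\rightarrow R^{b_{n-1}}(-(2m-2))\rightarrow\cdots\rightarrow R^{b_2}(-(2m-n+1))\rightarrow R^{b_1}(-(2m-n))\rightarrow R^n(-(m-1))\rightarrow J_f\rightarrow 0.$$ That is, the free module in homological degree $0$ is $R^n(-(m-1))$ and, for $1\leq k\leq n-1$, the free module in homological degree $k$ is $R^{b_k}(-(2m-n+k-1))$.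
   Context: A central hyperplane arrangement of size $m$ in $\mathbb{K}^n$ is given by nonzero, pairwise non-proportional linear forms $l_1,\ldots,l_m\in R$; its defining polynomial is $f=l_1\cdots l_m$. It is generic if any $n$ of the forms are $\mathbb{K}$-linearly independent. Depth is with respect to the maximal ideal $\mathfrak{m}=\langle x_1,\ldots,x_n\rangle$. *)

theory Defs
  imports
    "HOL-Library.Poly_Mapping"
    "HOL-Library.Extended_Nat"
    "HOL-Library.Cardinality"
    "Jordan_Normal_Form.Matrix_Kernel"
begin

section \<open>Polynomials in finitely many variables\<close>

text \<open>
  The polynomial ring \<open>K[x\<^sub>1, \<dots>, x\<^sub>n]\<close> is the type \<open>('n, 'k) mpoly\<close> with
  \<open>n = CARD('n)\<close>: finitely supported functions from exponent vectors to coefficients,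
  with the convolution product of \<^theory>\<open>HOL-Library.Poly_Mapping\<close>.
\<close>

type_synonym ('n, 'k) mpoly = "('n \<Rightarrow>\<^sub>0 nat) \<Rightarrow>\<^sub>0 'k"

definition Const :: "'k::comm_ring_1 \<Rightarrow> ('n, 'k) mpoly" where
  "Const c = Poly_Mapping.single 0 c"

definition Var :: "'n \<Rightarrow> ('n, 'k::comm_ring_1) mpoly" where
  "Var i = Poly_Mapping.single (Poly_Mapping.single i 1) 1"

definition monom_degree :: "('n::finite \<Rightarrow>\<^sub>0 nat) \<Rightarrow> nat" where
  "monom_degree u = (\<Sum>i\<in>UNIV. Poly_Mapping.lookup u i)"

text \<open>
  Degrees are integers because differences of shifts occur below. The zero polynomial is
  homogeneous of every degree, and it is the only one that is homogeneous of negative degree.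
\<close>

definition homogeneous :: "int \<Rightarrow> ('n::finite, 'k::comm_ring_1) mpoly \<Rightarrow> bool" where
  "homogeneous d p \<longleftrightarrow> (\<forall>u\<in>Poly_Mapping.keys p. int (monom_degree u) = d)"

text \<open>
  If \<open>x\<^sub>i\<close> does not divide the monomial \<open>u\<close>, then the difference of exponents is truncated,
  but the coefficient is \<open>0\<close>.
\<close>

definition mpderiv :: "'n \<Rightarrow> ('n, 'k::comm_ring_1) mpoly \<Rightarrow> ('n, 'k) mpoly" where
  "mpderiv i p = (\<Sum>u\<in>Poly_Mapping.keys p.
     Poly_Mapping.single (u - Poly_Mapping.single i 1)
       (of_nat (Poly_Mapping.lookup u i) * Poly_Mapping.lookup p u))"

lemma mpderiv_Const [simp]: "mpderiv i (Const c) = 0"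
  by (auto simp: mpderiv_def Const_def intro!: sum.neutral split: if_splits)

lemma mpderiv_Var: "mpderiv i (Var j :: ('n, 'k::comm_ring_1) mpoly) = (if i = j then 1 else 0)"
  by (auto simp: mpderiv_def Var_def lookup_single)

global_interpretation mpoly: vector_space "\<lambda>(c::'k::field) (p::('n, 'k) mpoly). Const c * p"
  by unfold_locales
    (simp_all add: Const_def single_add mult_single algebra_simps flip: mult.assoc)

text \<open>
  A commutative ring as a module over itself: submodules are ideals, and \<open>ideal.span\<close> is the
  ideal generated by a set.
\<close>

global_interpretation ideal: Modules.module "(*) :: 'a::comm_ring_1 \<Rightarrow> 'a \<Rightarrow> 'a"
  by unfold_locales (simp_all add: algebra_simps)

definition irrelevant_ideal :: "('n, 'k::comm_ring_1) mpoly set" where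
  "irrelevant_ideal = ideal.span (range Var)"

definition jacobian_ideal :: "('n, 'k::comm_ring_1) mpoly \<Rightarrow> ('n, 'k) mpoly set" where
  "jacobian_ideal f = ideal.span (range (\<lambda>i. mpderiv i f))"


section \<open>Hyperplane arrangements\<close>

definition central_arrangement :: "nat \<Rightarrow> (nat \<Rightarrow> ('n::finite, 'k::field) mpoly) \<Rightarrow> bool" where
  "central_arrangement m l \<longleftrightarrow>
     (\<forall>j<m. homogeneous 1 (l j) \<and> l j \<noteq> 0) \<and>
     (\<forall>i<m. \<forall>j<m. i \<noteq> j \<longrightarrow> (\<nexists>c. l i = Const c * l j))"

definition defining_polynomial :: "nat \<Rightarrow> (nat \<Rightarrow> ('n, 'k::comm_ring_1) mpoly) \<Rightarrow> ('n, 'k) mpoly"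
  where "defining_polynomial m l = (\<Prod>j<m. l j)"

text \<open>
  Independence is stated for the set of forms with indices in \<open>S\<close>; for a central arrangement
  \<open>l\<close> is injective on \<open>{..<m}\<close>, so this is independence of the family.
\<close>

definition generic_arrangement :: "nat \<Rightarrow> (nat \<Rightarrow> ('n::finite, 'k::field) mpoly) \<Rightarrow> bool" where
  "generic_arrangement m l \<longleftrightarrow>
     central_arrangement m l \<and>
     (\<forall>S\<subseteq>{..<m}. card S = CARD('n) \<longrightarrow> mpoly.independent (l ` S))"


section \<open>Depth of a cyclic module\<close>

text \<open>
  Regular sequences on the module \<open>R/J\<close>. The module \<open>(R/J)/(r\<^sub>1, \<dots>, r\<^sub>i)(R/J)\<close> is
  \<open>R/(J + (r\<^sub>1, \<dots>, r\<^sub>i))\<close>, and vanishing in it is membership in \<open>J + (r\<^sub>1, \<dots>, r\<^sub>i)\<close>.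
\<close>

definition regular_sequence_on_quotient :: "'a::comm_ring_1 set \<Rightarrow> 'a list \<Rightarrow> bool" where
  "regular_sequence_on_quotient J rs \<longleftrightarrow>
     (\<forall>i<length rs. \<forall>p. rs ! i * p \<in> ideal.span (J \<union> set (take i rs)) \<longrightarrow>
                        p \<in> ideal.span (J \<union> set (take i rs))) \<and>
     ideal.span (J \<union> set rs) \<noteq> UNIV"

text \<open>
  The depth of \<open>R/J\<close> with respect to an ideal \<open>I\<close>: the supremum of the lengths of the
  \<open>R/J\<close>-regular sequences in \<open>I\<close>, and \<open>\<infinity>\<close> if \<open>I(R/J) = R/J\<close>, that is, \<open>I + J = R\<close>.
  It is an extended natural number, since on \<^typ>\<open>nat\<close> the supremum of an unbounded set
  is not meaningful.
\<close>

definition depth_quotient :: "'a::comm_ring_1 set \<Rightarrow> 'a set \<Rightarrow> enat" where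
  "depth_quotient I J =
     (if ideal.span (I \<union> J) = UNIV then \<infinity>
      else Sup {enat (length rs) | rs. set rs \<subseteq> I \<and> regular_sequence_on_quotient J rs})"


section \<open>Minimal graded free resolutions\<close>

text \<open>
  A list \<open>s\<close> of integers stands for the graded free module \<open>R(-s\<^sub>0) \<oplus> R(-s\<^sub>1) \<oplus> \<dots>\<close> of rank
  \<open>length s\<close>, whose \<open>j\<close>-th basis element has degree \<open>s\<^sub>j\<close>; its elements are the vectors in
  \<open>carrier_vec (length s)\<close>. A graded (degree preserving) homomorphism from the module of \<open>s\<close>
  to the module of \<open>t\<close> is a matrix whose \<open>(i, j)\<close> entry is homogeneous of degree \<open>s\<^sub>j - t\<^sub>i\<close>.
\<close>

definition graded_hom :: "int list \<Rightarrow> int list \<Rightarrow> ('n::finite, 'k::comm_ring_1) mpoly mat \<Rightarrow> bool"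
  where "graded_hom s t A \<longleftrightarrow>
     A \<in> carrier_mat (length t) (length s) \<and>
     (\<forall>i<length t. \<forall>j<length s. homogeneous (s ! j - t ! i) (A $$ (i, j)))"

definition mat_image :: "'a::semiring_0 mat \<Rightarrow> 'a vec set" where
  "mat_image A = (\<lambda>v. A *\<^sub>v v) ` carrier_vec (dim_col A)"

text \<open>
  A graded free resolution \<open>\<dots> \<rightarrow> F\<^sub>2 \<rightarrow> F\<^sub>1 \<rightarrow> F\<^sub>0 \<rightarrow> J \<rightarrow> 0\<close> of an ideal \<open>J\<close>: the list \<open>s k\<close> gives
  the shifts of \<open>F\<^sub>k\<close>, the augmentation \<open>F\<^sub>0 \<rightarrow> J\<close> is \<open>v \<mapsto> g \<bullet> v\<close>, and \<open>d k\<close> is the matrix of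
  \<open>F\<^sub>k\<^sub>+\<^sub>1 \<rightarrow> F\<^sub>k\<close>. A resolution of finite length has \<open>s k = []\<close> for all large \<open>k\<close>.
\<close>

definition graded_free_resolution ::
    "('n::finite, 'k::comm_ring_1) mpoly set \<Rightarrow> (nat \<Rightarrow> int list) \<Rightarrow>
     ('n, 'k) mpoly vec \<Rightarrow> (nat \<Rightarrow> ('n, 'k) mpoly mat) \<Rightarrow> bool" where
  "graded_free_resolution J s g d \<longleftrightarrow>
     g \<in> carrier_vec (length (s 0)) \<and>
     (\<forall>j<length (s 0). homogeneous (s 0 ! j) (g $ j)) \<and>
     (\<forall>k. graded_hom (s (Suc k)) (s k) (d k)) \<and>
     (\<lambda>v. g \<bullet> v) ` carrier_vec (length (s 0)) = J \<and>
     {v \<in> carrier_vec (length (s 0)). g \<bullet> v = 0} = mat_image (d 0) \<and>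
     (\<forall>k. mat_kernel (d k) = mat_image (d (Suc k)))"

text \<open>Minimality: every differential maps \<open>F\<^sub>k\<^sub>+\<^sub>1\<close> into \<open>\<mm> F\<^sub>k\<close>.\<close>

definition minimal_graded_free_resolution ::
    "('n::finite, 'k::comm_ring_1) mpoly set \<Rightarrow> (nat \<Rightarrow> int list) \<Rightarrow>
     ('n, 'k) mpoly vec \<Rightarrow> (nat \<Rightarrow> ('n, 'k) mpoly mat) \<Rightarrow> bool" where
  "minimal_graded_free_resolution J s g d \<longleftrightarrow>
     graded_free_resolution J s g d \<and>
     (\<forall>k. \<forall>i<length (s k). \<forall>j<length (s (Suc k)). d k $$ (i, j) \<in> irrelevant_ideal)"

end

theory Submission
  imports Defs "HOL-Library.Function_Algebras" "HOL-Library.Countable" "HOL-Computational_Algebra.Polynomial"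
begin

text \<open>
  Let \<open>f = \<Prod>\<^sub>k l\<^sub>k\<close> be the product of the \<open>m\<close> linear forms, and let \<open>J\<close> be its Jacobian ideal. Identify a vector
  \<open>\<theta> \<in> R\<^sup>n\<close> with the derivation \<open>x\<^sub>j \<mapsto> \<theta>\<^sub>j\<close>; then the syzygies of the partial derivatives of \<open>f\<close> are the
  derivations with \<open>\<theta>(f) = 0\<close>. Since \<open>\<theta>(f) = \<Sum>\<^sub>k \<theta>(l\<^sub>k) f/l\<^sub>k\<close>, this forces \<open>\<theta>(l\<^sub>k) = l\<^sub>k a\<^sub>k\<close> with quotients
  such that \<open>\<Sum>\<^sub>k a\<^sub>k = 0\<close>, and conversely. So the syzygies are the kernel of the map
  \<open>\<Phi> : (\<theta>, a) \<mapsto> (\<theta>(l\<^sub>k) - l\<^sub>k a\<^sub>k)\<^sub>k\<close> from \<open>{(\<theta>, a). \<Sum>\<^sub>k a\<^sub>k = 0}\<close> to \<open>R\<^sup>m\<close>, which is \<open>quotient_deriv\<close>.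

  The kernel of \<open>\<Phi>\<close> is zero in degrees up to \<open>m - n\<close>, the degree being that of \<open>\<theta>\<close>: for a generic
  arrangement a derivation of such low degree with \<open>l\<^sub>k | \<theta>(l\<^sub>k)\<close> for all \<open>k\<close> is a multiple of the Euler
  derivation (\<open>quotients_agree_on_flats\<close>), and the multiplier \<open>a\<close> satisfies \<open>m a = 0\<close>
  (\<open>low_degree_derivation_zero\<close>). In degree \<open>m - n\<close> the source and the target of \<open>\<Phi>\<close> happen to have the
  same dimension over \<open>K\<close>, so \<open>\<Phi>\<close> is surjective there, hence in all higher degrees
  (\<open>quotient_deriv_surjective\<close>).

  Surjectivity gives both claims. For the depth, it says that \<open>q f/l\<^sub>0 \<in> J\<close> for all forms \<open>q\<close> of degree at
  least \<open>m - n\<close>, while \<open>f/l\<^sub>0 \<notin> J\<close> because there are more than \<open>n\<close> hyperplanes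
  (\<open>cofactor_not_combination\<close>); so \<open>R/J\<close> has a nonzero element that a power of the irrelevant ideal
  kills (\<open>depth_zero\<close>). For the resolution, the Koszul complexes of the source and the target of \<open>\<Phi>\<close> are
  exact in the relevant degrees, and the cokernel of \<open>\<Phi>\<close> is zero from degree \<open>m - n\<close> on. Two dimension
  shifts along \<open>0 \<rightarrow> ker \<Phi> \<rightarrow> \<dots> \<rightarrow> R\<^sup>m \<rightarrow> coker \<Phi> \<rightarrow> 0\<close> show that the Koszul homology \<open>H\<^sub>i(ker \<Phi>)\<close> lives in
  internal degree \<open>i + m - n + 1\<close> and vanishes for \<open>i \<ge> n - 1\<close> (\<open>linear_module_annihilators\<close>). A module
  with such Koszul homology has a linear resolution of length at most \<open>n - 2\<close>, which is built one syzygy module at a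
  time (\<open>linear_module_step\<close>). With \<open>R\<^sup>n \<rightarrow> J\<close> in front of it, this is the resolution of \<open>J\<close>.
\<close>

section \<open>Polynomials as finitely supported functions\<close>

(* As a rewrite rule this is associativity from right to left, which would loop with algebra_simps. *)
declare ideal.scale_scale [simp del]

abbreviation (input) "coef \<equiv> Poly_Mapping.lookup"
abbreviation (input) "unit_exp i \<equiv> Poly_Mapping.single i (1::nat)"

lemma mpoly_monomial_sum:
  "p = (\<Sum>u\<in>Poly_Mapping.keys p. Poly_Mapping.single u (coef p u))"
proof (rule poly_mapping_eqI)
  fix u
  show "coef p u = coef (\<Sum>u\<in>Poly_Mapping.keys p. Poly_Mapping.single u (coef p u)) u"
    by (cases "u \<in> Poly_Mapping.keys p")
      (auto simp: lookup_sum lookup_single when_def in_keys_iff sum.delta)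
qed

lemma mpoly_monomial_induct [case_names zero add monomial]:
  fixes p :: "'a \<Rightarrow>\<^sub>0 'b::comm_monoid_add"
  assumes "P 0" "\<And>p q. P p \<Longrightarrow> P q \<Longrightarrow> P (p + q)" "\<And>u c. P (Poly_Mapping.single u c)"
  shows "P p"
proof -
  have "P (\<Sum>u\<in>A. Poly_Mapping.single u (coef p u))" if "finite A" for A
    using that by (induction A rule: finite_induct) (auto intro: assms)
  from this[OF finite_keys[of p]] show ?thesis using mpoly_monomial_sum[of p] by simp
qed

lemma monom_degree_add: "monom_degree (u + v) = monom_degree u + monom_degree v"
  by (simp add: monom_degree_def lookup_add sum.distrib)

lemma monom_degree_unit [simp]: "monom_degree (Poly_Mapping.single i k) = k"
  by (simp add: monom_degree_def lookup_single when_def)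

lemma monom_degree_zero [simp]: "monom_degree 0 = 0"
  by (simp add: monom_degree_def)

lemma monom_degree_eq_0_iff: "monom_degree u = 0 \<longleftrightarrow> u = 0"
  by (auto simp: monom_degree_def intro: poly_mapping_eqI)

lemma unit_exp_le:
  assumes "coef u i \<noteq> 0"
  shows "unit_exp i + (u - unit_exp i) = u" "u - unit_exp i + unit_exp i = u"
  using assms by (auto intro!: poly_mapping_eqI simp: lookup_add lookup_minus lookup_single when_def)

lemma monom_degree_diff_unit:
  assumes "coef u i \<noteq> 0" shows "monom_degree u = Suc (monom_degree (u - unit_exp i))"
  using monom_degree_add[of "unit_exp i" "u - unit_exp i"] unit_exp_le(1)[OF assms] by simp

lemma unit_exp_eq_iff [simp]: "Poly_Mapping.single i (Suc 0) = Poly_Mapping.single j (Suc 0) \<longleftrightarrow> i = j"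
  by (metis One_nat_def lookup_single_eq lookup_single_not_eq zero_neq_one)

lemma mpoly_var_induct [case_names Const add Var]:
  fixes p :: "('n::finite, 'k::comm_ring_1) mpoly"
  assumes C: "\<And>c. P (Const c)" and A: "\<And>p q. P p \<Longrightarrow> P q \<Longrightarrow> P (p + q)"
    and V: "\<And>p j. P p \<Longrightarrow> P (Var j * p)"
  shows "P p"
proof (induction p rule: mpoly_monomial_induct)
  case zero
  then show ?case using C[of 0] by (simp add: Const_def)
next
  case (monomial u c)
  show ?case
  proof (induction "monom_degree u" arbitrary: u)
    case 0
    then show ?case using C[of c] by (simp add: Const_def monom_degree_eq_0_iff)
  next
    case (Suc d)
    then obtain i where i: "coef u i \<noteq> 0"
      by (metis monom_degree_zero nat.distinct(1) poly_mapping_eqI lookup_zero)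
    have "Poly_Mapping.single u c = Var i * Poly_Mapping.single (u - unit_exp i) c"
      using unit_exp_le[OF i] by (simp add: Var_def mult_single)
    moreover have "P (Poly_Mapping.single (u - unit_exp i) c)"
      using Suc monom_degree_diff_unit[OF i] by simp
    ultimately show ?case using V by simp
  qed
qed (rule A)

lemma lookup_Const_mult [simp]: "coef (Const c * p) u = c * coef p u"
  by (induction p rule: mpoly_monomial_induct)
    (auto simp: distrib_left lookup_add Const_def mult_single lookup_single when_def)

lemma lookup_Var_mult:
  "coef (Var j * p) u = (if coef u j = 0 then 0 else coef p (u - unit_exp j))"
proof (induction p rule: mpoly_monomial_induct)
  case (monomial v c)
  have "unit_exp j + v = u \<longleftrightarrow> coef u j \<noteq> 0 \<and> v = u - unit_exp j"
    using unit_exp_le[of u j] by (auto simp: lookup_add)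
  then show ?case by (auto simp: Var_def mult_single lookup_single when_def)
qed (auto simp: distrib_left lookup_add)

lemma lookup_Const: "coef (Const c) u = (if u = 0 then c else 0)"
  by (auto simp: Const_def lookup_single when_def)

lemma lookup_Var: "coef (Var j :: ('n, 'k::comm_ring_1) mpoly) u = (if u = unit_exp j then 1 else 0)"
  by (auto simp: Var_def lookup_single when_def)

lemma Const_zero [simp]: "Const 0 = 0" and Const_one [simp]: "Const 1 = 1"
  by (simp_all add: Const_def)

lemma Const_add: "Const (a + b) = Const a + Const b"
  and Const_mult: "Const (a * b) = Const a * Const b"
  and Const_uminus: "Const (- a) = - Const a"
  by (simp_all add: Const_def single_add mult_single single_diff single_uminus)

lemma Const_of_nat: "Const (of_nat m) = of_nat m"
  by (induction m) (auto simp: Const_add)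

subsection \<open>Homogeneous polynomials\<close>

lemma homogeneous_iff: "homogeneous d p \<longleftrightarrow> (\<forall>u. coef p u \<noteq> 0 \<longrightarrow> int (monom_degree u) = d)"
  by (auto simp: homogeneous_def in_keys_iff)

lemma homogeneous_zero [simp]: "homogeneous d 0"
  by (simp add: homogeneous_iff)

lemma homogeneous_add: "homogeneous d p \<Longrightarrow> homogeneous d q \<Longrightarrow> homogeneous d (p + q)"
  by (auto simp: homogeneous_iff lookup_add) (metis add.right_neutral)

lemma homogeneous_uminus: "homogeneous d p \<Longrightarrow> homogeneous d (- p)"
  by (auto simp: homogeneous_iff)

lemma homogeneous_diff: "homogeneous d p \<Longrightarrow> homogeneous d q \<Longrightarrow> homogeneous d (p - q)"
  using homogeneous_add[of d p "- q"] homogeneous_uminus by auto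

lemma homogeneous_sum: "(\<And>a. a \<in> A \<Longrightarrow> homogeneous d (f a)) \<Longrightarrow> homogeneous d (sum f A)"
  by (induction A rule: infinite_finite_induct) (auto intro: homogeneous_add)

lemma homogeneous_single: "homogeneous (int (monom_degree u)) (Poly_Mapping.single u c)"
  by (auto simp: homogeneous_iff lookup_single when_def)

lemma homogeneous_Const [simp]: "homogeneous 0 (Const c)"
  by (auto simp: homogeneous_iff lookup_Const)

lemma homogeneous_Var [simp]: "homogeneous 1 (Var j)"
  by (auto simp: homogeneous_iff lookup_Var)

lemma homogeneous_Const_mult: "homogeneous d p \<Longrightarrow> homogeneous d (Const c * p)"
  by (auto simp: homogeneous_iff) (metis mult_zero_right)

lemma homogeneous_mult:
  fixes p q :: "('n::finite, 'k::comm_ring_1) mpoly"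
  assumes "homogeneous d p" "homogeneous e q"
  shows "homogeneous (d + e) (p * q)"
proof -
  have "\<exists>a b. u = a + b \<and> a \<in> Poly_Mapping.keys p \<and> b \<in> Poly_Mapping.keys q"
    if "u \<in> Poly_Mapping.keys (p * q)" for u
    using keys_mult[of p q] that by auto
  then show ?thesis using assms by (fastforce simp: homogeneous_def monom_degree_add)
qed

lemma homogeneous_Var_mult: "homogeneous d p \<Longrightarrow> homogeneous (d + 1) (Var j * p)"
  using homogeneous_mult[OF homogeneous_Var[of j], of d p] by (simp only: add.commute)

lemma homogeneous_prod:
  "(\<And>a. a \<in> A \<Longrightarrow> homogeneous 1 (f a)) \<Longrightarrow> homogeneous (int (card A)) (prod f A)"
proof (induction A rule: infinite_finite_induct)
  case (insert x F)
  then have "homogeneous (1 + int (card F)) (f x * prod f F)" by (intro homogeneous_mult) auto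
  then show ?case using insert by simp
qed (use homogeneous_Const[of 1] in auto)

lemma homogeneous_negative: "homogeneous d p \<Longrightarrow> d < 0 \<Longrightarrow> p = 0"
  by (rule poly_mapping_eqI) (force simp: homogeneous_iff)

lemma homogeneous_degree_0: "homogeneous 0 p \<Longrightarrow> p = Const (coef p 0)"
  by (rule poly_mapping_eqI) (auto simp: homogeneous_iff lookup_Const monom_degree_eq_0_iff)

definition hcomp :: "int \<Rightarrow> ('n::finite, 'k::comm_ring_1) mpoly \<Rightarrow> ('n, 'k) mpoly" where
  "hcomp d p = (\<Sum>u | u \<in> Poly_Mapping.keys p \<and> int (monom_degree u) = d. Poly_Mapping.single u (coef p u))"

lemma lookup_hcomp: "coef (hcomp d p) u = (if int (monom_degree u) = d then coef p u else 0)"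
  by (auto simp: hcomp_def lookup_sum lookup_single when_def sum.delta' in_keys_iff)

lemma homogeneous_hcomp [simp]: "homogeneous d (hcomp d p)"
  by (auto simp: homogeneous_iff lookup_hcomp)

lemma hcomp_zero [simp]: "hcomp d 0 = 0"
  by (rule poly_mapping_eqI) (simp add: lookup_hcomp)

lemma hcomp_add: "hcomp d (p + q) = hcomp d p + hcomp d q"
  by (rule poly_mapping_eqI) (simp add: lookup_hcomp lookup_add)

lemma hcomp_sum: "hcomp d (sum f A) = (\<Sum>a\<in>A. hcomp d (f a))"
  by (induction A rule: infinite_finite_induct) (auto simp: hcomp_add)

lemma hcomp_homogeneous: "homogeneous d p \<Longrightarrow> hcomp e p = (if e = d then p else 0)"
  by (rule poly_mapping_eqI) (auto simp: homogeneous_iff lookup_hcomp)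

lemma hcomp_decomp:
  assumes "finite D" "\<And>u. u \<in> Poly_Mapping.keys p \<Longrightarrow> int (monom_degree u) \<in> D"
  shows "(\<Sum>d\<in>D. hcomp d p) = p"
  using assms by (intro poly_mapping_eqI) (auto simp: lookup_sum lookup_hcomp in_keys_iff)

lemma hcomp_mult:
  fixes p q :: "('n::finite, 'k::comm_ring_1) mpoly"
  assumes "homogeneous e q" shows "hcomp (e + d) (q * p) = q * hcomp d p"
proof -
  define D where "D = (\<lambda>u. int (monom_degree u)) ` Poly_Mapping.keys p"
  have p: "p = (\<Sum>d\<in>D. hcomp d p)" by (rule hcomp_decomp[symmetric]) (auto simp: D_def)
  have "hcomp (e + d) (q * p) = (\<Sum>d'\<in>D. hcomp (e + d) (q * hcomp d' p))"
    by (subst p) (simp add: sum_distrib_left hcomp_sum)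
  also have "\<dots> = (\<Sum>d'\<in>D. if d' = d then q * hcomp d' p else 0)"
    by (intro sum.cong refl) (use assms in \<open>auto simp: hcomp_homogeneous[OF homogeneous_mult[OF assms homogeneous_hcomp]]\<close>)
  also have "\<dots> = q * hcomp d p"
  proof (cases "d \<in> D")
    case False
    then have "hcomp d p = 0"
      by (intro poly_mapping_eqI) (auto simp: D_def lookup_hcomp in_keys_iff)
    then show ?thesis using False by (auto simp: D_def)
  qed (auto simp: D_def sum.delta)
  finally show ?thesis .
qed

subsection \<open>Partial derivatives\<close>

lemma lookup_mpderiv:
  "coef (mpderiv i p) u = of_nat (Suc (coef u i)) * coef p (u + unit_exp i)"
proof -
  have "coef (mpderiv i p) u = (\<Sum>v\<in>Poly_Mapping.keys p.
      if v = u + unit_exp i then of_nat (coef v i) * coef p v else 0)"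
    unfolding mpderiv_def lookup_sum
  proof (intro sum.cong refl)
    fix v
    show "coef (Poly_Mapping.single (v - unit_exp i) (of_nat (coef v i) * coef p v)) u =
      (if v = u + unit_exp i then of_nat (coef v i) * coef p v else 0)"
      using unit_exp_le[of v i] by (cases "coef v i = 0") (auto simp: lookup_single when_def lookup_add)
  qed
  also have "\<dots> = of_nat (Suc (coef u i)) * coef p (u + unit_exp i)"
    by (auto simp: sum.delta in_keys_iff lookup_add)
  finally show ?thesis .
qed

lemma mpderiv_add: "mpderiv i (p + q) = mpderiv i p + mpderiv i q"
  by (rule poly_mapping_eqI) (simp add: lookup_mpderiv lookup_add algebra_simps)

lemma mpderiv_zero [simp]: "mpderiv i 0 = 0"
  by (rule poly_mapping_eqI) (simp add: lookup_mpderiv)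

lemma mpderiv_sum: "mpderiv i (sum f A) = (\<Sum>a\<in>A. mpderiv i (f a))"
  by (induction A rule: infinite_finite_induct) (auto simp: mpderiv_add)

lemma mpderiv_Const_mult: "mpderiv i (Const c * p) = Const c * mpderiv i p"
  by (rule poly_mapping_eqI) (simp only: lookup_mpderiv lookup_Const_mult mult.left_commute)

lemma mpderiv_Var_mult:
  "mpderiv i (Var j * p) = (if i = j then p else 0) + Var j * mpderiv i p"
proof (rule poly_mapping_eqI)
  fix u
  show "coef (mpderiv i (Var j * p)) u = coef ((if i = j then p else 0) + Var j * mpderiv i p) u"
  proof (cases "coef u j = 0")
    case True
    then show ?thesis by (auto simp: lookup_mpderiv lookup_Var_mult lookup_add lookup_single when_def)
  next
    case False
    have "u + unit_exp i - unit_exp j = u - unit_exp j + unit_exp i"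
      using False by (auto intro!: poly_mapping_eqI simp: lookup_add lookup_minus lookup_single when_def)
    moreover obtain k where k: "coef u j = Suc k" using False by (cases "coef u j") auto
    have "coef (mpderiv i (Var j * p)) u =
        of_nat (Suc (coef u i)) * coef p (u + unit_exp i - unit_exp j)"
      using False by (simp add: lookup_mpderiv lookup_Var_mult lookup_add)
    moreover have "coef ((if i = j then p else 0) + Var j * mpderiv i p) u =
        (if i = j then coef p u else 0)
        + of_nat (Suc (coef (u - unit_exp j) i)) * coef p (u - unit_exp j + unit_exp i)"
      using False by (simp add: lookup_mpderiv lookup_Var_mult lookup_add)
    moreover have "coef (u - unit_exp j) i = (if i = j then k else coef u i)"
      using k by (simp add: lookup_minus lookup_single when_def)
    ultimately show ?thesis using k unit_exp_le[OF False] by (cases "i = j") (simp_all add: algebra_simps)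
  qed
qed

lemma mpderiv_homogeneous:
  assumes "homogeneous d p" shows "homogeneous (d - 1) (mpderiv i p)"
  unfolding homogeneous_iff
proof (intro allI impI)
  fix u assume "coef (mpderiv i p) u \<noteq> 0"
  then have "coef p (u + unit_exp i) \<noteq> 0" by (auto simp: lookup_mpderiv)
  then show "int (monom_degree u) = d - 1"
    using assms by (auto simp: homogeneous_iff monom_degree_add)
qed

subsection \<open>Linear forms\<close>

abbreviation (input) "lcoef l j \<equiv> coef l (unit_exp j)"

lemma monom_degree_1: "monom_degree u = 1 \<Longrightarrow> \<exists>j. u = unit_exp j"
proof -
  assume u: "monom_degree u = 1"
  then obtain i where i: "coef u i \<noteq> 0"
    by (metis monom_degree_zero one_neq_zero poly_mapping_eqI lookup_zero)
  then have "u - unit_exp i = 0" using monom_degree_diff_unit[OF i] u monom_degree_eq_0_iff by auto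
  then show ?thesis using unit_exp_le[OF i] by auto
qed

lemma linear_form_expand:
  fixes l :: "('n::finite, 'k::comm_ring_1) mpoly"
  assumes "homogeneous 1 l"
  shows "l = (\<Sum>j\<in>UNIV. Const (lcoef l j) * Var j)"
proof (rule poly_mapping_eqI)
  fix u
  show "coef l u = coef (\<Sum>j\<in>UNIV. Const (lcoef l j) * Var j) u"
  proof (cases "\<exists>j. u = unit_exp j")
    case True
    then obtain j where u: "u = unit_exp j" by auto
    have "coef (\<Sum>j\<in>UNIV. Const (lcoef l j) * Var j) u = (\<Sum>x\<in>UNIV. if j = x then lcoef l x else 0)"
      unfolding lookup_sum by (intro sum.cong refl) (auto simp: u lookup_Var)
    then show ?thesis by (simp add: u)
  next
    case False
    then have "coef l u = 0" using assms monom_degree_1[of u] by (auto simp: homogeneous_iff)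
    then show ?thesis using False by (auto simp: lookup_sum lookup_Var)
  qed
qed

lemma mpderiv_linear_combination_mult:
  fixes p :: "('n::finite, 'k::comm_ring_1) mpoly"
  shows "mpderiv i ((\<Sum>j\<in>UNIV. Const (c j) * Var j) * p)
    = Const (c i) * p + (\<Sum>j\<in>UNIV. Const (c j) * Var j) * mpderiv i p"
proof -
  have "mpderiv i ((\<Sum>j\<in>UNIV. Const (c j) * Var j) * p)
      = (\<Sum>j\<in>UNIV. Const (c j) * mpderiv i (Var j * p))"
    by (simp add: sum_distrib_right mpderiv_sum mpderiv_Const_mult mult.assoc)
  also have "\<dots> = (\<Sum>j\<in>UNIV. (if i = j then Const (c j) * p else 0) + Const (c j) * Var j * mpderiv i p)"
    by (intro sum.cong refl) (auto simp: mpderiv_Var_mult distrib_left mult.assoc)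
  finally show ?thesis by (simp add: sum.distrib sum_distrib_right)
qed

lemma mpderiv_linear_form_mult:
  fixes l :: "('n::finite, 'k::comm_ring_1) mpoly"
  assumes "homogeneous 1 l"
  shows "mpderiv i (l * p) = Const (lcoef l i) * p + l * mpderiv i p"
  using mpderiv_linear_combination_mult[of i "lcoef l" p]
  unfolding linear_form_expand[OF assms, symmetric] .

lemma mpderiv_prod_linear_forms:
  fixes l :: "nat \<Rightarrow> ('n::finite, 'k::comm_ring_1) mpoly"
  assumes "finite A" "\<And>k. k \<in> A \<Longrightarrow> homogeneous 1 (l k)"
  shows "mpderiv i (\<Prod>k\<in>A. l k) = (\<Sum>k\<in>A. Const (lcoef (l k) i) * (\<Prod>k'\<in>A - {k}. l k'))"
  using assms
proof (induction A rule: finite_induct)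
  case empty
  then show ?case using mpderiv_Const[of i 1] by simp
next
  case (insert x F)
  have "(\<Sum>k\<in>F. Const (lcoef (l k) i) * (\<Prod>k'\<in>insert x F - {k}. l k')) =
        (\<Sum>k\<in>F. l x * (Const (lcoef (l k) i) * (\<Prod>k'\<in>F - {k}. l k')))"
  proof (intro sum.cong refl)
    fix k assume "k \<in> F"
    then have "insert x F - {k} = insert x (F - {k})" using insert by auto
    then show "Const (lcoef (l k) i) * (\<Prod>k'\<in>insert x F - {k}. l k') =
      l x * (Const (lcoef (l k) i) * (\<Prod>k'\<in>F - {k}. l k'))" using insert by (simp add: algebra_simps)
  qed
  moreover have "insert x F - {x} = F" using insert by auto
  ultimately show ?case using insert
    by (simp add: mpderiv_linear_form_mult sum_distrib_left)
qed

section \<open>Polynomial functions over an infinite field\<close>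

definition monom_at :: "('n::finite \<Rightarrow> 'a::comm_semiring_1) \<Rightarrow> ('n \<Rightarrow>\<^sub>0 nat) \<Rightarrow> 'a" where
  "monom_at x u = (\<Prod>i\<in>UNIV. x i ^ coef u i)"

definition eval_at :: "('n::finite \<Rightarrow> 'k::comm_ring_1) \<Rightarrow> ('n, 'k) mpoly \<Rightarrow> 'k" where
  "eval_at x p = (\<Sum>u\<in>Poly_Mapping.keys p. coef p u * monom_at x u)"

lemma monom_at_add: "monom_at x (u + v) = monom_at x u * monom_at x v"
  by (simp add: monom_at_def lookup_add power_add prod.distrib)

lemma monom_at_zero [simp]: "monom_at x 0 = 1"
  by (simp add: monom_at_def)

lemma monom_at_unit [simp]: "monom_at x (unit_exp i) = x i"
proof -
  have "monom_at x (unit_exp i) = (\<Prod>j\<in>UNIV. if i = j then x j else 1)"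
    unfolding monom_at_def by (intro prod.cong) (auto simp: lookup_single when_def)
  then show ?thesis by simp
qed

lemma eval_at_superset:
  assumes "finite A" "Poly_Mapping.keys p \<subseteq> A"
  shows "eval_at x p = (\<Sum>u\<in>A. coef p u * monom_at x u)"
  unfolding eval_at_def using assms by (intro sum.mono_neutral_left) (auto simp: in_keys_iff)

lemma eval_at_add [simp]: "eval_at x (p + q) = eval_at x p + eval_at x q"
proof -
  define A where "A = Poly_Mapping.keys p \<union> Poly_Mapping.keys q"
  have "finite A" "Poly_Mapping.keys p \<subseteq> A" "Poly_Mapping.keys q \<subseteq> A" "Poly_Mapping.keys (p + q) \<subseteq> A"
    using keys_add[of p q] by (auto simp: A_def)
  then show ?thesis by (simp add: eval_at_superset[of A] lookup_add distrib_right sum.distrib)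
qed

lemma eval_at_zero [simp]: "eval_at x 0 = 0"
  by (simp add: eval_at_def)

lemma eval_at_single [simp]: "eval_at x (Poly_Mapping.single u c) = c * monom_at x u"
  by (simp add: eval_at_def)

lemma eval_at_uminus [simp]: "eval_at x (- p) = - eval_at x p"
  using eval_at_add[of x p "- p"] by (simp add: eq_neg_iff_add_eq_0 add.commute del: eval_at_add)

lemma eval_at_diff [simp]: "eval_at x (p - q) = eval_at x p - eval_at x q"
  using eval_at_add[of x p "- q"] by simp

lemma eval_at_mult [simp]: "eval_at x (p * q) = eval_at x p * eval_at x q"
proof (induction p rule: mpoly_monomial_induct)
  case (monomial u c)
  show ?case
    by (induction q rule: mpoly_monomial_induct)
      (auto simp: distrib_left distrib_right mult_single monom_at_add mult.commute mult.left_commute)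
qed (auto simp: distrib_right)

lemma eval_at_Const [simp]: "eval_at x (Const c) = c"
  by (simp add: Const_def)

lemma eval_at_one [simp]: "eval_at x 1 = 1"
  using eval_at_Const[of x 1] by (simp del: eval_at_Const)

lemma eval_at_Var [simp]: "eval_at x (Var i) = x i"
  by (simp add: Var_def del: One_nat_def)

lemma eval_at_sum [simp]: "eval_at x (sum f A) = (\<Sum>a\<in>A. eval_at x (f a))"
  by (induction A rule: infinite_finite_induct) auto

lemma eval_at_prod [simp]: "eval_at x (prod f A) = (\<Prod>a\<in>A. eval_at x (f a))"
  by (induction A rule: infinite_finite_induct) auto

lemma eval_at_linear_form:
  assumes "homogeneous 1 l"
  shows "eval_at x l = (\<Sum>j\<in>UNIV. lcoef l j * x j)"
  using arg_cong[where f = "eval_at x", OF linear_form_expand[OF assms]] by simp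

lemma eval_at_linear_form_line:
  assumes "homogeneous 1 l"
  shows "eval_at (\<lambda>i. x i + t * y i) l = eval_at x l + t * eval_at y l"
  by (simp add: eval_at_linear_form[OF assms] distrib_left sum.distrib sum_distrib_left mult.left_commute)

lemma monom_at_scale: "monom_at (\<lambda>i. t * x i) u = t ^ monom_degree u * monom_at x u"
  by (simp add: monom_at_def monom_degree_def power_mult_distrib prod.distrib power_sum)

lemma eval_at_scale:
  assumes "homogeneous d p"
  shows "eval_at (\<lambda>i. t * x i) p = t ^ nat d * eval_at x p"
  unfolding eval_at_def sum_distrib_left
  using assms by (intro sum.cong refl) (auto simp: homogeneous_def monom_at_scale)

text \<open>
  The restriction of a polynomial function to a line is a polynomial in one variable, of degree at
  most \<open>d\<close> for a form of degree \<open>d\<close>. So a form that vanishes on more than \<open>d\<close> points of a line vanishes on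
  the line, and a polynomial that vanishes off finitely many hyperplanes is zero.
\<close>

definition line_poly ::
    "('n::finite \<Rightarrow> 'k::comm_ring_1) \<Rightarrow> ('n \<Rightarrow> 'k) \<Rightarrow> ('n, 'k) mpoly \<Rightarrow> 'k poly" where
  "line_poly x y p =
    (\<Sum>u\<in>Poly_Mapping.keys p. Polynomial.smult (coef p u) (monom_at (\<lambda>i. [:x i, y i:]) u))"

lemma poly_line_poly: "poly (line_poly x y p) t = eval_at (\<lambda>i. x i + t * y i) p"
  by (simp add: line_poly_def eval_at_def poly_sum monom_at_def poly_prod)

lemma degree_line_poly:
  assumes "homogeneous d p" shows "degree (line_poly x y p) \<le> nat d"
  unfolding line_poly_def
proof (rule degree_sum_le)
  fix u assume u: "u \<in> Poly_Mapping.keys p"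
  have "degree (monom_at (\<lambda>i. [:x i, y i:]) u) \<le> (\<Sum>i\<in>UNIV. degree ([:x i, y i:] ^ coef u i))"
    unfolding monom_at_def using degree_prod_sum_le[of UNIV "\<lambda>i. [:x i, y i:] ^ coef u i"] by (simp add: o_def)
  also have "\<dots> \<le> (\<Sum>i\<in>UNIV. coef u i)"
  proof (rule sum_mono)
    fix i
    have "degree ([:x i, y i:] ^ coef u i) \<le> degree [:x i, y i:] * coef u i" by (rule degree_power_le)
    also have "\<dots> \<le> 1 * coef u i" by (intro mult_right_mono) auto
    finally show "degree ([:x i, y i:] ^ coef u i) \<le> coef u i" by simp
  qed
  also have "\<dots> = nat d"
  proof -
    have "int (monom_degree u) = d" using assms u by (simp add: homogeneous_def)
    then show ?thesis by (auto simp: monom_degree_def simp del: of_nat_sum)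
  qed
  finally show "degree (Polynomial.smult (coef p u) (monom_at (\<lambda>i. [:x i, y i:]) u)) \<le> nat d"
    using degree_smult_le order_trans by blast
qed simp

lemma affine_zero:
  fixes a b t :: "'k::field"
  assumes "b \<noteq> 0" "a + t * b = 0" shows "t = - a / b"
  unfolding nonzero_eq_divide_eq[OF assms(1)] eq_neg_iff_add_eq_0 using assms(2) by (simp only: add.commute)

lemma eval_at_line_eq_0_many_zeros:
  fixes p :: "('n::finite, 'k::field) mpoly"
  assumes "homogeneous d p" "finite Z" "d < int (card Z)"
    and "\<And>t. t \<in> Z \<Longrightarrow> eval_at (\<lambda>i. x i + t * y i) p = 0"
  shows "eval_at x p = 0"
proof (cases "d < 0")
  case True
  then show ?thesis using homogeneous_negative assms(1) by fastforce
next
  case False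
  have "line_poly x y p = 0"
  proof (rule ccontr)
    assume nz: "line_poly x y p \<noteq> 0"
    have "card Z \<le> card {t. poly (line_poly x y p) t = 0}"
      using assms(4) poly_roots_finite[OF nz] by (intro card_mono) (auto simp: poly_line_poly)
    also have "\<dots> \<le> degree (line_poly x y p)" by (rule card_poly_roots_bound[OF nz])
    also have "\<dots> \<le> nat d" by (rule degree_line_poly[OF assms(1)])
    finally show False using assms(3) False by linarith
  qed
  then show ?thesis using poly_line_poly[of x y p 0] by simp
qed

lemma eval_at_line_eq_0_almost_everywhere:
  fixes p :: "('n::finite, 'k::field) mpoly"
  assumes "infinite (UNIV :: 'k set)" "finite Z"
    and "\<And>t. t \<notin> Z \<Longrightarrow> eval_at (\<lambda>i. x i + t * y i) p = 0"
  shows "eval_at x p = 0"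
proof -
  have "- Z \<subseteq> {t. poly (line_poly x y p) t = 0}" using assms(3) by (auto simp: poly_line_poly)
  moreover have "infinite (- Z)" using assms(1,2) Compl_eq_Diff_UNIV Diff_infinite_finite by metis
  ultimately have "line_poly x y p = 0" using poly_roots_finite finite_subset by blast
  then show ?thesis using poly_line_poly[of x y p 0] by simp
qed

lemma digits_unique:
  fixes f g :: "nat \<Rightarrow> nat"
  assumes "\<And>k. f k < N" "\<And>k. g k < N" "(\<Sum>k<M. f k * N ^ k) = (\<Sum>k<M. g k * N ^ k)" "k < M"
  shows "f k = g k"
  using assms
proof (induction M arbitrary: f g k)
  case (Suc M)
  have shift: "(\<Sum>k<Suc M. h k * N ^ k) = h 0 + N * (\<Sum>k<M. h (Suc k) * N ^ k)" for h :: "nat \<Rightarrow> nat"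
    by (subst sum.lessThan_Suc_shift) (simp add: sum_distrib_left mult_ac)
  have eq: "f 0 + N * (\<Sum>k<M. f (Suc k) * N ^ k) = g 0 + N * (\<Sum>k<M. g (Suc k) * N ^ k)"
    using Suc.prems(3) by (simp only: shift)
  have "f 0 = (f 0 + N * (\<Sum>k<M. f (Suc k) * N ^ k)) mod N" using Suc.prems(1) by simp
  also have "\<dots> = g 0" unfolding eq using Suc.prems(2) by simp
  finally have 0: "f 0 = g 0" .
  moreover have "f (Suc j) = g (Suc j)" if "j < M" for j
  proof (rule Suc.IH[of "\<lambda>k. f (Suc k)" "\<lambda>k. g (Suc k)"])
    have "N > 0" using Suc.prems(1)[of 0] by simp
    then show "(\<Sum>k<M. f (Suc k) * N ^ k) = (\<Sum>k<M. g (Suc k) * N ^ k)" using eq 0 by simp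
  qed (use Suc.prems that in auto)
  ultimately show ?case using Suc.prems(4) by (cases k) auto
qed simp

text \<open>
  By the substitution \<open>x\<^sub>i = s ^ (N ^ i)\<close>, with \<open>N\<close> larger than all exponents, distinct monomials
  of the polynomial become distinct powers of \<open>s\<close>.
\<close>

lemma eval_at_eq_0_imp_eq_0:
  fixes p :: "('n::finite, 'k::field) mpoly"
  assumes "infinite (UNIV :: 'k set)" "\<And>x. eval_at x p = 0"
  shows "p = 0"
proof (rule poly_mapping_eqI)
  fix w
  obtain h :: "nat \<Rightarrow> 'n" where h: "bij_betw h {0..<CARD('n)} UNIV"
    using ex_bij_betw_nat_finite[of "UNIV :: 'n set"] by auto
  define r where "r = inv_into {0..<CARD('n)} h"
  have r: "r (h k) = k" if "k < CARD('n)" for k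
    using h that by (auto simp: r_def bij_betw_def inv_into_f_f)
  have surj_h: "\<exists>k<CARD('n). h k = i" for i
    using h unfolding bij_betw_def by (metis UNIV_I atLeastLessThan_iff imageE)
  define E where "E = (\<lambda>(u, i). coef u i) ` (Poly_Mapping.keys p \<times> UNIV)"
  define N where "N = Suc (Max (insert 0 E))"
  have "finite E" by (auto simp: E_def)
  then have N: "coef u i < N" if "u \<in> Poly_Mapping.keys p" for u i
    unfolding N_def using that by (auto simp: E_def less_Suc_eq_le intro!: Max_ge)
  define W where "W u = (\<Sum>i\<in>UNIV. coef u i * N ^ r i)" for u :: "'n \<Rightarrow>\<^sub>0 nat"
  have W: "W u = (\<Sum>k<CARD('n). coef u (h k) * N ^ k)" for u
    unfolding W_def using sum.reindex_bij_betw[OF h, of "\<lambda>i. coef u i * N ^ r i"]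
    by (simp add: atLeast0LessThan r)
  have inj: "u = v" if "u \<in> Poly_Mapping.keys p" "v \<in> Poly_Mapping.keys p" "W u = W v" for u v
  proof (rule poly_mapping_eqI)
    fix i
    obtain k where "k < CARD('n)" "h k = i" using surj_h by blast
    then show "coef u i = coef v i"
      using digits_unique[of "\<lambda>k. coef u (h k)" N "\<lambda>k. coef v (h k)" "CARD('n)" k] that N by (auto simp: W)
  qed
  define q where "q = (\<Sum>u\<in>Poly_Mapping.keys p. monom (coef p u) (W u))"
  have "poly q s = 0" for s
  proof -
    have "poly q s = eval_at (\<lambda>i. s ^ (N ^ r i)) p"
      by (simp add: q_def eval_at_def poly_sum poly_monom monom_at_def W_def power_sum power_mult[symmetric] mult.commute)
    then show ?thesis using assms(2) by simp
  qed
  then have "q = 0" using assms(1) poly_roots_finite[of q] by auto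
  have "coef p w = coeff q (W w)" if w: "w \<in> Poly_Mapping.keys p"
  proof -
    have "coeff q (W w) = (\<Sum>u\<in>Poly_Mapping.keys p. if u = w then coef p u else 0)"
      unfolding q_def coeff_sum by (intro sum.cong refl) (use inj w in auto)
    then show ?thesis using w by simp
  qed
  with \<open>q = 0\<close> show "coef p w = coef 0 w" by (cases "w \<in> Poly_Mapping.keys p") (auto simp: in_keys_iff)
qed

lemma finite_hyperplanes_avoidable:
  fixes V :: "('n::finite \<Rightarrow> 'k::field) set"
  assumes inf: "infinite (UNIV :: 'k set)" and "finite L"
    and sub: "\<And>x y t. x \<in> V \<Longrightarrow> y \<in> V \<Longrightarrow> (\<lambda>i. x i + t * y i) \<in> V" and "x0 \<in> V"
    and L: "\<And>l. l \<in> L \<Longrightarrow> homogeneous 1 l \<and> (\<exists>w\<in>V. eval_at w l \<noteq> 0)"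
  shows "\<exists>u\<in>V. \<forall>l\<in>L. eval_at u l \<noteq> 0"
  using \<open>finite L\<close> L
proof (induction L rule: finite_induct)
  case empty
  then show ?case using \<open>x0 \<in> V\<close> by auto
next
  case (insert l L)
  then obtain u where u: "u \<in> V" "\<forall>l\<in>L. eval_at u l \<noteq> 0" by auto
  obtain w where w: "w \<in> V" "eval_at w l \<noteq> 0" using insert.prems by auto
  define Z where "Z = (\<lambda>l'. - eval_at w l' / eval_at u l') ` L"
  have "finite Z" using insert by (auto simp: Z_def)
  then obtain t where t: "t \<notin> Z" using inf ex_new_if_finite by blast
  \<comment> \<open>If \<open>u\<close> lies on the hyperplane of \<open>l\<close>, then \<open>w + t * u\<close> has the same value under \<open>l\<close> as \<open>w\<close> for all \<open>t\<close>.\<close>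
  show ?case
  proof (cases "eval_at u l = 0")
    case True
    have "eval_at (\<lambda>i. w i + t * u i) l' \<noteq> 0" if "l' \<in> insert l L" for l'
    proof (cases "l' = l")
      case False
      then have "l' \<in> L" using that by auto
      then have "eval_at u l' \<noteq> 0" "t \<noteq> - eval_at w l' / eval_at u l'" using u t by (auto simp: Z_def)
      then show ?thesis using insert.prems[OF that] affine_zero[of "eval_at u l'" "eval_at w l'" t]
        by (auto simp: eval_at_linear_form_line)
    qed (use w True insert.prems in \<open>auto simp: eval_at_linear_form_line\<close>)
    then show ?thesis using sub[OF w(1) u(1), of t] by blast
  next
    case False
    then show ?thesis using u by blast
  qed
qed

text \<open>
  Division with remainder by a linear form in which the variable \<open>x\<^sub>j\<close> occurs leaves a remainder
  without \<open>x\<^sub>j\<close>, and such a polynomial is zero as soon as it vanishes on the hyperplane.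
\<close>

lemma linear_form_dvd:
  fixes l q :: "('n::finite, 'k::field) mpoly"
  assumes inf: "infinite (UNIV :: 'k set)" and l: "homogeneous 1 l" "l \<noteq> 0"
    and van: "\<And>x. eval_at x l = 0 \<Longrightarrow> eval_at x q = 0"
  shows "\<exists>a. q = l * a"
proof -
  obtain j0 where j0: "lcoef l j0 \<noteq> 0"
    using linear_form_expand[OF l(1)] l(2) by (metis (no_types, lifting) Const_zero mult_zero_left sum.neutral)
  define c where "c = lcoef l j0"
  have c: "c \<noteq> 0" using j0 by (simp add: c_def)
  define free where "free r \<longleftrightarrow> (\<forall>u. coef r u \<noteq> 0 \<longrightarrow> coef u j0 = 0)" for r :: "('n, 'k) mpoly"
  have free_add: "free (r + s)" if "free r" "free s" for r s
    using that by (auto simp: free_def lookup_add) (metis add.right_neutral)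
  have free_uminus: "free (- r)" if "free r" for r using that by (auto simp: free_def)
  have free_zero: "free 0" by (auto simp: free_def)
  have free_sum: "free (sum f A)" if "\<And>a. a \<in> A \<Longrightarrow> free (f a)" for f :: "'n \<Rightarrow> ('n, 'k) mpoly" and A
    using that by (induction A rule: infinite_finite_induct) (auto intro: free_add free_zero)
  have free_Const: "free (Const d * r)" if "free r" for d r using that by (auto simp: free_def)
  have free_Var: "free (Var j * r)" if "free r" "j \<noteq> j0" for j r
    using that by (fastforce simp: free_def lookup_Var_mult lookup_minus lookup_single when_def split: if_splits)
  define S where "S = (\<Sum>j\<in>UNIV - {j0}. Const (lcoef l j) * Var j)"
  have "l = Const c * Var j0 + S"
    unfolding S_def c_def by (subst sum.remove[of UNIV j0, symmetric]) (use linear_form_expand[OF l(1)] in auto)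
  then have "l - S = Const c * Var j0" by simp
  moreover have "Const (1 / c) * (Const c * Var j0) = Const (1 / c * c) * Var j0"
    by (simp only: Const_mult mult.assoc)
  ultimately have Vj0: "Var j0 = Const (1 / c) * (l - S)" using c by simp
  have "\<exists>a r. q = l * a + r \<and> free r"
  proof (induction q rule: mpoly_var_induct)
    case (Const d)
    have "Const d = l * 0 + Const d" "free (Const d)" by (auto simp: free_def lookup_Const)
    then show ?case by blast
  next
    case (add p q)
    then obtain a r b s where "p = l * a + r" "free r" "q = l * b + s" "free s" by auto
    then have "p + q = l * (a + b) + (r + s)" "free (r + s)" by (auto simp: distrib_left free_add)
    then show ?case by blast
  next
    case (Var p j)
    then obtain a r where p: "p = l * a + r" "free r" by auto
    show ?case
    proof (cases "j = j0")
      case False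
      have "Var j * p = l * (Var j * a) + Var j * r" by (simp add: p distrib_left mult.left_commute)
      then show ?thesis using free_Var[OF p(2) False] by blast
    next
      case True
      have "Var j * p = l * (Var j * a) + Var j * r" by (simp add: p distrib_left mult.left_commute)
      also have "Var j * r = l * (Const (1 / c) * r) + - (Const (1 / c) * (S * r))"
        unfolding True Vj0 by (simp add: algebra_simps)
      finally have "Var j * p = l * (Var j * a + Const (1 / c) * r) + - (Const (1 / c) * (S * r))"
        by (simp add: distrib_left)
      moreover have "free (- (Const (1 / c) * (S * r)))"
      proof (intro free_uminus free_Const)
        have "S * r = (\<Sum>j\<in>UNIV - {j0}. Const (lcoef l j) * (Var j * r))"
          by (simp add: S_def sum_distrib_right mult.assoc)
        then show "free (S * r)" using p(2) by (auto intro!: free_sum free_Const free_Var)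
      qed
      ultimately show ?thesis by blast
    qed
  qed
  then obtain a r where q: "q = l * a + r" "free r" by blast
  have "eval_at x r = 0" for x
  proof -
    define x' where "x' = x(j0 := - (\<Sum>j\<in>UNIV - {j0}. lcoef l j * x j) / c)"
    have "(\<Sum>j\<in>UNIV - {j0}. lcoef l j * x' j) = (\<Sum>j\<in>UNIV - {j0}. lcoef l j * x j)"
      by (intro sum.cong) (auto simp: x'_def)
    then have "eval_at x' l = 0" using c
      by (simp add: eval_at_linear_form[OF l(1)] sum.remove[of UNIV j0]) (simp add: x'_def c_def)
    then have "eval_at x' r = 0" using van[of x'] by (simp add: q)
    moreover have "monom_at x' u = monom_at x u" if "u \<in> Poly_Mapping.keys r" for u
      unfolding monom_at_def using that q(2)
      by (intro prod.cong refl) (auto simp: x'_def free_def in_keys_iff)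
    ultimately show ?thesis by (simp add: eval_at_def)
  qed
  then have "r = 0" using eval_at_eq_0_imp_eq_0[OF inf] by blast
  then show ?thesis using q by auto
qed

lemma linear_form_mult_cancel:
  fixes l a :: "('n::finite, 'k::field) mpoly"
  assumes inf: "infinite (UNIV :: 'k set)" and l: "homogeneous 1 l" "l \<noteq> 0" and "l * a = 0"
  shows "a = 0"
proof (rule eval_at_eq_0_imp_eq_0[OF inf])
  fix x
  obtain y where y: "eval_at y l \<noteq> 0" using eval_at_eq_0_imp_eq_0[OF inf] l(2) by blast
  show "eval_at x a = 0"
  proof (rule eval_at_line_eq_0_almost_everywhere[OF inf, of "{- eval_at x l / eval_at y l}"])
    fix t assume "t \<notin> {- eval_at x l / eval_at y l}"
    then have "eval_at (\<lambda>i. x i + t * y i) l \<noteq> 0"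
      using y affine_zero[of "eval_at y l" "eval_at x l" t] by (auto simp: eval_at_linear_form_line[OF l(1)])
    moreover have "eval_at (\<lambda>i. x i + t * y i) l * eval_at (\<lambda>i. x i + t * y i) a = 0"
      using arg_cong[OF assms(4), of "eval_at (\<lambda>i. x i + t * y i)"] by simp
    ultimately show "eval_at (\<lambda>i. x i + t * y i) a = 0" by simp
  qed simp
qed

section \<open>Generic arrangements\<close>

lemma (in vector_space) spanning_set_in_span_of_independent:
  assumes "finite T" "independent B" "B \<subseteq> span T" "card T \<le> card B"
  shows "T \<subseteq> span B"
proof
  fix t assume t: "t \<in> T"
  show "t \<in> span B"
  proof (rule ccontr)
    assume nt: "t \<notin> span B"
    then have "independent (insert t B)" using assms(2) by (simp add: independent_insertI)
    moreover have "insert t B \<subseteq> span T" using assms(3) t span_base by auto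
    ultimately have "finite (insert t B) \<and> card (insert t B) \<le> card T"
      by (rule independent_span_bound[OF assms(1)])
    moreover have "t \<notin> B" using nt span_base by blast
    ultimately show False using assms(4) by (auto simp: card_insert_if)
  qed
qed

locale generic_forms =
  fixes m :: nat and l :: "nat \<Rightarrow> ('n::finite, 'k::field) mpoly"
  assumes infinite_field: "infinite (UNIV :: 'k set)"
    and generic: "generic_arrangement m l"
    and dim_ge_2: "CARD('n) \<ge> 2"
    and size_gt_dim: "m \<ge> CARD('n) + 1"
    and size_nonzero: "of_nat m \<noteq> (0 :: 'k)"
begin

lemma form [simp]: "k < m \<Longrightarrow> homogeneous 1 (l k)" "k < m \<Longrightarrow> l k \<noteq> 0"
  using generic by (auto simp: generic_arrangement_def central_arrangement_def)

lemma inj_on_forms: "inj_on l {..<m}"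
proof (rule inj_onI, rule ccontr)
  fix i j assume ij: "i \<in> {..<m}" "j \<in> {..<m}" "l i = l j" "i \<noteq> j"
  then have "\<nexists>c. l i = Const c * l j"
    using generic by (auto simp: generic_arrangement_def central_arrangement_def)
  moreover have "l i = Const 1 * l j" using ij by simp
  ultimately show False by blast
qed

lemma independent_forms:
  assumes "S \<subseteq> {..<m}" "card S \<le> CARD('n)" shows "mpoly.independent (l ` S)"
proof -
  have "card S \<le> CARD('n)" "CARD('n) \<le> card {..<m}" using assms size_gt_dim by auto
  then obtain T where T: "S \<subseteq> T" "T \<subseteq> {..<m}" "card T = CARD('n)"
    using exists_subset_between[of S "CARD('n)" "{..<m}"] assms(1) by auto
  then have "mpoly.independent (l ` T)" using generic by (auto simp: generic_arrangement_def)
  then show ?thesis by (rule mpoly.independent_mono) (use T in auto)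
qed

definition flat :: "nat set \<Rightarrow> ('n \<Rightarrow> 'k) set" where
  "flat S = {x. \<forall>k\<in>S. eval_at x (l k) = 0}"

lemma flat_line:
  assumes "S \<subseteq> {..<m}" "x \<in> flat S" "y \<in> flat S"
  shows "(\<lambda>i. x i + t * y i) \<in> flat S"
  using assms by (auto simp: flat_def subset_iff eval_at_linear_form_line)

lemma zero_in_flat: "S \<subseteq> {..<m} \<Longrightarrow> (\<lambda>_. 0) \<in> flat S"
  by (auto simp: flat_def eval_at_linear_form subset_iff)

text \<open>
  By independence there is a linear functional that is \<open>0\<close> on the forms of \<open>S\<close> and \<open>1\<close> on \<open>l k\<close>, and on linear
  forms a linear functional is evaluation at the point of its values on the variables.
\<close>

lemma exists_point_in_flat:
  assumes S: "S \<subseteq> {..<m}" "card S < CARD('n)" and k: "k < m" "k \<notin> S"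
  shows "\<exists>x\<in>flat S. eval_at x (l k) = 1"
proof -
  interpret field_space: vector_space "(*) :: 'k \<Rightarrow> 'k \<Rightarrow> 'k"
    by unfold_locales (simp_all add: distrib_left distrib_right mult.assoc)
  interpret functionals: vector_space_pair "\<lambda>(c::'k) (p::('n, 'k) mpoly). Const c * p" "(*) :: 'k \<Rightarrow> 'k \<Rightarrow> 'k"
    by unfold_locales
  have "finite S" using S finite_subset by auto
  then have "mpoly.independent (l ` insert k S)" using S k by (intro independent_forms) auto
  then obtain g where g: "Vector_Spaces.linear (\<lambda>c p. Const c * p) (*) g"
      "\<forall>p\<in>l ` insert k S. g p = (if p = l k then 1 else 0)"
    using functionals.linear_independent_extend[of "l ` insert k S" "\<lambda>p. if p = l k then 1 else 0"] by blast
  interpret g: Vector_Spaces.linear "\<lambda>(c::'k) (p::('n, 'k) mpoly). Const c * p" "(*)" g by (rule g)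
  define x where "x j = g (Var j)" for j
  have eval: "eval_at x (l i) = g (l i)" if "i < m" for i
  proof -
    have "g (l i) = g (\<Sum>j\<in>UNIV. Const (lcoef (l i) j) * Var j)"
      by (rule arg_cong[where f = g, OF linear_form_expand]) (use that in simp)
    also have "\<dots> = eval_at x (l i)"
      using that by (simp add: eval_at_linear_form g.sum g.scale x_def)
    finally show ?thesis by simp
  qed
  have "l s \<noteq> l k" if "s \<in> S" for s
    using that k S inj_on_forms by (metis inj_onD lessThan_iff subsetD)
  then have "x \<in> flat S" using g(2) S eval by (auto simp: flat_def subset_iff)
  moreover have "eval_at x (l k) = 1" using g(2) eval k by auto
  ultimately show ?thesis by blast
qed

text \<open>By counting dimensions, \<open>n\<close> independent linear forms span the variables.\<close>

lemma flat_of_size_n: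
  assumes S: "S \<subseteq> {..<m}" "card S = CARD('n)" and x: "x \<in> flat S"
  shows "x j = 0"
proof -
  have "finite S" using S finite_subset by auto
  have ind: "mpoly.independent (l ` S)" using S by (intro independent_forms) auto
  have in_span: "l k \<in> mpoly.span (range Var)" if "k < m" for k
  proof -
    have "(\<Sum>j\<in>UNIV. Const (lcoef (l k) j) * Var j) \<in> mpoly.span (range Var)"
      by (intro mpoly.span_sum mpoly.span_scale mpoly.span_base) auto
    then show ?thesis using linear_form_expand[of "l k"] that by simp
  qed
  have "card (l ` S) = CARD('n)" using inj_on_forms S by (metis card_image inj_on_subset)
  have "range Var \<subseteq> mpoly.span (l ` S)"
  proof (rule mpoly.spanning_set_in_span_of_independent[OF _ ind])
    show "l ` S \<subseteq> mpoly.span (range Var)" using in_span S(1) by blast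
    show "card (range (Var :: 'n \<Rightarrow> ('n, 'k) mpoly)) \<le> card (l ` S)"
      unfolding \<open>card (l ` S) = CARD('n)\<close> by (rule card_image_le) simp
  qed simp
  also have "mpoly.span (l ` S) \<subseteq> {p. eval_at x p = 0}"
    using x by (intro mpoly.span_minimal) (auto simp: flat_def mpoly.subspace_def)
  finally have "eval_at x (Var j) = 0" by blast
  then show ?thesis by simp
qed

lemma exists_point_off_other_hyperplanes:
  assumes S: "S \<subseteq> {..<m}" "card S < CARD('n)"
  shows "\<exists>u\<in>flat S. \<forall>k\<in>{..<m} - S. eval_at u (l k) \<noteq> 0"
proof -
  have "\<exists>u\<in>flat S. \<forall>p\<in>l ` ({..<m} - S). eval_at u p \<noteq> 0"
    using exists_point_in_flat[OF S]
    by (intro finite_hyperplanes_avoidable[OF infinite_field _ flat_line[OF S(1)] zero_in_flat[OF S(1)]])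
      (auto, metis one_neq_zero)
  then show ?thesis by auto
qed

subsection \<open>Derivations of low degree\<close>

text \<open>The value on \<open>l k\<close> of the derivation that sends \<open>x\<^sub>j\<close> to \<open>\<theta> j\<close>.\<close>

definition deriv_form :: "('n \<Rightarrow> ('n, 'k) mpoly) \<Rightarrow> nat \<Rightarrow> ('n, 'k) mpoly" where
  "deriv_form \<theta> k = (\<Sum>j\<in>UNIV. Const (lcoef (l k) j) * \<theta> j)"

lemma eval_deriv_form: "k < m \<Longrightarrow> eval_at x (deriv_form \<theta> k) = eval_at (\<lambda>j. eval_at x (\<theta> j)) (l k)"
  by (simp add: deriv_form_def eval_at_linear_form)

text \<open>
  On a flat of dimension one, \<open>\<theta>\<close> restricts to a multiple of the Euler derivation, and the
  quotients \<open>a k\<close> with \<open>k \<notin> S\<close> all restrict to the multiplier. The equality then spreads to larger flats, one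
  dimension at a time: if \<open>a i - a j\<close> vanishes on all hyperplanes that the remaining forms cut out
  of the flat, then these are more hyperplanes than its degree. A suitable line through a given
  point of the flat meets them in distinct points.
\<close>

lemma quotients_agree_on_flats:
  assumes hom: "\<And>k. k < m \<Longrightarrow> homogeneous e (a k)" and e: "e \<le> int m - int CARD('n) - 1"
    and eq: "\<And>k. k < m \<Longrightarrow> deriv_form \<theta> k = l k * a k"
    and S: "S \<subseteq> {..<m}" "card S + d = CARD('n) - 1" and ij: "i < m" "j < m" "i \<notin> S" "j \<notin> S"
    and x: "x \<in> flat S"
  shows "eval_at x (a i) = eval_at x (a j)"
  using S ij x
proof (induction d arbitrary: S x)
  case 0
  have "finite S" using 0 finite_subset by auto
  have less: "card S < CARD('n)" using 0 dim_ge_2 by simp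
  have multiplier: "\<exists>c. \<forall>k\<in>{..<m} - S. eval_at w (a k) = c" if w: "w \<in> flat S" "w j0 \<noteq> 0" for w j0
  proof -
    have nz: "eval_at w (l k) \<noteq> 0" if "k \<in> {..<m} - S" for k
    proof
      assume "eval_at w (l k) = 0"
      then have "w \<in> flat (insert k S)" using w by (auto simp: flat_def)
      moreover have "card (insert k S) = CARD('n)" using that 0 \<open>finite S\<close> dim_ge_2 by simp
      ultimately show False using w(2) flat_of_size_n[of "insert k S" w j0] that 0 by auto
    qed
    define y where "y = (\<lambda>j. eval_at w (\<theta> j))"
    have y: "eval_at y (l k) = eval_at w (l k) * eval_at w (a k)" if "k < m" for k
      using eval_deriv_form[OF that, of w \<theta>] eq[OF that] by (simp add: y_def)
    then have yS: "y \<in> flat S" using w(1) 0 by (auto simp: flat_def)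
    define c where "c = eval_at y (l i) / eval_at w (l i)"
    have "eval_at (\<lambda>j. y j + (- c) * w j) (l i) = eval_at y (l i) + (- c) * eval_at w (l i)"
      by (rule eval_at_linear_form_line) (use 0 in simp)
    also have "\<dots> = 0" using nz[of i] 0 by (simp add: c_def)
    finally have z: "(\<lambda>j. y j + (- c) * w j) \<in> flat (insert i S)"
      using flat_line[OF _ yS w(1), of "- c"] 0 by (simp add: flat_def)
    have "card (insert i S) = CARD('n)" using 0 \<open>finite S\<close> dim_ge_2 by simp
    then have "y j = c * w j" for j using flat_of_size_n[OF _ _ z, of j] 0 by auto
    then have yc: "y = (\<lambda>j. c * w j)" by auto
    have "eval_at w (a k) = c" if k: "k \<in> {..<m} - S" for k
    proof -
      have "eval_at y (l k) = c * eval_at w (l k)"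
        unfolding yc using k by (simp add: eval_at_linear_form sum_distrib_left mult_ac)
      then show ?thesis using y[of k] nz[OF k] k by simp
    qed
    then show ?thesis by blast
  qed
  show ?case
  proof (cases "\<exists>j0. x j0 \<noteq> 0")
    case True
    then obtain j0 where "x j0 \<noteq> 0" ..
    then obtain c where "\<forall>k\<in>{..<m} - S. eval_at x (a k) = c" using multiplier[of x j0] 0 by blast
    then show ?thesis using 0 by simp
  next
    case False
    obtain w where w: "w \<in> flat S" "eval_at w (l i) = 1"
      using exists_point_in_flat[OF _ less] 0 by blast
    have "\<exists>j0. w j0 \<noteq> 0"
    proof (rule ccontr)
      assume "\<nexists>j0. w j0 \<noteq> 0"
      then have "eval_at w (l i) = 0" using 0 by (simp add: eval_at_linear_form)
      then show False using w(2) by simp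
    qed
    then obtain j0 where "w j0 \<noteq> 0" ..
    then obtain c where "\<forall>k\<in>{..<m} - S. eval_at w (a k) = c" using multiplier[of w j0] w by blast
    then have "eval_at w (a i) = eval_at w (a j)" using 0 by simp
    moreover have x: "x = (\<lambda>j. 0 * w j)" using False by auto
    ultimately show ?thesis
      unfolding x using eval_at_scale[OF hom[of i], of 0 w] eval_at_scale[OF hom[of j], of 0 w] 0 by simp
  qed
next
  case (Suc d)
  define p where "p = a i - a j"
  have hp: "homogeneous e p" using Suc hom by (auto simp: p_def intro: homogeneous_diff)
  have "finite S" using finite_subset[OF Suc.prems(1)] by simp
  have less: "card S + 2 \<le> CARD('n)" using Suc.prems(2) by linarith
  define K where "K = {..<m} - S - {i, j}"
  have "finite K" by (simp add: K_def)
  have vanish: "eval_at y p = 0" if "k \<in> K" "y \<in> flat (insert k S)" for k y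
    using Suc.IH[of "insert k S" y] Suc.prems that \<open>finite S\<close> by (auto simp: K_def p_def)
  have "eval_at x p = 0"
  proof (rule ccontr)
    assume xp: "eval_at x p \<noteq> 0"
    then have "i \<noteq> j" by (auto simp: p_def)
    have xk: "eval_at x (l k) \<noteq> 0" if "k \<in> K" for k
      using vanish[OF that, of x] xp Suc.prems by (auto simp: flat_def)
    define q where "q k k' = Const (eval_at x (l k)) * l k' - Const (eval_at x (l k')) * l k" for k k'
    have "\<exists>u\<in>flat S. \<forall>r\<in>l ` K \<union> (\<lambda>(k, k'). q k k') ` (K \<times> K - Id). eval_at u r \<noteq> 0"
    proof (rule finite_hyperplanes_avoidable[OF infinite_field _ flat_line[OF Suc.prems(1)] zero_in_flat[OF Suc.prems(1)]])
      fix r assume "r \<in> l ` K \<union> (\<lambda>(k, k'). q k k') ` (K \<times> K - Id)"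
      then consider k where "k \<in> K" "r = l k" | k k' where "k \<in> K" "k' \<in> K" "k \<noteq> k'" "r = q k k'" by auto
      then show "homogeneous 1 r \<and> (\<exists>w\<in>flat S. eval_at w r \<noteq> 0)"
      proof cases
        case 1
        then obtain w where "w \<in> flat S" "eval_at w r = 1"
          using exists_point_in_flat[OF Suc.prems(1), of k] less by (auto simp: K_def)
        then show ?thesis using 1 by (auto simp: K_def intro!: bexI[of _ w])
      next
        case 2
        have "card (insert k S) < CARD('n)" using less 2 \<open>finite S\<close> by (auto simp: K_def)
        then obtain w where "w \<in> flat (insert k S)" "eval_at w (l k') = 1"
          using exists_point_in_flat[of "insert k S" k'] Suc.prems 2 by (auto simp: K_def)
        then have "w \<in> flat S" "eval_at w r \<noteq> 0" using 2 xk by (auto simp: q_def flat_def)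
        moreover have "homogeneous 1 r" using 2
          by (auto simp: q_def K_def intro!: homogeneous_diff homogeneous_Const_mult)
        ultimately show ?thesis by blast
      qed
    qed (use \<open>finite K\<close> in auto)
    then obtain u where u: "u \<in> flat S" "\<And>k. k \<in> K \<Longrightarrow> eval_at u (l k) \<noteq> 0"
      "\<And>k k'. k \<in> K \<Longrightarrow> k' \<in> K \<Longrightarrow> k \<noteq> k' \<Longrightarrow> eval_at u (q k k') \<noteq> 0" by fastforce
    define z where "z k = - eval_at x (l k) / eval_at u (l k)" for k
    have "inj_on z K"
    proof (rule inj_onI, rule ccontr)
      fix k k' assume k: "k \<in> K" "k' \<in> K" "z k = z k'" "k \<noteq> k'"
      then have "eval_at u (q k k') = 0" using u(2)[of k] u(2)[of k']
        by (simp add: z_def q_def frac_eq_eq)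
      then show False using u(3) k by blast
    qed
    then have "card (z ` K) = card K" by (rule card_image)
    also have "card K = m - card S - 2"
      using \<open>i \<noteq> j\<close> Suc.prems \<open>finite S\<close> by (simp add: K_def card_Diff_subset)
    finally have cardZ: "e < int (card (z ` K))" using e less size_gt_dim by linarith
    have "eval_at (\<lambda>i. x i + t * u i) p = 0" if "t \<in> z ` K" for t
    proof -
      from that obtain k where k: "k \<in> K" "t = z k" by auto
      have "eval_at (\<lambda>i. x i + t * u i) (l k) = eval_at x (l k) + t * eval_at u (l k)"
        by (rule eval_at_linear_form_line) (use k in \<open>simp add: K_def\<close>)
      also have "\<dots> = 0" using u(2)[OF k(1)] by (simp add: k(2) z_def)
      finally have "(\<lambda>i. x i + t * u i) \<in> flat (insert k S)"
        using flat_line[OF Suc.prems(1) Suc.prems(7) u(1), of t] by (simp add: flat_def)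
      then show ?thesis by (rule vanish[OF k(1)])
    qed
    then have "eval_at x p = 0"
      using eval_at_line_eq_0_many_zeros[OF hp _ cardZ] \<open>finite K\<close> by blast
    with xp show False by simp
  qed
  then show ?case by (simp add: p_def)
qed

text \<open>
  This is where the characteristic enters: the common quotient \<open>a 0\<close>, the multiplier of the Euler
  derivation, is killed by \<open>m\<close>.
\<close>

lemma low_degree_derivation_zero:
  assumes hom: "\<And>k. k < m \<Longrightarrow> homogeneous e (a k)" and e: "e \<le> int m - int CARD('n) - 1"
    and eq: "\<And>k. k < m \<Longrightarrow> deriv_form \<theta> k = l k * a k" and sum: "(\<Sum>k<m. a k) = 0"
  shows "k < m \<Longrightarrow> a k = 0" "\<theta> j = 0"
proof -
  have m: "0 < m" using size_gt_dim by simp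
  have const: "a k = a 0" if "k < m" for k
  proof -
    have "eval_at x (a k - a 0) = 0" for x
      using quotients_agree_on_flats[OF hom e eq, where S = "{}" and d = "CARD('n) - 1" and i = k and j = 0] that m
      by (auto simp: flat_def)
    then have "a k - a 0 = 0" using eval_at_eq_0_imp_eq_0[OF infinite_field] by blast
    then show ?thesis by simp
  qed
  have "(\<Sum>k<m. a k) = (\<Sum>k<m. a 0)" by (rule sum.cong) (use const in blast)+
  then have "Const (of_nat m) * a 0 = 0" using sum by (simp add: Const_of_nat)
  then have "of_nat m * coef (a 0) u = 0" for u by (metis lookup_Const_mult lookup_zero)
  then have "a 0 = 0" using size_nonzero by (intro poly_mapping_eqI) auto
  then show a: "a k = 0" if "k < m" for k using const[OF that] by simp
  show "\<theta> j = 0"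
  proof (rule eval_at_eq_0_imp_eq_0[OF infinite_field])
    fix x
    have "(\<lambda>j. eval_at x (\<theta> j)) \<in> flat {..<CARD('n)}"
      using size_gt_dim by (auto simp: flat_def eq a simp flip: eval_deriv_form)
    then show "eval_at x (\<theta> j) = 0"
      using flat_of_size_n[of "{..<CARD('n)}" "\<lambda>j. eval_at x (\<theta> j)" j] size_gt_dim by auto
  qed
qed

subsection \<open>Derivations that annihilate the defining polynomial\<close>

definition cofactor :: "nat \<Rightarrow> ('n, 'k) mpoly" where
  "cofactor k = (\<Prod>k'\<in>{..<m} - {k}. l k')"

lemma form_mult_cofactor: "k < m \<Longrightarrow> l k * cofactor k = defining_polynomial m l"
  by (simp add: cofactor_def defining_polynomial_def prod.remove[of "{..<m}" k])

lemma homogeneous_cofactor: "k < m \<Longrightarrow> homogeneous (int m - 1) (cofactor k)"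
  using homogeneous_prod[of "{..<m} - {k}" l] by (simp add: cofactor_def of_nat_diff)

lemma derivation_defining_polynomial:
  "(\<Sum>j\<in>UNIV. \<theta> j * mpderiv j (defining_polynomial m l)) = (\<Sum>k<m. deriv_form \<theta> k * cofactor k)"
proof -
  have "mpderiv j (defining_polynomial m l) = (\<Sum>k<m. Const (lcoef (l k) j) * cofactor k)" for j
    unfolding defining_polynomial_def cofactor_def by (rule mpderiv_prod_linear_forms) auto
  then have "(\<Sum>j\<in>UNIV. \<theta> j * mpderiv j (defining_polynomial m l)) =
      (\<Sum>j\<in>UNIV. \<Sum>k<m. Const (lcoef (l k) j) * \<theta> j * cofactor k)"
    by (simp add: sum_distrib_left mult_ac)
  also have "\<dots> = (\<Sum>k<m. \<Sum>j\<in>UNIV. Const (lcoef (l k) j) * \<theta> j * cofactor k)"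
    by (rule sum.swap)
  finally show ?thesis by (simp add: deriv_form_def sum_distrib_right)
qed

lemma homogeneous_mpderiv_defining_polynomial:
  "homogeneous (int m - 1) (mpderiv j (defining_polynomial m l))"
  using homogeneous_prod[of "{..<m}" l] by (auto simp: defining_polynomial_def intro!: mpderiv_homogeneous)

lemma prod_forms_cancel:
  assumes "A \<subseteq> {..<m}" "(\<Prod>k\<in>A. l k) * q = 0" shows "q = 0"
proof -
  have "finite A" using assms(1) finite_subset by auto
  then show ?thesis using assms
  proof (induction A rule: finite_induct)
    case (insert x F)
    then have "l x * (prod l F * q) = 0" by (simp add: mult.assoc)
    then have "prod l F * q = 0"
      using linear_form_mult_cancel[OF infinite_field, of "l x" "prod l F * q"] insert.prems(1) by auto
    then show ?case using insert by auto
  qed simp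
qed

lemma eval_cofactor_other: "k < m \<Longrightarrow> k' \<noteq> k \<Longrightarrow> eval_at x (l k) = 0 \<Longrightarrow> eval_at x (cofactor k') = 0"
  by (auto simp: cofactor_def intro!: prod_zero bexI[of _ k])

lemma eval_sum_cofactors_on_hyperplane:
  assumes "k < m" "eval_at x (l k) = 0"
  shows "eval_at x (\<Sum>k'<m. w k' * cofactor k') = eval_at x (w k) * eval_at x (cofactor k)"
proof -
  have "(\<Sum>k'<m. eval_at x (w k') * eval_at x (cofactor k')) =
      (\<Sum>k'<m. if k' = k then eval_at x (w k) * eval_at x (cofactor k) else 0)"
    by (intro sum.cong refl) (use assms eval_cofactor_other in auto)
  then show ?thesis using assms(1) by simp
qed

text \<open>
  On the hyperplane \<open>l\<^sub>k = 0\<close> the sum \<open>\<Sum>\<^sub>i \<theta>(l\<^sub>i) f/l\<^sub>i\<close> reduces to \<open>\<theta>(l\<^sub>k) f/l\<^sub>k\<close>, and \<open>f/l\<^sub>k\<close> is zero only on finitely many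
  subspaces of the hyperplane. So \<open>\<theta>(l\<^sub>k)\<close> vanishes there, and \<open>l\<^sub>k\<close> divides it.
\<close>

lemma annihilating_derivation_quotients:
  assumes zero: "(\<Sum>j\<in>UNIV. \<theta> j * mpderiv j (defining_polynomial m l)) = 0"
    and hom: "\<And>j. homogeneous d (\<theta> j)"
  shows "\<exists>a. (\<forall>k<m. homogeneous (d - 1) (a k) \<and> deriv_form \<theta> k = l k * a k) \<and> (\<Sum>k<m. a k) = 0"
proof -
  have zero': "(\<Sum>k<m. deriv_form \<theta> k * cofactor k) = 0"
    using zero by (simp add: derivation_defining_polynomial)
  have "\<exists>a. homogeneous (d - 1) a \<and> deriv_form \<theta> k = l k * a" if k: "k < m" for k
  proof -
    have "card {k} < CARD('n)" using dim_ge_2 by simp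
    then obtain u where u: "u \<in> flat {k}" "\<forall>k'\<in>{..<m} - {k}. eval_at u (l k') \<noteq> 0"
      using exists_point_off_other_hyperplanes[of "{k}"] k by auto
    have "eval_at x (deriv_form \<theta> k) = 0" if x: "eval_at x (l k) = 0" for x
    proof (rule eval_at_line_eq_0_almost_everywhere[OF infinite_field])
      fix t assume t: "t \<notin> (\<lambda>k'. - eval_at x (l k') / eval_at u (l k')) ` ({..<m} - {k})"
      let ?y = "\<lambda>i. x i + t * u i"
      have "eval_at ?y (l k') \<noteq> 0" if "k' \<in> {..<m} - {k}" for k'
        using affine_zero[of "eval_at u (l k')" "eval_at x (l k')" t] t u that
        by (auto simp: eval_at_linear_form_line)
      then have "eval_at ?y (cofactor k) \<noteq> 0" by (auto simp: cofactor_def)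
      moreover have "eval_at ?y (l k) = 0" using u x k by (simp add: flat_def eval_at_linear_form_line)
      ultimately show "eval_at ?y (deriv_form \<theta> k) = 0"
        using eval_sum_cofactors_on_hyperplane[of k ?y "deriv_form \<theta>"] k zero' by simp
    qed auto
    then obtain a where a: "deriv_form \<theta> k = l k * a"
      using linear_form_dvd[OF infinite_field, of "l k" "deriv_form \<theta> k"] k by auto
    have "homogeneous d (deriv_form \<theta> k)"
      unfolding deriv_form_def by (intro homogeneous_sum homogeneous_Const_mult hom)
    then have "deriv_form \<theta> k = hcomp (1 + (d - 1)) (l k * a)" by (simp add: hcomp_homogeneous flip: a)
    also have "\<dots> = l k * hcomp (d - 1) a" by (rule hcomp_mult) (use k in simp)
    finally show ?thesis using homogeneous_hcomp by blast
  qed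
  then obtain a where a: "\<forall>k<m. homogeneous (d - 1) (a k) \<and> deriv_form \<theta> k = l k * a k" by metis
  have "(\<Prod>k<m. l k) * (\<Sum>k<m. a k) = (\<Sum>k<m. deriv_form \<theta> k * cofactor k)"
    unfolding sum_distrib_left
  proof (intro sum.cong refl)
    fix k assume k: "k \<in> {..<m}"
    then have "(\<Prod>k<m. l k) * a k = l k * cofactor k * a k"
      by (simp add: form_mult_cofactor defining_polynomial_def)
    also have "\<dots> = (l k * a k) * cofactor k" by (simp only: mult_ac)
    finally show "(\<Prod>k<m. l k) * a k = deriv_form \<theta> k * cofactor k" using a k by simp
  qed
  then have "(\<Prod>k<m. l k) * (\<Sum>k<m. a k) = 0" using zero' by (rule trans)
  then have "(\<Sum>k<m. a k) = 0" by (rule prod_forms_cancel[OF subset_refl])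
  with a show ?thesis by blast
qed

lemma derivation_with_quotients:
  assumes "(\<Sum>k<m. a k) = 0"
  shows "(\<Sum>j\<in>UNIV. \<theta> j * mpderiv j (defining_polynomial m l))
    = (\<Sum>k<m. (deriv_form \<theta> k - l k * a k) * cofactor k)"
proof -
  have "(\<Sum>k<m. l k * a k * cofactor k) = (\<Sum>k<m. defining_polynomial m l * a k)"
    by (intro sum.cong refl) (auto simp: mult_ac simp flip: form_mult_cofactor)
  then show ?thesis
    using assms by (simp add: derivation_defining_polynomial left_diff_distrib sum_subtractf flip: sum_distrib_left)
qed

text \<open>
  For degree reasons the coefficients could be taken constant, and the combination would be
  \<open>\<Sum>\<^sub>k l\<^sub>k(\<rho>) f/l\<^sub>k\<close> for a point \<open>\<rho>\<close>. Restriction to the hyperplanes other than the one of \<open>l\<^sub>0\<close> shows that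
  \<open>\<rho>\<close> lies on all of them. There are at least \<open>n\<close>, so \<open>\<rho> = 0\<close>, and \<open>f/l\<^sub>0\<close> would be zero.
\<close>

lemma cofactor_not_combination:
  "cofactor 0 \<noteq> (\<Sum>j\<in>UNIV. r j * mpderiv j (defining_polynomial m l))"
proof
  let ?f = "defining_polynomial m l"
  assume eq: "cofactor 0 = (\<Sum>j\<in>UNIV. r j * mpderiv j ?f)"
  have m: "0 < m" using size_gt_dim by simp
  define \<rho> where "\<rho> j = coef (r j) 0" for j
  have r0: "hcomp 0 (r j) = Const (\<rho> j)" for j
    using homogeneous_degree_0[OF homogeneous_hcomp, of "r j"] by (simp add: \<rho>_def lookup_hcomp)
  have "cofactor 0 = hcomp ((int m - 1) + 0) (cofactor 0)"
    using homogeneous_cofactor[OF m] by (simp add: hcomp_homogeneous)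
  also have "\<dots> = (\<Sum>j\<in>UNIV. hcomp ((int m - 1) + 0) (mpderiv j ?f * r j))"
    by (simp add: eq hcomp_sum mult.commute)
  also have "\<dots> = (\<Sum>j\<in>UNIV. Const (\<rho> j) * mpderiv j ?f)"
    by (subst hcomp_mult[OF homogeneous_mpderiv_defining_polynomial]) (simp add: r0 mult.commute)
  finally have cof: "cofactor 0 = (\<Sum>k<m. deriv_form (\<lambda>j. Const (\<rho> j)) k * cofactor k)"
    by (simp add: derivation_defining_polynomial)
  have "eval_at \<rho> (l k) = 0" if k: "k < m" "k \<noteq> 0" for k
  proof -
    have "card {k} < CARD('n)" using dim_ge_2 by simp
    then obtain u where u: "u \<in> flat {k}" "\<forall>k'\<in>{..<m} - {k}. eval_at u (l k') \<noteq> 0"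
      using exists_point_off_other_hyperplanes[of "{k}"] k by auto
    then have uk: "eval_at u (l k) = 0" by (simp add: flat_def)
    have "eval_at u (cofactor k) \<noteq> 0" using u by (auto simp: cofactor_def)
    moreover have "eval_at u (cofactor 0) = 0" using eval_cofactor_other k uk by auto
    ultimately show ?thesis
      using eval_sum_cofactors_on_hyperplane[OF k(1) uk, of "deriv_form (\<lambda>j. Const (\<rho> j))"] k
      by (simp add: eval_deriv_form flip: cof)
  qed
  then have "\<rho> \<in> flat {1..<CARD('n) + 1}" using size_gt_dim by (auto simp: flat_def)
  moreover have "{1..<CARD('n) + 1} \<subseteq> {..<m}" using size_gt_dim by fastforce
  ultimately have "\<rho> j = 0" for j using flat_of_size_n[of "{1..<CARD('n) + 1}" \<rho> j] by simp
  then have "cofactor 0 = 0" using cof by (simp add: deriv_form_def)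
  then have "(\<Prod>k\<in>{..<m} - {0}. l k) * 1 = 0" by (simp add: cofactor_def)
  then show False using prod_forms_cancel[of "{..<m} - {0}" 1] by simp
qed

end

section \<open>The Koszul complex\<close>

subsection \<open>The contracting homotopy\<close>

text \<open>
  The variables are ordered by \<^const>\<open>to_nat\<close>. The operator \<open>shift q\<close> divides by \<open>x\<^sub>q\<close> those terms
  in which \<open>x\<^sub>q\<close> is the least variable, and discards the others.
\<close>

definition shift :: "'n::finite \<Rightarrow> ('n, 'k::comm_ring_1) mpoly \<Rightarrow> ('n, 'k) mpoly" where
  "shift q p = Abs_poly_mapping
     (\<lambda>u. if \<forall>i. to_nat i < to_nat q \<longrightarrow> coef u i = 0 then coef p (u + unit_exp q) else 0)"

lemma lookup_shift:
  "coef (shift q p) u =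
    (if \<forall>i. to_nat i < to_nat q \<longrightarrow> coef u i = 0 then coef p (u + unit_exp q) else 0)"
proof -
  let ?g = "\<lambda>u. if \<forall>i. to_nat i < to_nat q \<longrightarrow> coef u i = 0 then coef p (u + unit_exp q) else 0"
  have "{u. ?g u \<noteq> 0} \<subseteq> (\<lambda>v. v - unit_exp q) ` Poly_Mapping.keys p"
  proof
    fix u assume "u \<in> {u. ?g u \<noteq> 0}"
    then have "u + unit_exp q \<in> Poly_Mapping.keys p" by (auto simp: in_keys_iff split: if_splits)
    then show "u \<in> (\<lambda>v. v - unit_exp q) ` Poly_Mapping.keys p"
      by (rule rev_image_eqI) simp
  qed
  then have "finite {u. ?g u \<noteq> 0}" by (rule finite_subset) simp
  then show ?thesis unfolding shift_def by simp
qed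

lemma shift_zero [simp]: "shift q 0 = 0"
  by (rule poly_mapping_eqI) (simp add: lookup_shift)

lemma shift_add: "shift q (p + p') = shift q p + shift q p'"
proof (rule poly_mapping_eqI)
  fix u
  have if_add: "(if P then x + y else 0) = (if P then x else 0) + (if P then y else 0)"
    for P and x y :: 'b by simp
  show "coef (shift q (p + p')) u = coef (shift q p + shift q p') u"
    unfolding lookup_add lookup_shift by (rule if_add)
qed

lemma shift_sum: "shift q (sum f A) = (\<Sum>a\<in>A. shift q (f a))"
  by (induction A rule: infinite_finite_induct) (auto simp: shift_add)

lemma homogeneous_shift: "homogeneous d p \<Longrightarrow> homogeneous (d - 1) (shift q p)"
  unfolding homogeneous_iff
proof (intro allI impI)
  fix u assume "\<forall>u. coef p u \<noteq> 0 \<longrightarrow> int (monom_degree u) = d" "coef (shift q p) u \<noteq> 0"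
  then have "int (monom_degree (u + unit_exp q)) = d"
    unfolding lookup_shift by (metis (no_types))
  then show "int (monom_degree u) = d - 1" by (simp add: monom_degree_add)
qed

definition least_var :: "'n::finite set \<Rightarrow> 'n" where
  "least_var T = arg_min_on to_nat T"

lemma least_var:
  assumes "T \<noteq> {}"
  shows "least_var T \<in> T" "i \<in> T \<Longrightarrow> to_nat (least_var T) \<le> to_nat i"
  using arg_min_if_finite[OF finite assms, of to_nat] unfolding least_var_def by force+

lemma least_var_eqI:
  assumes "q \<in> T" "\<And>i. i \<in> T \<Longrightarrow> to_nat q \<le> to_nat i" shows "least_var T = q"
proof -
  have "T \<noteq> {}" using assms(1) by blast
  then have "to_nat (least_var T) = to_nat q"
    using least_var(1)[of T] least_var(2)[of T q] assms by (intro le_antisym) auto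
  then show ?thesis by (simp add: inj_eq)
qed

definition koszul_sign :: "'n::finite \<Rightarrow> 'n set \<Rightarrow> 'a::comm_ring_1" where
  "koszul_sign j T = (- 1) ^ card {i \<in> T. to_nat i < to_nat j}"

text \<open>
  A chain \<open>c\<close> stands for \<open>\<Sum>\<^sub>T c T \<otimes> e\<^sub>T\<close>, where \<open>e\<^sub>T\<close> is the exterior product of the basis vectors
  with indices in \<open>T\<close>; coefficients are vectors of polynomials.
\<close>

definition koszul_d ::
    "('n::finite set \<Rightarrow> 'b \<Rightarrow> ('n, 'k::comm_ring_1) mpoly) \<Rightarrow> 'n set \<Rightarrow> 'b \<Rightarrow> ('n, 'k) mpoly" where
  "koszul_d c T b = (\<Sum>j\<in>- T. koszul_sign j T * (Var j * c (insert j T) b))"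

definition koszul_h ::
    "('n::finite set \<Rightarrow> 'b \<Rightarrow> ('n, 'k::comm_ring_1) mpoly) \<Rightarrow> 'n set \<Rightarrow> 'b \<Rightarrow> ('n, 'k) mpoly" where
  "koszul_h c T = (if T = {} then 0 else (\<lambda>b. shift (least_var T) (c (T - {least_var T}) b)))"

lemma lookup_sign_mult: "coef (koszul_sign j T * p) u = koszul_sign j T * coef p u"
  by (cases "even (card {i \<in> T. to_nat i < to_nat j})") (simp_all add: koszul_sign_def)

lemma lookup_koszul_d:
  "coef (koszul_d c T b) u =
    (\<Sum>j\<in>- T. koszul_sign j T * (if coef u j = 0 then 0 else coef (c (insert j T) b) (u - unit_exp j)))"
  unfolding koszul_d_def lookup_sum lookup_sign_mult lookup_Var_mult ..

text \<open>
  On the term \<open>x\<^sup>u e\<^sub>T\<close> the homotopy \<open>h\<close> moves the least variable \<open>q\<close> that occurs in \<open>u\<close> or in \<open>T\<close> from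
  \<open>u\<close> to \<open>T\<close>, and gives \<open>0\<close> if \<open>q \<in> T\<close>; seen from the result, \<open>q\<close> is the least element of the index set.
  Unlike the homotopy given by the Euler derivation it needs no division by the degree, so it works
  in every characteristic. The only term on which \<open>d h + h d\<close> is not the identity is the constant one.
\<close>

lemma koszul_homotopy:
  fixes c :: "'n::finite set \<Rightarrow> 'b \<Rightarrow> ('n, 'k::comm_ring_1) mpoly"
  assumes cycle: "\<And>T. koszul_d c T b = 0" and const: "coef (c {} b) 0 = 0"
  shows "koszul_d (koszul_h c) T b = c T b"
proof (rule poly_mapping_eqI)
  fix u
  have "koszul_h c (insert j T) b = shift (least_var (insert j T)) (c (insert j T - {least_var (insert j T)}) b)" for j
    by (simp add: koszul_h_def)
  then have lhs: "coef (koszul_d (koszul_h c) T b) u =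
      (\<Sum>j\<in>- T. koszul_sign j T * (if coef u j = 0 then 0
        else coef (shift (least_var (insert j T)) (c (insert j T - {least_var (insert j T)}) b)) (u - unit_exp j)))"
    by (simp only: lookup_koszul_d)
  show "coef (koszul_d (koszul_h c) T b) u = coef (c T b) u"
  proof (cases "Poly_Mapping.keys u \<union> T = {}")
    case True
    then have "T = {}" "u = 0" by auto
    then show ?thesis using const by (simp add: lookup_koszul_d)
  next
    case False
    define q where "q = least_var (Poly_Mapping.keys u \<union> T)"
    have q: "q \<in> Poly_Mapping.keys u \<union> T" "\<And>i. i \<in> Poly_Mapping.keys u \<union> T \<Longrightarrow> to_nat q \<le> to_nat i"
      using least_var[OF False] by (auto simp: q_def)
    have below: "coef u i = 0" if "to_nat i < to_nat q" for i
      using q(2)[of i] that by (metis UnI1 in_keys_iff not_le)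
    have below_T: "{i \<in> T - {q}. to_nat i < to_nat q} = {}" "{i \<in> T. to_nat i < to_nat q} = {}"
      using q(2) by force+
    have less: "to_nat q < to_nat j" if "coef u j \<noteq> 0" "j \<noteq> q" for j
      using q(2)[of j] that by (metis UnI1 in_keys_iff inj_eq inj_to_nat le_neq_implies_less)
    show ?thesis
    proof (cases "q \<in> T")
      case True
      define T' where "T' = T - {q}"
      have "- T' = insert q (- T)" using True by (auto simp: T'_def)
      moreover have "coef (koszul_d c T' b) (u + unit_exp q) = 0" using cycle by simp
      moreover have "koszul_sign q T' = (1 :: 'k)" unfolding koszul_sign_def T'_def below_T by simp
      moreover have "insert q T' = T" using True by (auto simp: T'_def)
      ultimately have "coef (c T b) u = - (\<Sum>j\<in>- T. koszul_sign j T' *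
          (if coef (u + unit_exp q) j = 0 then 0 else coef (c (insert j T') b) (u + unit_exp q - unit_exp j)))"
        using True by (simp add: lookup_koszul_d lookup_add eq_neg_iff_add_eq_0 del: One_nat_def)
      also have "\<dots> = coef (koszul_d (koszul_h c) T b) u"
        unfolding lhs sum_negf[symmetric]
      proof (intro sum.cong refl)
        fix j assume j: "j \<in> - T"
        then have jq: "j \<noteq> q" using True by auto
        show "- (koszul_sign j T' * (if coef (u + unit_exp q) j = 0 then 0
              else coef (c (insert j T') b) (u + unit_exp q - unit_exp j))) =
          koszul_sign j T * (if coef u j = 0 then 0
              else coef (shift (least_var (insert j T)) (c (insert j T - {least_var (insert j T)}) b)) (u - unit_exp j))"
        proof (cases "coef u j = 0")
          case True
          then show ?thesis using jq by (simp add: lookup_add lookup_single when_def)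
        next
          case uj: False
          have lv: "least_var (insert j T) = q"
            using less[OF uj jq] q(2) True by (intro least_var_eqI) auto
          have "{i \<in> T. to_nat i < to_nat j} = insert q {i \<in> T'. to_nat i < to_nat j}"
            using less[OF uj jq] True by (auto simp: T'_def)
          then have "koszul_sign j T = - (koszul_sign j T' :: 'k)"
            by (simp add: koszul_sign_def T'_def)
          moreover have "insert j T - {q} = insert j T'" using jq by (auto simp: T'_def)
          moreover have "u - unit_exp j + unit_exp q = u + unit_exp q - unit_exp j"
            using uj by (auto intro!: poly_mapping_eqI simp: lookup_add lookup_minus lookup_single when_def)
          ultimately show ?thesis using uj below
            by (simp add: lv lookup_shift lookup_add lookup_minus)
        qed
      qed
      finally show ?thesis by simp
    next
      case False
      then have uq: "coef u q \<noteq> 0" using q(1) by (auto simp: in_keys_iff)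
      have "coef (koszul_d (koszul_h c) T b) u = (\<Sum>j\<in>- T. if j = q then coef (c T b) u else 0)"
        unfolding lhs
      proof (intro sum.cong refl)
        fix j assume j: "j \<in> - T"
        show "koszul_sign j T * (if coef u j = 0 then 0
              else coef (shift (least_var (insert j T)) (c (insert j T - {least_var (insert j T)}) b)) (u - unit_exp j)) =
          (if j = q then coef (c T b) u else 0)"
        proof (cases "j = q")
          case True
          have "koszul_sign q T = (1 :: 'k)" unfolding koszul_sign_def below_T by simp
          moreover have "least_var (insert q T) = q" using q(2) by (intro least_var_eqI) auto
          moreover have "insert q T - {q} = T" using False by auto
          ultimately show ?thesis using True uq below
            by (simp add: lookup_shift lookup_minus unit_exp_le(2)[OF uq, simplified])
        next
          case jq: False
          have "coef (shift (least_var (insert j T)) p) (u - unit_exp j) = 0" if uj: "coef u j \<noteq> 0" for p :: "('n, 'k) mpoly"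
          proof -
            have "least_var (insert j T) \<in> insert j T" by (rule least_var) simp
            then have "least_var (insert j T) \<noteq> q" "to_nat q \<le> to_nat (least_var (insert j T))"
              using jq False q(2) uj by (auto simp: in_keys_iff)
            then have "to_nat q < to_nat (least_var (insert j T))"
              by (metis inj_eq inj_to_nat le_neq_implies_less)
            moreover have "coef (u - unit_exp j) q \<noteq> 0"
              using uq jq by (simp add: lookup_minus lookup_single when_def)
            ultimately show ?thesis by (auto simp: lookup_shift)
          qed
          then show ?thesis using jq by simp
        qed
      qed
      also have "\<dots> = coef (c T b) u" using False by simp
      finally show ?thesis .
    qed
  qed
qed

lemma koszul_d_zero [simp]: "koszul_d 0 = 0"
  by (intro ext) (simp add: koszul_d_def)

lemma koszul_d_diff: "koszul_d (c - c') = koszul_d c - koszul_d c'"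
  by (intro ext) (simp add: koszul_d_def right_diff_distrib sum_subtractf)

lemma koszul_sign_swap:
  assumes "j \<noteq> k" "j \<notin> T" "k \<notin> T"
  shows "koszul_sign j T * koszul_sign k (insert j T) = - (koszul_sign k T * koszul_sign j (insert k T) :: 'a::comm_ring_1)"
proof -
  have *: "koszul_sign j T * koszul_sign k (insert j T) = - (koszul_sign k T * koszul_sign j (insert k T) :: 'a)"
    if "j \<notin> T" "k \<notin> T" "to_nat j < to_nat k" for j k :: 'b
  proof -
    have "{i \<in> insert j T. to_nat i < to_nat k} = insert j {i \<in> T. to_nat i < to_nat k}"
      "{i \<in> insert k T. to_nat i < to_nat j} = {i \<in> T. to_nat i < to_nat j}" using that by auto
    then show ?thesis using that by (simp add: koszul_sign_def mult.commute)
  qed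
  have "to_nat j \<noteq> to_nat k" using assms(1) by (simp add: inj_eq)
  then consider "to_nat j < to_nat k" | "to_nat k < to_nat j" using nat_neq_iff by blast
  then show ?thesis
  proof cases
    case 2
    then show ?thesis using *[of k j] assms by simp
  qed (use * assms in blast)
qed

text \<open>
  The terms for \<open>(j, k)\<close> and \<open>(k, j)\<close> cancel. That the double sum equals its own negative would not be enough in
  characteristic two, so the pairs with \<open>j < k\<close> are separated from the others.
\<close>

lemma koszul_d_d: "koszul_d (koszul_d c) = 0"
proof (intro ext)
  fix T b
  define F where "F = (\<lambda>(j, k). koszul_sign j T * koszul_sign k (insert j T) * (Var j * Var k * c (insert k (insert j T)) b))"
  define P where "P = {(j, k). j \<notin> T \<and> k \<notin> T \<and> to_nat j < to_nat k}"
  have anti: "F (k, j) = - F (j, k)" if "(j, k) \<in> P" for j k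
  proof -
    have "koszul_sign k T * koszul_sign j (insert k T) = - (koszul_sign j T * koszul_sign k (insert j T) :: ('a, 'c) mpoly)"
      by (rule koszul_sign_swap) (use that in \<open>auto simp: P_def\<close>)
    then show ?thesis by (simp add: F_def insert_commute mult.commute[of "Var j"])
  qed
  have "koszul_d (koszul_d c) T b = (\<Sum>j\<in>- T. \<Sum>k\<in>- insert j T. F (j, k))"
    unfolding koszul_d_def F_def sum_distrib_left
    by (intro sum.cong refl) (simp add: mult_ac)
  also have "\<dots> = sum F (SIGMA j:- T. - insert j T)" by (subst sum.Sigma) auto
  also have "(SIGMA j:- T. - insert j T) = P \<union> prod.swap ` P"
    by (auto simp: P_def image_iff) (metis inj_eq inj_to_nat linorder_neqE_nat)
  also have "sum F (P \<union> prod.swap ` P) = sum F P + sum F (prod.swap ` P)"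
    by (rule sum.union_disjoint) (auto simp: P_def)
  also have "sum F (prod.swap ` P) = (\<Sum>x\<in>P. F (prod.swap x))"
    by (rule sum.reindex[unfolded o_def]) (auto intro: inj_onI)
  also have "\<dots> = (\<Sum>x\<in>P. - F x)" by (intro sum.cong) (auto simp: anti)
  finally show "koszul_d (koszul_d c) T b = 0 T b" by (simp add: sum_negf)
qed

subsection \<open>Graded modules of vectors\<close>

definition vec_scale :: "'k::comm_ring_1 \<Rightarrow> ('b \<Rightarrow> ('n, 'k) mpoly) \<Rightarrow> 'b \<Rightarrow> ('n, 'k) mpoly" where
  "vec_scale c x = (\<lambda>b. Const c * x b)"

global_interpretation vec_space: vector_space "vec_scale :: 'k::field \<Rightarrow> ('b \<Rightarrow> ('n, 'k) mpoly) \<Rightarrow> _"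
  by unfold_locales (rule ext, simp add: vec_scale_def distrib_left distrib_right Const_add)+

text \<open>A graded submodule of a module of vectors is given by its homogeneous pieces.\<close>

locale graded_pieces =
  fixes N :: "int \<Rightarrow> ('b \<Rightarrow> ('n::finite, 'k::field) mpoly) set"
  assumes zero: "0 \<in> N t"
    and add: "x \<in> N t \<Longrightarrow> y \<in> N t \<Longrightarrow> x + y \<in> N t"
    and scale: "x \<in> N t \<Longrightarrow> vec_scale c x \<in> N t"
    and Var_mult: "x \<in> N t \<Longrightarrow> (\<lambda>b. Var j * x b) \<in> N (t + 1)"
begin

lemma uminus: "x \<in> N t \<Longrightarrow> - x \<in> N t"
proof -
  assume "x \<in> N t"
  then have "vec_scale (- 1) x \<in> N t" by (rule scale)
  also have "vec_scale (- 1) x = - x" by (rule ext) (simp add: vec_scale_def Const_uminus)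
  finally show ?thesis .
qed

lemma diff: "x \<in> N t \<Longrightarrow> y \<in> N t \<Longrightarrow> x - y \<in> N t"
  using add[of x t "- y"] uminus[of y t] by simp

lemma sum: "(\<And>a. a \<in> A \<Longrightarrow> f a \<in> N t) \<Longrightarrow> (\<lambda>b. \<Sum>a\<in>A. f a b) \<in> N t"
proof (induction A rule: infinite_finite_induct)
  case (insert a A)
  then have "f a + (\<lambda>b. \<Sum>a\<in>A. f a b) \<in> N t" by (intro add) auto
  then show ?case using insert by (simp add: plus_fun_def)
qed (use zero in \<open>auto simp: zero_fun_def\<close>)

lemma sign: "x \<in> N t \<Longrightarrow> (\<lambda>b. koszul_sign j T * x b) \<in> N t"
  using uminus[of x t] by (cases "even (card {i \<in> T. to_nat i < to_nat j})")
    (auto simp: koszul_sign_def fun_Compl_def)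

lemma koszul_d: "(\<And>T. c T \<in> N t) \<Longrightarrow> koszul_d c T \<in> N (t + 1)"
  using sum[of "- T" "\<lambda>j b. koszul_sign j T * (Var j * c (insert j T) b)" "t + 1"] sign Var_mult
  by (simp add: koszul_d_def[abs_def] sign Var_mult)

end

definition free_pieces :: "'b set \<Rightarrow> ('b \<Rightarrow> int) \<Rightarrow> int \<Rightarrow> ('b \<Rightarrow> ('n::finite, 'k::field) mpoly) set" where
  "free_pieces B \<delta> t = {x. \<forall>b. (b \<in> B \<longrightarrow> homogeneous (t - \<delta> b) (x b)) \<and> (b \<notin> B \<longrightarrow> x b = 0)}"

lemma homogeneous_Var_mult': "homogeneous (t - d) p \<Longrightarrow> homogeneous (t + 1 - d) (Var j * p)"
  using homogeneous_Var_mult[of "t - d" p j] by (simp add: algebra_simps)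

lemma homogeneous_shift': "homogeneous (t - d) p \<Longrightarrow> homogeneous (t - 1 - d) (shift q p)"
  using homogeneous_shift[of "t - d" p q] by (simp add: algebra_simps)

lemma graded_pieces_free: "graded_pieces (free_pieces B \<delta>)"
  by unfold_locales
    (auto simp: free_pieces_def vec_scale_def homogeneous_add homogeneous_Const_mult homogeneous_Var_mult')

subsection \<open>Exactness\<close>

definition koszul_exact ::
    "(int \<Rightarrow> ('b \<Rightarrow> ('n::finite, 'k::field) mpoly) set) \<Rightarrow> nat \<Rightarrow> int \<Rightarrow> bool" where
  "koszul_exact N i t \<longleftrightarrow> (\<forall>c.
     (\<forall>T. c T \<in> N t) \<and> (\<forall>T. card T \<noteq> i \<longrightarrow> c T = 0) \<and> koszul_d c = 0 \<longrightarrow>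
     (\<exists>c'. (\<forall>T. c' T \<in> N (t - 1)) \<and> (\<forall>T. card T \<noteq> Suc i \<longrightarrow> c' T = 0) \<and> koszul_d c' = c))"

lemma koszul_exact_if_shift_closed:
  assumes zero: "0 \<in> N (t - 1)" and shift: "\<And>x q. x \<in> N t \<Longrightarrow> (\<lambda>b. shift q (x b)) \<in> N (t - 1)"
    and pos: "i > 0 \<or> (\<forall>x\<in>N t. \<forall>b. coef (x b) 0 = 0)"
  shows "koszul_exact N i t"
  unfolding koszul_exact_def
proof (intro allI impI, elim conjE)
  fix c assume c: "\<forall>T. c T \<in> N t" "\<forall>T. card T \<noteq> i \<longrightarrow> c T = 0" "koszul_d c = 0"
  have "koszul_h c T \<in> N (t - 1)" for T
    using zero shift c(1) by (auto simp: koszul_h_def)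
  moreover have "koszul_h c T = 0" if "card T \<noteq> Suc i" for T
  proof (cases "T = {}")
    case False
    then have "card (T - {least_var T}) \<noteq> i"
      using least_var(1)[OF False] that by (metis card_Suc_Diff1 finite)
    then show ?thesis using c(2) by (auto simp: koszul_h_def zero_fun_def)
  qed (simp add: koszul_h_def)
  moreover have "koszul_d (koszul_h c) = c"
  proof (intro ext koszul_homotopy)
    fix b show "coef (c {} b) 0 = 0" using pos c(1,2) by (cases "i = 0") auto
  qed (use c(3) in simp)
  ultimately show "\<exists>c'. (\<forall>T. c' T \<in> N (t - 1)) \<and> (\<forall>T. card T \<noteq> Suc i \<longrightarrow> c' T = 0) \<and> koszul_d c' = c"
    by blast
qed

lemma koszul_exact_free:
  fixes B :: "'b set"
  assumes "i > 0 \<or> (\<forall>b\<in>B. t > \<delta> b)"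
  shows "koszul_exact (free_pieces B \<delta> :: int \<Rightarrow> ('b \<Rightarrow> ('n::finite, 'k::field) mpoly) set) i t"
proof (rule koszul_exact_if_shift_closed)
  show "i > 0 \<or> (\<forall>x\<in>(free_pieces B \<delta> t :: ('b \<Rightarrow> ('n, 'k) mpoly) set). \<forall>b. coef (x b) 0 = 0)"
  proof (cases "i > 0")
    case False
    have "coef (x b) 0 = 0" if "x \<in> free_pieces B \<delta> t" for x :: "'b \<Rightarrow> ('n, 'k) mpoly" and b
    proof (cases "b \<in> B")
      case True
      then have "homogeneous (t - \<delta> b) (x b)" "t - \<delta> b \<noteq> int (monom_degree (0 :: 'n \<Rightarrow>\<^sub>0 nat))"
        using that assms False by (auto simp: free_pieces_def)
      then show ?thesis unfolding homogeneous_iff by metis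
    qed (use that in \<open>simp add: free_pieces_def\<close>)
    then show ?thesis by blast
  qed simp
qed (simp_all add: free_pieces_def homogeneous_shift')

lemma koszul_exact_trivial:
  fixes N :: "int \<Rightarrow> ('b \<Rightarrow> ('n::finite, 'k::field) mpoly) set"
  shows "N t \<subseteq> {0} \<Longrightarrow> 0 \<in> N (t - 1) \<Longrightarrow> koszul_exact N i t"
  unfolding koszul_exact_def
proof (intro allI impI, elim conjE)
  fix c :: "'n set \<Rightarrow> 'b \<Rightarrow> ('n, 'k) mpoly" assume "N t \<subseteq> {0}" "0 \<in> N (t - 1)" "\<forall>T. c T \<in> N t"
  moreover from this have "c = 0" by (intro ext) (metis singletonD subsetD zero_fun_apply)
  ultimately show "\<exists>c'. (\<forall>T. c' T \<in> N (t - 1)) \<and> (\<forall>T. card T \<noteq> Suc i \<longrightarrow> c' T = 0) \<and> koszul_d c' = c"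
    by (intro exI[of _ 0]) simp
qed

text \<open>
  A dimension shift along \<open>0 \<rightarrow> ker \<phi> \<rightarrow> G \<rightarrow> N \<rightarrow> 0\<close>, piece by piece: a cycle in the kernel is the boundary of
  a chain in \<open>G\<close>, the image of this chain is a cycle in \<open>N\<close>, hence a boundary there, and correcting the
  chain by a lift moves it into the kernel. The lift exists for free when the chains in question
  have more than \<open>n\<close> indices, since these are zero.
\<close>

lemma koszul_exact_kernel:
  fixes \<phi> :: "('b \<Rightarrow> ('n::finite, 'k::field) mpoly) \<Rightarrow> 'c \<Rightarrow> ('n, 'k) mpoly"
  assumes "graded_pieces G"
    and add: "\<And>x y. \<phi> (x + y) = \<phi> x + \<phi> y" and mult: "\<And>r x. \<phi> (\<lambda>b. r * x b) = (\<lambda>b. r * \<phi> x b)"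
    and maps: "\<And>x. x \<in> G (t - 1) \<Longrightarrow> \<phi> x \<in> N (t - 1)"
    and surj: "\<And>y. Suc (Suc i) \<le> CARD('n) \<Longrightarrow> y \<in> N (t - 1 - 1) \<Longrightarrow> \<exists>x\<in>G (t - 1 - 1). \<phi> x = y"
    and exG: "koszul_exact G i t" and exN: "koszul_exact N (Suc i) (t - 1)"
  shows "koszul_exact (\<lambda>t. {x \<in> G t. \<phi> x = 0}) i t"
  unfolding koszul_exact_def
proof (intro allI impI, elim conjE)
  interpret G: graded_pieces G by fact
  have phi0: "\<phi> 0 = 0" using mult[of 0 0] by (simp add: zero_fun_def)
  have phi_diff: "\<phi> (x - y) = \<phi> x - \<phi> y" for x y using add[of "x - y" y] by simp
  have phi_sum: "\<phi> (\<lambda>b. \<Sum>a\<in>A. f a b) = (\<lambda>b. \<Sum>a\<in>A. \<phi> (f a) b)" if "finite A" for f and A :: "'n set"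
    using that
  proof (induction A rule: finite_induct)
    case (insert a A)
    then have "\<phi> (f a + (\<lambda>b. \<Sum>a\<in>A. f a b)) = \<phi> (f a) + (\<lambda>b. \<Sum>a\<in>A. \<phi> (f a) b)" by (simp only: add)
    then show ?case using insert by (simp add: plus_fun_def)
  qed (use phi0 in \<open>simp add: zero_fun_def\<close>)
  have phi_d: "\<phi> (koszul_d c T) = koszul_d (\<lambda>T. \<phi> (c T)) T" for c T
    by (simp add: koszul_d_def[abs_def] phi_sum mult)
  fix c :: "'n set \<Rightarrow> 'b \<Rightarrow> ('n, 'k) mpoly"
  assume c: "\<forall>T. c T \<in> {x \<in> G t. \<phi> x = 0}" "\<forall>T. card T \<noteq> i \<longrightarrow> c T = 0" "koszul_d c = 0"
  then obtain c' where c': "\<And>T. c' T \<in> G (t - 1)" "\<And>T. card T \<noteq> Suc i \<Longrightarrow> c' T = 0" "koszul_d c' = c"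
    using exG unfolding koszul_exact_def by blast
  have "koszul_d (\<lambda>T. \<phi> (c' T)) = 0"
    using c(1) by (intro ext) (simp flip: phi_d add: c'(3))
  moreover have "\<forall>T. card T \<noteq> Suc i \<longrightarrow> \<phi> (c' T) = 0" using c'(2) phi0 by auto
  ultimately obtain e where e: "\<And>T. e T \<in> N (t - 1 - 1)" "\<And>T. card T \<noteq> Suc (Suc i) \<Longrightarrow> e T = 0"
      "koszul_d e = (\<lambda>T. \<phi> (c' T))"
    using exN[unfolded koszul_exact_def, THEN spec[of _ "\<lambda>T. \<phi> (c' T)"]] maps[OF c'(1)] by auto
  have "\<exists>x. x \<in> G (t - 1 - 1) \<and> \<phi> x = e T \<and> (e T = 0 \<longrightarrow> x = 0)" for T
  proof (cases "e T = 0")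
    case True
    then show ?thesis using G.zero phi0 by auto
  next
    case False
    then have "Suc (Suc i) = card T" using e(2) by metis
    also have "\<dots> \<le> CARD('n)" by (rule card_mono) auto
    finally show ?thesis using surj[OF _ e(1)] False by blast
  qed
  then obtain e' where e': "\<And>T. e' T \<in> G (t - 1 - 1)" "\<And>T. \<phi> (e' T) = e T" "\<And>T. e T = 0 \<Longrightarrow> e' T = 0"
    by metis
  define z where "z = c' - koszul_d e'"
  have "z T \<in> {x \<in> G (t - 1). \<phi> x = 0}" for T
  proof -
    have "koszul_d e' T \<in> G (t - 1)" using G.koszul_d[of e' "t - 1 - 1" T] e'(1) by simp
    moreover have "\<phi> (koszul_d e' T) = \<phi> (c' T)" using e(3) by (simp add: phi_d e'(2))
    ultimately show ?thesis using c'(1) by (simp add: z_def G.diff phi_diff)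
  qed
  moreover have "z T = 0" if "card T \<noteq> Suc i" for T
  proof -
    have "e' (insert j T) = 0" if "j \<notin> T" for j
      using \<open>card T \<noteq> Suc i\<close> that by (intro e'(3) e(2)) simp
    then have "koszul_d e' T = 0" by (intro ext) (simp add: koszul_d_def)
    then show ?thesis using c'(2) that by (simp add: z_def)
  qed
  moreover have "koszul_d z = c" by (simp add: z_def koszul_d_diff koszul_d_d c'(3))
  ultimately show "\<exists>c'. (\<forall>T. c' T \<in> {x \<in> G (t - 1). \<phi> x = 0}) \<and> (\<forall>T. card T \<noteq> Suc i \<longrightarrow> c' T = 0) \<and> koszul_d c' = c"
    by blast
qed

section \<open>Finite dimension of the homogeneous pieces\<close>

definition monomials :: "nat \<Rightarrow> ('n::finite \<Rightarrow>\<^sub>0 nat) set" where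
  "monomials d = {u. monom_degree u = d}"

lemma finite_monomials [simp]: "finite (monomials d :: ('n::finite \<Rightarrow>\<^sub>0 nat) set)"
proof (induction d)
  case 0
  then show ?case by (simp add: monomials_def monom_degree_eq_0_iff)
next
  case (Suc d)
  have "monomials (Suc d) \<subseteq> (\<Union>i. (\<lambda>u. u + unit_exp i) ` (monomials d :: ('n \<Rightarrow>\<^sub>0 nat) set))"
  proof
    fix u :: "'n \<Rightarrow>\<^sub>0 nat" assume u: "u \<in> monomials (Suc d)"
    then obtain i where i: "coef u i \<noteq> 0"
      by (metis (mono_tags, lifting) mem_Collect_eq monom_degree_zero monomials_def nat.distinct(1) poly_mapping_eqI lookup_zero)
    then have "u - unit_exp i \<in> monomials d" using u monom_degree_diff_unit[OF i] by (simp add: monomials_def)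
    then have "u \<in> (\<lambda>u. u + unit_exp i) ` monomials d"
      by (rule rev_image_eqI) (rule unit_exp_le(2)[OF i, symmetric])
    then show "u \<in> (\<Union>i. (\<lambda>u. u + unit_exp i) ` monomials d)" by blast
  qed
  then show ?case by (rule finite_subset) (use Suc in simp)
qed

text \<open>Both sides count the pairs of a monomial of degree \<open>d + 1\<close> and one of its \<open>d + 1\<close> factors.\<close>

lemma card_monomials_Suc:
  "Suc d * card (monomials (Suc d) :: ('n::finite \<Rightarrow>\<^sub>0 nat) set)
    = (d + CARD('n)) * card (monomials d :: ('n \<Rightarrow>\<^sub>0 nat) set)"
proof -
  have "Suc d * card (monomials (Suc d) :: ('n \<Rightarrow>\<^sub>0 nat) set) =
      (\<Sum>u\<in>(monomials (Suc d) :: ('n \<Rightarrow>\<^sub>0 nat) set). \<Sum>i\<in>UNIV. coef u i)"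
    by (simp add: monomials_def monom_degree_def)
  also have "\<dots> = (\<Sum>(u, i)\<in>(monomials (Suc d) :: ('n \<Rightarrow>\<^sub>0 nat) set) \<times> UNIV. coef u i)"
    by (subst sum.cartesian_product[symmetric]) simp
  also have "\<dots> = (\<Sum>(u, i)\<in>(monomials d :: ('n \<Rightarrow>\<^sub>0 nat) set) \<times> UNIV. Suc (coef u i))"
  proof -
    define P where "P = {(u :: 'n \<Rightarrow>\<^sub>0 nat, i). u \<in> monomials (Suc d) \<and> coef u i \<noteq> 0}"
    have "(\<Sum>(u, i)\<in>(monomials (Suc d) :: ('n \<Rightarrow>\<^sub>0 nat) set) \<times> UNIV. coef u i) = (\<Sum>(u, i)\<in>P. coef u i)"
      by (rule sum.mono_neutral_right) (auto simp: P_def)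
    also have "\<dots> = (\<Sum>(u, i)\<in>(monomials d :: ('n \<Rightarrow>\<^sub>0 nat) set) \<times> UNIV. Suc (coef u i))"
    proof (rule sum.reindex_bij_witness[of P "\<lambda>(u, i). (u + unit_exp i, i)" "\<lambda>(u, i). (u - unit_exp i, i)"])
      fix a assume "a \<in> P"
      then obtain u i where a: "a = (u, i)" "monom_degree u = Suc d" and ui: "coef u i \<noteq> 0"
        by (auto simp: P_def monomials_def)
      have "coef u i = Suc (coef (u - unit_exp i) i)"
        using ui by (simp add: lookup_minus)
      then show "(case (case a of (u, i) \<Rightarrow> (u - unit_exp i, i)) of (u, i) \<Rightarrow> Suc (coef u i)) = (case a of (u, i) \<Rightarrow> coef u i)"
        by (simp add: a)
      show "(case a of (u, i) \<Rightarrow> (u - unit_exp i, i)) \<in> monomials d \<times> UNIV"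
        using a monom_degree_diff_unit[OF ui] by (simp add: monomials_def)
      show "(case (case a of (u, i) \<Rightarrow> (u - unit_exp i, i)) of (u, i) \<Rightarrow> (u + unit_exp i, i)) = a"
        using unit_exp_le(2)[OF ui] by (simp add: a)
    qed (auto simp: P_def monomials_def monom_degree_add lookup_add)
    finally show ?thesis .
  qed
  also have "\<dots> = (\<Sum>u\<in>(monomials d :: ('n \<Rightarrow>\<^sub>0 nat) set). \<Sum>i\<in>UNIV. Suc (coef u i))"
    by (rule sum.cartesian_product[symmetric])
  also have "\<dots> = (\<Sum>u\<in>(monomials d :: ('n \<Rightarrow>\<^sub>0 nat) set). d + CARD('n))"
    by (intro sum.cong refl) (simp add: monomials_def monom_degree_def sum_Suc)
  finally show ?thesis by simp
qed

lemma vec_sum_apply: "(\<Sum>a\<in>A. f a) b = (\<Sum>a\<in>A. f a b)" for f :: "'a \<Rightarrow> 'b \<Rightarrow> 'c::comm_monoid_add"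
  by (induction A rule: infinite_finite_induct) auto

definition monomial_vec :: "'b \<Rightarrow> ('n \<Rightarrow>\<^sub>0 nat) \<Rightarrow> 'b \<Rightarrow> ('n, 'k::comm_ring_1) mpoly" where
  "monomial_vec b u = (\<lambda>b'. if b' = b then Poly_Mapping.single u 1 else 0)"

lemma vec_in_span_monomials:
  fixes x :: "'b \<Rightarrow> ('n::finite, 'k::field) mpoly"
  assumes B: "finite B" "\<And>b. b \<notin> B \<Longrightarrow> x b = 0" and hom: "\<And>b. b \<in> B \<Longrightarrow> homogeneous (d b) (x b)"
  shows "x \<in> vec_space.span ((\<lambda>(b, u). monomial_vec b u) ` (SIGMA b:B. monomials (nat (d b))))"
proof -
  let ?P = "SIGMA b:B. (monomials (nat (d b)) :: ('n \<Rightarrow>\<^sub>0 nat) set)"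
  have fin: "finite ?P" using B by auto
  have "x = (\<Sum>q\<in>?P. vec_scale (coef (x (fst q)) (snd q)) (monomial_vec (fst q) (snd q)))"
  proof (intro ext poly_mapping_eqI)
    fix b v
    have "coef ((\<Sum>q\<in>?P. vec_scale (coef (x (fst q)) (snd q)) (monomial_vec (fst q) (snd q))) b) v
        = (\<Sum>q\<in>?P. if q = (b, v) then coef (x b) v else 0)"
      unfolding vec_sum_apply lookup_sum
      by (intro sum.cong refl) (auto simp: vec_scale_def monomial_vec_def lookup_single when_def)
    also have "\<dots> = (if (b, v) \<in> ?P then coef (x b) v else 0)" using fin by simp
    also have "\<dots> = coef (x b) v"
    proof (cases "coef (x b) v = 0")
      case False
      then have "b \<in> B" using B(2)[of b] by (metis lookup_zero)
      moreover from this have "int (monom_degree v) = d b" using hom False by (simp add: homogeneous_iff)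
      ultimately show ?thesis by (auto simp: monomials_def)
    qed simp
    finally show "coef (x b) v =
      coef ((\<Sum>q\<in>?P. vec_scale (coef (x (fst q)) (snd q)) (monomial_vec (fst q) (snd q))) b) v" by simp
  qed
  moreover have "(\<Sum>q\<in>?P. vec_scale (coef (x (fst q)) (snd q)) (monomial_vec (fst q) (snd q)))
      \<in> vec_space.span ((\<lambda>(b, u). monomial_vec b u) ` ?P)"
    by (intro vec_space.span_sum vec_space.span_scale vec_space.span_base) (auto intro!: rev_image_eqI)
  ultimately show ?thesis by simp
qed

text \<open>This is the homotopy on chains without indices.\<close>

lemma homogeneous_Var_shift:
  fixes r :: "('n::finite, 'k::comm_ring_1) mpoly"
  assumes "homogeneous d r" "d > 0" shows "r = (\<Sum>j\<in>UNIV. Var j * shift j r)"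
proof -
  define c where "c T = (\<lambda>b::unit. if T = {} then r else 0)" for T :: "'n set"
  have lv: "least_var {j} = j" for j :: 'n by (rule least_var_eqI) auto
  have "coef r 0 = 0" using assms unfolding homogeneous_iff by (metis less_irrefl monom_degree_zero of_nat_0)
  then have "koszul_d (koszul_h c) {} () = c {} ()"
    by (intro koszul_homotopy) (auto simp: c_def koszul_d_def)
  then show ?thesis by (simp add: koszul_d_def koszul_h_def koszul_sign_def lv c_def)
qed

lemma (in graded_pieces) homogeneous_mult:
  assumes "homogeneous d r" "x \<in> N s" shows "(\<lambda>b. r * x b) \<in> N (s + d)"
proof (cases "d < 0")
  case True
  then have "r = 0" using assms(1) homogeneous_negative by blast
  then show ?thesis using zero by (simp add: zero_fun_def)
next
  case False
  have "(\<lambda>b. r * x b) \<in> N (s + int k)" if "homogeneous (int k) r" for k r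
    using that
  proof (induction k arbitrary: r)
    case 0
    then have "r = Const (coef r 0)" by (intro homogeneous_degree_0) simp
    then show ?case using scale[OF assms(2), of "coef r 0"] by (simp add: vec_scale_def)
  next
    case (Suc k)
    have "homogeneous (int k) (shift j r)" for j using homogeneous_shift[OF Suc.prems, of j] by simp
    then have "(\<lambda>b. \<Sum>j\<in>UNIV. Var j * (shift j r * x b)) \<in> N (s + int k + 1)"
      by (intro sum Var_mult Suc.IH)
    moreover have "(\<lambda>b. \<Sum>j\<in>UNIV. Var j * (shift j r * x b)) = (\<lambda>b. r * x b)"
    proof
      fix b
      have "(\<Sum>j\<in>UNIV. Var j * (shift j r * x b)) = (\<Sum>j\<in>UNIV. Var j * shift j r) * x b"
        by (simp add: sum_distrib_right mult.assoc)
      then show "(\<Sum>j\<in>UNIV. Var j * (shift j r * x b)) = r * x b"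
        using homogeneous_Var_shift[OF Suc.prems] by simp
    qed
    ultimately show ?case by (simp add: algebra_simps)
  qed
  from this[of "nat d" r] show ?thesis using assms(1) False by simp
qed

lemma graded_pieces_kernel:
  fixes \<phi> :: "('b \<Rightarrow> ('n::finite, 'k::field) mpoly) \<Rightarrow> 'c \<Rightarrow> ('n, 'k) mpoly"
  assumes "graded_pieces G"
    and add: "\<And>x y. \<phi> (x + y) = \<phi> x + \<phi> y" and mult: "\<And>r x. \<phi> (\<lambda>b. r * x b) = (\<lambda>b. r * \<phi> x b)"
  shows "graded_pieces (\<lambda>t. {x \<in> G t. \<phi> x = 0})"
proof -
  interpret G: graded_pieces G by fact
  have "\<phi> 0 = 0" using mult[of 0 0] by (simp add: zero_fun_def)
  then show ?thesis
    by unfold_locales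
      (auto simp: G.zero G.add G.scale G.Var_mult add mult vec_scale_def[abs_def], auto simp: zero_fun_def G.scale[unfolded vec_scale_def])
qed

section \<open>Linear resolutions\<close>

text \<open>
  A chain with \<open>i\<close> indices and coefficients in \<open>N t\<close> has internal degree \<open>i + t\<close>. So the conditions say that the
  Koszul homology \<open>H\<^sub>i(N)\<close>, which is \<open>Tor\<^sub>i(N, K)\<close>, lives in internal degree \<open>i + e\<close> and vanishes for
  \<open>i \<ge> p\<close>. In other words, a nonzero \<open>N\<close> is generated in degree \<open>e\<close>, and it has a linear resolution with
  at most \<open>p\<close> free modules. Finite dimension of the lowest piece gives them finite rank.
\<close>

definition linear_module ::
    "(int \<Rightarrow> ('b \<Rightarrow> ('n::finite, 'k::field) mpoly) set) \<Rightarrow> int \<Rightarrow> nat \<Rightarrow> bool" where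
  "linear_module N e p \<longleftrightarrow> graded_pieces N \<and> (\<forall>t<e. N t \<subseteq> {0}) \<and>
     (\<exists>Y. finite Y \<and> N e \<subseteq> vec_space.span Y) \<and>
     (\<forall>i t. t > e \<longrightarrow> koszul_exact N i t) \<and> (\<forall>i t. p \<le> i \<longrightarrow> koszul_exact N i t)"

definition combination :: "nat \<Rightarrow> (nat \<Rightarrow> 'b \<Rightarrow> 'a::comm_ring_1) \<Rightarrow> (nat \<Rightarrow> 'a) \<Rightarrow> 'b \<Rightarrow> 'a" where
  "combination \<beta> v w = (\<lambda>b. \<Sum>j<\<beta>. w j * v j b)"

definition syzygies ::
    "nat \<Rightarrow> (nat \<Rightarrow> 'b \<Rightarrow> ('n::finite, 'k::field) mpoly) \<Rightarrow> int \<Rightarrow> int \<Rightarrow> (nat \<Rightarrow> ('n, 'k) mpoly) set" where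
  "syzygies \<beta> v e t = {w \<in> free_pieces {..<\<beta>} (\<lambda>_. e) t. combination \<beta> v w = 0}"

lemma combination_add: "combination \<beta> v (x + y) = combination \<beta> v x + combination \<beta> v y"
  by (simp add: combination_def fun_eq_iff distrib_right sum.distrib)

lemma combination_mult: "combination \<beta> v (\<lambda>j. r * x j) = (\<lambda>b. r * combination \<beta> v x b)"
  by (simp add: combination_def fun_eq_iff sum_distrib_left mult.assoc)

lemma koszul_exact_0_generates:
  assumes "graded_pieces N" "koszul_exact N 0 t" "y \<in> N t"
  shows "\<exists>z. (\<forall>j. z j \<in> N (t - 1)) \<and> y = (\<lambda>b. \<Sum>j\<in>UNIV. Var j * z j b)"
proof -
  interpret graded_pieces N by fact
  define c where "c T = (if T = {} then y else 0)" for T :: "'b set"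
  have "koszul_d c = 0" by (intro ext) (simp add: koszul_d_def c_def)
  moreover have "\<forall>T. c T \<in> N t" using assms(3) zero by (simp add: c_def)
  moreover have "\<forall>T. card T \<noteq> 0 \<longrightarrow> c T = 0" by (auto simp: c_def)
  ultimately obtain c' where c': "\<forall>T. c' T \<in> N (t - 1)" "koszul_d c' = c"
    using assms(2) unfolding koszul_exact_def by blast
  have "y b = (\<Sum>j\<in>UNIV. Var j * c' {j} b)" for b
  proof -
    have "y b = koszul_d c' {} b" by (simp add: c'(2) c_def)
    then show ?thesis by (simp add: koszul_d_def koszul_sign_def)
  qed
  then show ?thesis using c'(1) by (intro exI[of _ "\<lambda>j. c' {j}"]) auto
qed

text \<open>
  One step of the minimal resolution: a basis of the lowest piece generates the module, and the
  dimension shift \<open>H\<^sub>i\<close> of the syzygies \<open>= H\<^sub>i\<^sub>+\<^sub>1(N)\<close> makes the module of syzygies linear again.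
  When \<open>p = 0\<close>, already \<open>H\<^sub>0(N) = 0\<close>, so \<open>N = 0\<close> by the graded Nakayama lemma, and the resolution stops.
\<close>

lemma linear_module_step:
  fixes N :: "int \<Rightarrow> ('b \<Rightarrow> ('n::finite, 'k::field) mpoly) set"
  assumes N: "linear_module N e p"
  shows "\<exists>\<beta> v. (\<forall>j<\<beta>. v j \<in> N e) \<and>
    (\<forall>t. \<forall>y\<in>N t. \<exists>w\<in>free_pieces {..<\<beta>} (\<lambda>_. e) t. combination \<beta> v w = y) \<and>
    linear_module (syzygies \<beta> v e) (e + 1) (p - 1) \<and> (p = 0 \<longrightarrow> \<beta> = 0)"
proof -
  interpret graded_pieces N using N by (simp add: linear_module_def)
  have gN: "graded_pieces N" by unfold_locales
  have low: "N t \<subseteq> {0}" if "t < e" for t using N that by (simp add: linear_module_def)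
  have exact: "koszul_exact N i t" if "t > e \<or> p \<le> i" for i t using N that by (auto simp: linear_module_def)
  obtain Y where Y: "finite Y" "N e \<subseteq> vec_space.span Y" using N by (auto simp: linear_module_def)
  obtain B where B: "B \<subseteq> N e" "vec_space.independent B" "N e \<subseteq> vec_space.span B"
    using vec_space.maximal_independent_subset[of "N e"] by blast
  have "B \<subseteq> vec_space.span Y" using B(1) Y(2) by (rule subset_trans)
  then have "finite B" using vec_space.independent_span_bound[OF Y(1) B(2)] by blast
  then obtain v where v0: "bij_betw v {0..<card B} B" using ex_bij_betw_nat_finite by blast
  define \<beta> where "\<beta> = card B"
  have v: "bij_betw v {..<\<beta>} B" using v0 by (simp add: \<beta>_def atLeast0LessThan)
  have vN: "v j \<in> N e" if "j < \<beta>" for j using v B(1) that by (auto simp: bij_betw_def)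
  let ?F = "free_pieces {..<\<beta>} (\<lambda>_. e) :: int \<Rightarrow> (nat \<Rightarrow> ('n, 'k) mpoly) set"
  interpret F: graded_pieces ?F by (rule graded_pieces_free)
  have maps: "combination \<beta> v w \<in> N t" if w: "w \<in> ?F t" for w t
    unfolding combination_def
  proof (intro sum)
    fix j assume j: "j \<in> {..<\<beta>}"
    then have "homogeneous (t - e) (w j)" using w by (simp add: free_pieces_def)
    from homogeneous_mult[OF this vN] j show "(\<lambda>b. w j * v j b) \<in> N t" by simp
  qed
  have gen_e: "\<exists>w\<in>?F e. combination \<beta> v w = y" if y: "y \<in> N e" for y
  proof -
    have "y \<in> range (\<lambda>c. \<Sum>x\<in>B. vec_scale (c x) x)"
      using y B(3) vec_space.span_finite[OF \<open>finite B\<close>] by auto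
    then obtain c where "y = (\<Sum>x\<in>B. vec_scale (c x) x)" by auto
    also have "\<dots> = (\<Sum>j<\<beta>. vec_scale (c (v j)) (v j))" by (rule sum.reindex_bij_betw[OF v, symmetric])
    also have "\<dots> = combination \<beta> v (\<lambda>j. if j < \<beta> then Const (c (v j)) else 0)"
      by (rule ext) (simp add: vec_sum_apply vec_scale_def combination_def)
    finally have "combination \<beta> v (\<lambda>j. if j < \<beta> then Const (c (v j)) else 0) = y" by simp
    moreover have "(\<lambda>j. if j < \<beta> then Const (c (v j)) else 0) \<in> ?F e" by (simp add: free_pieces_def)
    ultimately show ?thesis by blast
  qed
  have gen_above: "\<exists>w\<in>?F (e + int k). combination \<beta> v w = y" if "y \<in> N (e + int k)" for y k
    using that
  proof (induction k arbitrary: y)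
    case 0
    then show ?case using gen_e by simp
  next
    case (Suc k)
    obtain z where z: "\<And>j. z j \<in> N (e + int k)" "y = (\<lambda>b. \<Sum>j\<in>UNIV. Var j * z j b)"
      using koszul_exact_0_generates[OF gN exact Suc.prems] by auto
    have "\<forall>j. \<exists>w. w \<in> ?F (e + int k) \<and> combination \<beta> v w = z j" using Suc.IH[OF z(1)] by blast
    then obtain w where w: "\<And>j. w j \<in> ?F (e + int k)" "\<And>j. combination \<beta> v (w j) = z j" by metis
    have "combination \<beta> v (\<lambda>b. \<Sum>j\<in>UNIV. Var j * w j b) = y"
      unfolding z(2) w(2)[symmetric] combination_def sum_distrib_left sum_distrib_right
      by (rule ext, subst sum.swap) (simp add: mult.assoc)
    moreover have "(\<lambda>b. \<Sum>j\<in>UNIV. Var j * w j b) \<in> ?F (e + int k + 1)"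
      by (intro F.sum F.Var_mult w)
    ultimately show ?case by (auto simp: add.assoc add.commute[of 1])
  qed
  have gen: "\<exists>w\<in>?F t. combination \<beta> v w = y" if y: "y \<in> N t" for t y
  proof (cases "t < e")
    case True
    then have "y = 0" using low y by blast
    then show ?thesis using F.zero[of t] by (auto simp: combination_def fun_eq_iff intro!: bexI[of _ 0])
  next
    case False
    then show ?thesis using gen_above[of y "nat (t - e)"] y by simp
  qed
  have syz_low: "syzygies \<beta> v e t \<subseteq> {0}" if t: "t < e + 1" for t
  proof
    fix w assume w: "w \<in> syzygies \<beta> v e t"
    then have hom: "homogeneous (t - e) (w j)" if "j < \<beta>" for j using that by (simp add: syzygies_def free_pieces_def)
    have zero: "combination \<beta> v w = 0" using w by (simp add: syzygies_def)
    have "w j = 0" if j: "j < \<beta>" for j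
    proof (cases "t < e")
      case True
      then show ?thesis using homogeneous_negative[OF hom[OF j]] by simp
    next
      case False
      then have const: "w i = Const (coef (w i) 0)" if "i < \<beta>" for i
        using homogeneous_degree_0[of "w i"] hom[OF that] t by simp
      define u where "u x = coef (w (inv_into {..<\<beta>} v x)) 0" for x
      have u: "u (v i) = coef (w i) 0" if "i < \<beta>" for i
        using v that by (simp add: u_def bij_betw_def inv_into_f_f)
      have "(\<Sum>x\<in>B. vec_scale (u x) x) = (\<Sum>i<\<beta>. vec_scale (u (v i)) (v i))"
        by (rule sum.reindex_bij_betw[OF v, symmetric])
      also have "\<dots> = (\<lambda>b. \<Sum>i<\<beta>. w i * v i b)"
        unfolding fun_eq_iff vec_sum_apply vec_scale_def
        by (intro allI sum.cong refl) (metis const lessThan_iff u)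
      also have "\<dots> = 0" using zero by (simp add: combination_def)
      finally have "u (v j) = 0"
        by (rule vec_space.independentD[OF B(2) \<open>finite B\<close> subset_refl]) (use v j in \<open>auto simp: bij_betw_def\<close>)
      then show ?thesis using u[OF j] const[OF j] by simp
    qed
    moreover have "w j = 0" if "\<not> j < \<beta>" for j using w that by (simp add: syzygies_def free_pieces_def)
    ultimately show "w \<in> {0}" by (auto simp: fun_eq_iff)
  qed
  have gS: "graded_pieces (syzygies \<beta> v e)"
    using graded_pieces_kernel[OF graded_pieces_free combination_add[of \<beta> v] combination_mult[of \<beta> v]]
    by (simp add: syzygies_def[abs_def])
  have syz_exact: "koszul_exact (syzygies \<beta> v e) i t" if "t > e + 1 \<or> p - 1 \<le> i" for i t
  proof (cases "t < e + 1")
    case True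
    then show ?thesis using syz_low graded_pieces.zero[OF gS] by (intro koszul_exact_trivial) auto
  next
    case False
    then have "koszul_exact ?F i t" by (intro koszul_exact_free) auto
    moreover have "koszul_exact N (Suc i) (t - 1)" using that by (intro exact) auto
    ultimately show ?thesis
      unfolding syzygies_def[abs_def]
      by (intro koszul_exact_kernel[OF graded_pieces_free combination_add[of \<beta> v] combination_mult[of \<beta> v]])
        (use maps gen in auto)
  qed
  have "\<beta> = 0" if "p = 0"
  proof -
    have "N e \<subseteq> {0}"
    proof
      fix y assume "y \<in> N e"
      then obtain z where z: "\<And>j. z j \<in> N (e - 1)" "y = (\<lambda>b. \<Sum>j\<in>UNIV. Var j * z j b)"
        using koszul_exact_0_generates[OF gN exact] \<open>p = 0\<close> by blast
      have "z j = 0" for j using z(1)[of j] low[of "e - 1"] by auto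
      then show "y \<in> {0}" using z(2) by (simp add: zero_fun_def)
    qed
    then have "B = {}" using B(1,2) vec_space.dependent_zero by blast
    then show ?thesis by (simp add: \<beta>_def)
  qed
  moreover have "\<exists>Y. finite Y \<and> syzygies \<beta> v e (e + 1) \<subseteq> vec_space.span Y"
  proof (intro exI conjI subsetI)
    fix w assume "w \<in> syzygies \<beta> v e (e + 1)"
    then show "w \<in> vec_space.span ((\<lambda>(b, u). monomial_vec b u) ` (SIGMA b:{..<\<beta>}. monomials (nat 1)))"
      by (intro vec_in_span_monomials) (auto simp: syzygies_def free_pieces_def)
  qed auto
  then have "linear_module (syzygies \<beta> v e) (e + 1) (p - 1)"
    using gS syz_low syz_exact by (simp add: linear_module_def)
  ultimately show ?thesis using vN gen by blast
qed

section \<open>The derivations that annihilate a generic arrangement\<close>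

lemma (in vector_space) spanning_family:
  assumes fin: "finite Q" "finite Y" and card: "card Y \<le> card Q"
    and x: "\<And>q. q \<in> Q \<Longrightarrow> x q \<in> span Y"
    and ind: "\<forall>c. (\<Sum>q\<in>Q. scale (c q) (x q)) = 0 \<longrightarrow> (\<forall>q\<in>Q. c q = 0)"
    and y: "y \<in> span Y"
  shows "\<exists>c. y = (\<Sum>q\<in>Q. scale (c q) (x q))"
proof -
  have inj: "inj_on x Q"
  proof (rule inj_onI, rule ccontr)
    fix q q' assume q: "q \<in> Q" "q' \<in> Q" "x q = x q'" "q \<noteq> q'"
    define c where "c r = (if r = q then 1 else if r = q' then - 1 else (0 :: 'a))" for r
    have "(\<Sum>r\<in>Q. scale (c r) (x r)) = (\<Sum>r\<in>{q, q'}. scale (c r) (x r))"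
      using fin(1) q by (intro sum.mono_neutral_right) (auto simp: c_def)
    also have "\<dots> = 0" using q by (auto simp: c_def)
    finally have "c q = 0" using ind q(1) by blast
    then show False by (simp add: c_def)
  qed
  have "independent (x ` Q)"
  proof (rule independent_if_scalars_zero)
    fix f v assume "(\<Sum>v\<in>x ` Q. scale (f v) v) = 0" "v \<in> x ` Q"
    then show "f v = 0" using spec[OF ind, of "\<lambda>q. f (x q)"] by (auto simp: sum.reindex[OF inj])
  qed (use fin in simp)
  then have "Y \<subseteq> span (x ` Q)"
    by (rule spanning_set_in_span_of_independent[OF fin(2)]) (use x card in \<open>auto simp: card_image[OF inj]\<close>)
  then have "span Y \<subseteq> span (x ` Q)" by (rule span_minimal) (rule subspace_span)
  then have "y \<in> range (\<lambda>u. \<Sum>v\<in>x ` Q. scale (u v) v)"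
    using y span_finite[of "x ` Q"] fin by auto
  then obtain u where "y = (\<Sum>v\<in>x ` Q. scale (u v) v)" by auto
  then have "y = (\<Sum>q\<in>Q. scale (u (x q)) (x q))" by (simp add: sum.reindex[OF inj])
  then show ?thesis by (intro exI[of _ "\<lambda>q. u (x q)"])
qed

lemma Const_mult_single: "Const c * Poly_Mapping.single u d = Poly_Mapping.single u (c * d)"
  by (simp add: Const_def mult_single)

lemma lookup_sum_single:
  "finite A \<Longrightarrow> u \<in> A \<Longrightarrow> coef (\<Sum>v\<in>A. Poly_Mapping.single v (g v)) u = g u"
  by (simp add: lookup_sum lookup_single when_def)

lemma homogeneous_sum_monomials:
  "homogeneous (int d) (\<Sum>u\<in>monomials d. Poly_Mapping.single u (g u))"
  by (intro homogeneous_sum) (auto simp: monomials_def intro: homogeneous_single)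

context generic_forms
begin

lemma deriv_form_add: "deriv_form (\<lambda>j. \<theta> j + \<theta>' j) k = deriv_form \<theta> k + deriv_form \<theta>' k"
  by (simp add: deriv_form_def distrib_left sum.distrib)

lemma deriv_form_mult: "deriv_form (\<lambda>j. r * \<theta> j) k = r * deriv_form \<theta> k"
  by (simp add: deriv_form_def sum_distrib_left mult.left_commute)

lemma deriv_form_sum: "deriv_form (\<lambda>j. \<Sum>i\<in>A. Var i * \<theta> i j) k = (\<Sum>i\<in>A. Var i * deriv_form (\<theta> i) k)"
  unfolding deriv_form_def sum_distrib_left by (subst sum.swap) (simp add: mult.left_commute)

text \<open>
  In degree \<open>d = m - n\<close> the map \<open>(\<theta>, a) \<mapsto> (\<theta>(l\<^sub>k) - l\<^sub>k a\<^sub>k)\<^sub>k\<close>, where \<open>\<Sum>\<^sub>k a\<^sub>k = 0\<close>, is injective because there are no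
  annihilating derivations of this degree. Its source and target have the same dimension, for
  \<open>n dim R\<^sub>d + (m - 1) dim R\<^sub>d\<^sub>-\<^sub>1 = m dim R\<^sub>d\<close>, so it is surjective. The family below is the image of a
  monomial basis of the source.
\<close>

definition image_family :: "'n \<times> ('n \<Rightarrow>\<^sub>0 nat) + nat \<times> ('n \<Rightarrow>\<^sub>0 nat) \<Rightarrow> nat \<Rightarrow> ('n, 'k) mpoly" where
  "image_family q = (case q of
     Inl (j, u) \<Rightarrow> (\<lambda>k. if k < m then Const (lcoef (l k) j) * Poly_Mapping.single u 1 else 0)
   | Inr (i, u) \<Rightarrow> (\<lambda>k. if k = i then - (l k * Poly_Mapping.single u 1)
       else if k = m - 1 then l k * Poly_Mapping.single u 1 else 0))"

lemma image_family_combination: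
  fixes c :: "'n \<times> ('n \<Rightarrow>\<^sub>0 nat) + nat \<times> ('n \<Rightarrow>\<^sub>0 nat) \<Rightarrow> 'k"
  assumes "finite U" "finite U'" and k: "k < m"
  defines "A i \<equiv> \<Sum>u\<in>U'. Poly_Mapping.single u (c (Inr (i, u)))"
  shows "(\<Sum>q\<in>(UNIV \<times> U) <+> ({..<m - 1} \<times> U'). vec_scale (c q) (image_family q)) k =
    deriv_form (\<lambda>j. \<Sum>u\<in>U. Poly_Mapping.single u (c (Inl (j, u)))) k
    - l k * (if k < m - 1 then A k else - (\<Sum>i<m - 1. A i))"
proof -
  have "(\<Sum>q\<in>(UNIV \<times> U) <+> ({..<m - 1} \<times> U'). vec_scale (c q) (image_family q)) k =
      (\<Sum>(j, u)\<in>UNIV \<times> U. Const (c (Inl (j, u))) * image_family (Inl (j, u)) k)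
      + (\<Sum>(i, u)\<in>{..<m - 1} \<times> U'. Const (c (Inr (i, u))) * image_family (Inr (i, u)) k)"
    using assms(1,2) unfolding vec_sum_apply
    by (subst sum.Plus) (auto simp: vec_scale_def case_prod_unfold)
  also have "(\<Sum>(j, u)\<in>UNIV \<times> U. Const (c (Inl (j, u))) * image_family (Inl (j, u)) k)
      = deriv_form (\<lambda>j. \<Sum>u\<in>U. Poly_Mapping.single u (c (Inl (j, u)))) k"
    unfolding sum.cartesian_product[symmetric] deriv_form_def sum_distrib_left
    by (intro sum.cong refl) (simp add: image_family_def k Const_mult_single, simp only: mult.commute)
  also have "(\<Sum>(i, u)\<in>{..<m - 1} \<times> U'. Const (c (Inr (i, u))) * image_family (Inr (i, u)) k)
      = (\<Sum>i<m - 1. if k = i then - (l k * A i) else if k = m - 1 then l k * A i else 0)"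
    unfolding sum.cartesian_product[symmetric]
  proof (intro sum.cong refl)
    fix i
    have lA: "l k * A i = (\<Sum>u\<in>U'. Const (c (Inr (i, u))) * (l k * Poly_Mapping.single u 1))"
      unfolding A_def sum_distrib_left
      by (intro sum.cong refl) (simp add: mult.left_commute Const_mult_single)
    show "(\<Sum>u\<in>U'. Const (c (Inr (i, u))) * image_family (Inr (i, u)) k) =
        (if k = i then - (l k * A i) else if k = m - 1 then l k * A i else 0)"
      unfolding lA by (simp add: image_family_def sum_negf)
  qed
  also have "\<dots> = - (l k * (if k < m - 1 then A k else - (\<Sum>i<m - 1. A i)))"
  proof (cases "k < m - 1")
    case True
    have "(\<Sum>i<m - 1. if k = i then - (l k * A i) else if k = m - 1 then l k * A i else 0) =
        (\<Sum>i<m - 1. if k = i then - (l k * A i) else 0)" using True by (intro sum.cong refl) auto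
    then show ?thesis using True by simp
  next
    case False
    then have "(\<Sum>i<m - 1. if k = i then - (l k * A i) else if k = m - 1 then l k * A i else 0) =
        (\<Sum>i<m - 1. l k * A i)" using k by (intro sum.cong refl) auto
    then show ?thesis using False by (simp add: sum_distrib_left)
  qed
  finally show ?thesis by simp
qed

lemma quotient_deriv_surjective_lowest:
  assumes w: "\<And>k. k < m \<Longrightarrow> homogeneous (int (m - CARD('n))) (w k)"
  shows "\<exists>\<theta> a. (\<forall>j. homogeneous (int (m - CARD('n))) (\<theta> j)) \<and>
    (\<forall>k. homogeneous (int (m - CARD('n)) - 1) (a k)) \<and> (\<Sum>k<m. a k) = 0 \<and>
    (\<forall>k<m. w k = deriv_form \<theta> k - l k * a k)"
proof -
  define e where "e = m - CARD('n) - 1"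
  have d: "m - CARD('n) = Suc e" and m1: "m - 1 = e + CARD('n)" and m: "m = Suc (m - 1)"
    using size_gt_dim by (auto simp: e_def)
  let ?U = "monomials (Suc e) :: ('n \<Rightarrow>\<^sub>0 nat) set" and ?U' = "monomials e :: ('n \<Rightarrow>\<^sub>0 nat) set"
  define Q where "Q = ((UNIV :: 'n set) \<times> ?U) <+> ({..<m - 1} \<times> ?U')"
  define Y where "Y = (\<lambda>(b, u). monomial_vec b u :: nat \<Rightarrow> ('n, 'k) mpoly) ` (SIGMA b:{..<m}. monomials (nat (int (Suc e))))"
  have fin: "finite Q" "finite Y" by (auto simp: Q_def Y_def)
  have "card Y \<le> m * card ?U"
  proof -
    have "card Y \<le> card (SIGMA b:{..<m}. (monomials (nat (int (Suc e))) :: ('n \<Rightarrow>\<^sub>0 nat) set))"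
      unfolding Y_def by (rule card_image_le) auto
    then show ?thesis by (simp add: card_SigmaI del: of_nat_Suc)
  qed
  also have "\<dots> = card Q"
  proof -
    have "card Q = CARD('n) * card ?U + (m - 1) * card ?U'"
      by (simp add: Q_def card_Plus card_cartesian_product)
    also have "(m - 1) * card ?U' = Suc e * card ?U"
      unfolding m1 by (rule card_monomials_Suc[symmetric])
    also have "CARD('n) * card ?U + Suc e * card ?U = m * card ?U"
    proof -
      have "m = CARD('n) + Suc e" using d size_gt_dim by simp
      then show ?thesis by (simp only: add_mult_distrib)
    qed
    finally show ?thesis by simp
  qed
  finally have card: "card Y \<le> card Q" .
  define \<theta> where "\<theta> c j = (\<Sum>u\<in>?U. Poly_Mapping.single u (c (Inl (j, u)) :: 'k))"
    for c :: "'n \<times> ('n \<Rightarrow>\<^sub>0 nat) + nat \<times> ('n \<Rightarrow>\<^sub>0 nat) \<Rightarrow> 'k" and j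
  define A where "A c i = (\<Sum>u\<in>?U'. Poly_Mapping.single u (c (Inr (i, u)) :: 'k))"
    for c :: "'n \<times> ('n \<Rightarrow>\<^sub>0 nat) + nat \<times> ('n \<Rightarrow>\<^sub>0 nat) \<Rightarrow> 'k" and i :: nat
  define a where "a c k = (if k < m - 1 then A c k else - (\<Sum>i<m - 1. A c i))" for c k
  have comb: "(\<Sum>q\<in>Q. vec_scale (c q) (image_family q)) k = deriv_form (\<theta> c) k - l k * a c k" if "k < m" for c k
    using image_family_combination[OF finite_monomials finite_monomials that, of c "Suc e" e]
    by (simp add: Q_def \<theta>_def[abs_def] A_def a_def)
  have hom_\<theta>: "homogeneous (int (Suc e)) (\<theta> c j)" for c j unfolding \<theta>_def by (rule homogeneous_sum_monomials)
  have hom_a: "homogeneous (int e) (a c k)" for c k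
    unfolding a_def A_def by (auto intro!: homogeneous_uminus homogeneous_sum homogeneous_sum_monomials)
  have sum_a: "(\<Sum>k<m. a c k) = 0" for c
    by (subst m) (simp add: a_def)
  have fam: "image_family q \<in> vec_space.span Y" if "q \<in> Q" for q
    unfolding Y_def
  proof (rule vec_in_span_monomials)
    fix b assume b: "b \<in> {..<m}"
    have "0 < m" using size_gt_dim by simp
    have *: "homogeneous (int (Suc e)) (l b * Poly_Mapping.single u 1)" if "u \<in> ?U'" "b < m" for u b
      using homogeneous_mult[of 1 "l b" "int e" "Poly_Mapping.single u 1"] homogeneous_single[of u "1 :: 'k"] that
      by (simp add: monomials_def)
    have **: "homogeneous (int (Suc e)) (Const c * Poly_Mapping.single u (1 :: 'k))" if "u \<in> ?U" for u c
      using homogeneous_single[of u "1 :: 'k"] that by (intro homogeneous_Const_mult) (simp add: monomials_def)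
    show "homogeneous (int (Suc e)) (image_family q b)"
      using that b \<open>0 < m\<close> unfolding Q_def image_family_def
      by (auto simp del: of_nat_Suc intro!: homogeneous_uminus * **)
  qed (use that m in \<open>auto simp: image_family_def Q_def\<close>)
  have ind: "c q = 0" if zero: "(\<Sum>q\<in>Q. vec_scale (c q) (image_family q)) = 0" and q: "q \<in> Q" for c q
  proof -
    have eq: "deriv_form (\<theta> c) k = l k * a c k" if "k < m" for k
      using comb[OF that, of c] zero by simp
    have e: "int e \<le> int m - int CARD('n) - 1" using size_gt_dim by (simp add: e_def)
    have "a c k = 0" if "k < m" for k
      by (rule low_degree_derivation_zero(1)[of "int e" "a c" "\<theta> c"]) (use hom_a e eq sum_a that in auto)
    moreover have "\<theta> c j = 0" for j
      by (rule low_degree_derivation_zero(2)[of "int e" "a c" "\<theta> c"]) (use hom_a e eq sum_a in auto)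
    moreover have "coef (\<theta> c j) u = c (Inl (j, u))" if "u \<in> ?U" for j u
      unfolding \<theta>_def by (rule lookup_sum_single) (use that in auto)
    moreover have "coef (a c i) u = c (Inr (i, u))" if "i < m - 1" "u \<in> ?U'" for i u
      unfolding a_def A_def using that lookup_sum_single[of ?U' u] by simp
    ultimately show "c q = 0" using q unfolding Q_def by (fastforce elim!: PlusE)
  qed
  define w' where "w' k = (if k < m then w k else 0)" for k
  have "w' \<in> vec_space.span Y" unfolding Y_def
    by (rule vec_in_span_monomials) (use w d in \<open>auto simp: w'_def simp del: of_nat_Suc\<close>)
  moreover have "\<forall>c. (\<Sum>q\<in>Q. vec_scale (c q) (image_family q)) = 0 \<longrightarrow> (\<forall>q\<in>Q. c q = 0)"
    using ind by blast
  ultimately obtain c where c: "w' = (\<Sum>q\<in>Q. vec_scale (c q) (image_family q))"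
    using vec_space.spanning_family[of Q Y image_family w', OF fin card fam] by blast
  have "w k = deriv_form (\<theta> c) k - l k * a c k" if "k < m" for k
    using fun_cong[OF c, of k] comb[OF that, of c] that by (simp add: w'_def)
  then show ?thesis using hom_\<theta> hom_a sum_a d
    by (intro exI[of _ "\<theta> c"] exI[of _ "a c"]) auto
qed

text \<open>Upwards from the lowest degree, a form of positive degree is a combination of the variables.\<close>

lemma quotient_deriv_surjective:
  assumes "t \<ge> int (m - CARD('n))" "\<And>k. k < m \<Longrightarrow> homogeneous t (w k)"
  shows "\<exists>\<theta> a. (\<forall>j. homogeneous t (\<theta> j)) \<and> (\<forall>k. homogeneous (t - 1) (a k)) \<and> (\<Sum>k<m. a k) = 0 \<and>
    (\<forall>k<m. w k = deriv_form \<theta> k - l k * a k)"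
  using assms
proof (induction t arbitrary: w rule: int_ge_induct)
  case base
  then show ?case by (rule quotient_deriv_surjective_lowest)
next
  case (step t)
  have "\<exists>\<theta> a. (\<forall>j. homogeneous t (\<theta> j)) \<and> (\<forall>k. homogeneous (t - 1) (a k)) \<and> (\<Sum>k<m. a k) = 0 \<and>
      (\<forall>k<m. shift i (w k) = deriv_form \<theta> k - l k * a k)" for i
    by (rule step.IH) (use homogeneous_shift[of "t + 1"] step.prems in auto)
  then obtain \<theta> a where *: "\<And>i j. homogeneous t (\<theta> i j)" "\<And>i k. homogeneous (t - 1) (a i k)"
      "\<And>i. (\<Sum>k<m. a i k) = 0" "\<And>i k. k < m \<Longrightarrow> shift i (w k) = deriv_form (\<theta> i) k - l k * a i k"
    by metis
  show ?case
  proof (intro exI conjI allI impI)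
    show "homogeneous (t + 1) (\<Sum>i\<in>UNIV. Var i * \<theta> i j)" for j
      using * by (intro homogeneous_sum homogeneous_Var_mult)
    have "homogeneous (t - 1 + 1) (Var i * a i k)" for i k by (rule homogeneous_Var_mult[OF *(2)])
    then show "homogeneous (t + 1 - 1) (\<Sum>i\<in>UNIV. Var i * a i k)" for k
      by (intro homogeneous_sum) simp
    show "(\<Sum>k<m. \<Sum>i\<in>UNIV. Var i * a i k) = 0"
      by (subst sum.swap) (simp add: *(3) flip: sum_distrib_left)
    fix k assume k: "k < m"
    have "w k = (\<Sum>i\<in>UNIV. Var i * shift i (w k))"
      by (rule homogeneous_Var_shift[of "t + 1"]) (use step k in auto)
    also have "\<dots> = deriv_form (\<lambda>j. \<Sum>i\<in>UNIV. Var i * \<theta> i j) k - l k * (\<Sum>i\<in>UNIV. Var i * a i k)"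
      by (simp add: *(4)[OF k] deriv_form_sum right_diff_distrib sum_subtractf sum_distrib_left mult.left_commute)
    finally show "w k = deriv_form (\<lambda>j. \<Sum>i\<in>UNIV. Var i * \<theta> i j) k - l k * (\<Sum>i\<in>UNIV. Var i * a i k)" .
  qed
qed

subsection \<open>The annihilating derivations form a linear module\<close>

text \<open>
  An annihilating derivation \<open>\<theta>\<close> is stored together with its quotients \<open>a\<^sub>k = \<theta>(l\<^sub>k) / l\<^sub>k\<close>, as one vector. In
  this form these derivations are the kernel of a linear map to a free module, and the degree of the
  vector is that of \<open>\<theta>\<close>, one more than that of the quotients.
\<close>

definition pair_degree :: "'n + nat \<Rightarrow> int" where
  "pair_degree b = (case b of Inl _ \<Rightarrow> 0 | Inr _ \<Rightarrow> 1)"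

definition pairs :: "int \<Rightarrow> ('n + nat \<Rightarrow> ('n, 'k) mpoly) set" where
  "pairs t = {x \<in> free_pieces (range Inl \<union> Inr ` {..<m}) pair_degree t. (\<Sum>k<m. x (Inr k)) = 0}"

definition quotient_deriv :: "('n + nat \<Rightarrow> ('n, 'k) mpoly) \<Rightarrow> nat \<Rightarrow> ('n, 'k) mpoly" where
  "quotient_deriv x = (\<lambda>k. if k < m then deriv_form (\<lambda>j. x (Inl j)) k - l k * x (Inr k) else 0)"

definition annihilators :: "int \<Rightarrow> ('n + nat \<Rightarrow> ('n, 'k) mpoly) set" where
  "annihilators t = {x \<in> pairs t. quotient_deriv x = 0}"

lemma pairs_iff: "x \<in> pairs t \<longleftrightarrow> (\<forall>j. homogeneous t (x (Inl j))) \<and>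
    (\<forall>k<m. homogeneous (t - 1) (x (Inr k))) \<and> (\<forall>k\<ge>m. x (Inr k) = 0) \<and> (\<Sum>k<m. x (Inr k)) = 0"
proof -
  have mem: "Inl j \<in> range Inl \<union> Inr ` {..<m}" "Inr k \<in> range Inl \<union> Inr ` {..<m} \<longleftrightarrow> k < m"
    for j :: 'n and k by auto
  show ?thesis
    unfolding pairs_def free_pieces_def mem_Collect_eq split_sum_all mem pair_degree_def sum.case
    by (simp add: not_less) blast
qed

lemma quotient_deriv_add: "quotient_deriv (x + y) = quotient_deriv x + quotient_deriv y"
  by (auto simp: quotient_deriv_def fun_eq_iff deriv_form_add algebra_simps)

lemma quotient_deriv_mult: "quotient_deriv (\<lambda>b. r * x b) = (\<lambda>k. r * quotient_deriv x k)"
  by (auto simp: quotient_deriv_def fun_eq_iff deriv_form_mult algebra_simps)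

lemma graded_pieces_pairs: "graded_pieces pairs"
proof
  fix t x j assume "x \<in> pairs t"
  then show "(\<lambda>b. Var j * x b) \<in> pairs (t + 1)"
    using homogeneous_Var_mult[of "t - 1"] by (auto simp: pairs_iff homogeneous_Var_mult simp flip: sum_distrib_left)
qed (auto simp: pairs_iff vec_scale_def sum.distrib homogeneous_add homogeneous_Const_mult simp flip: sum_distrib_left)

lemma koszul_exact_pairs:
  assumes "i > 0 \<or> t > 1" shows "koszul_exact pairs i t"
proof (rule koszul_exact_if_shift_closed)
  fix x q assume x: "x \<in> pairs t"
  have "(\<Sum>k<m. shift q (x (Inr k))) = 0" using x by (simp add: pairs_iff flip: shift_sum)
  moreover have "homogeneous (t - 1 - 1) (shift q (x (Inr k)))" if "k < m" for k
    using x that by (intro homogeneous_shift) (simp add: pairs_iff)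
  ultimately show "(\<lambda>b. shift q (x b)) \<in> pairs (t - 1)"
    using x unfolding pairs_iff by (simp add: homogeneous_shift)
next
  show "0 \<in> pairs (t - 1)" by (rule graded_pieces.zero[OF graded_pieces_pairs])
  have "coef (x b) 0 = 0" if "t > 1" "x \<in> pairs t" for x b
  proof -
    have *: "coef p 0 = 0" if "homogeneous d p" "d > 0" for d and p :: "('n, 'k) mpoly"
      using that unfolding homogeneous_iff by (metis less_irrefl monom_degree_zero of_nat_0)
    show ?thesis
    proof (cases b)
      case (Inl j)
      then show ?thesis using that *[of t] by (simp add: pairs_iff)
    next
      case (Inr k)
      then show ?thesis using that *[of "t - 1"] by (cases "k < m") (simp_all add: pairs_iff)
    qed
  qed
  then show "i > 0 \<or> (\<forall>x\<in>pairs t. \<forall>b. coef (x b) 0 = 0)" using assms by blast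
qed

lemma quotient_deriv_pairs:
  assumes "x \<in> pairs t" shows "quotient_deriv x \<in> free_pieces {..<m} (\<lambda>_. 0) t"
proof -
  have "homogeneous t (l k * x (Inr k))" if "k < m" for k
    using homogeneous_mult[of 1 "l k" "t - 1" "x (Inr k)"] assms that by (simp add: pairs_iff)
  moreover have "homogeneous t (deriv_form (\<lambda>j. x (Inl j)) k)" for k
    unfolding deriv_form_def
    by (intro homogeneous_sum homogeneous_Const_mult) (use assms in \<open>simp add: pairs_iff\<close>)
  ultimately show ?thesis by (simp add: free_pieces_def quotient_deriv_def homogeneous_diff)
qed

text \<open>
  The first bound comes from surjectivity. The second one comes from the number of variables: the two
  dimension shifts lead from chains with \<open>i\<close> indices to chains with \<open>i + 2\<close> indices, which are zero if
  \<open>i \<ge> n - 1\<close>.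
\<close>

lemma linear_module_annihilators:
  "linear_module annihilators (int m - int CARD('n) + 1) (CARD('n) - 1)"
proof -
  define e where "e = int m - int CARD('n) + 1"
  have e: "e \<ge> 2" using size_gt_dim by (simp add: e_def)
  have "annihilators t \<subseteq> {0}" if t: "t < e" for t
  proof
    fix x assume "x \<in> annihilators t"
    then have x: "x \<in> pairs t" and q: "quotient_deriv x = 0" by (auto simp: annihilators_def)
    have eq: "deriv_form (\<lambda>j. x (Inl j)) k = l k * x (Inr k)" if "k < m" for k
      using fun_cong[OF q, of k] that by (simp add: quotient_deriv_def)
    have t': "t - 1 \<le> int m - int CARD('n) - 1" using t by (simp add: e_def)
    have sum: "(\<Sum>k<m. x (Inr k)) = 0" and hom: "homogeneous (t - 1) (x (Inr k))" if "k < m" for k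
      using x that by (auto simp: pairs_iff)
    have "x (Inl j) = 0" for j
      by (rule low_degree_derivation_zero(2)[of "t - 1" "\<lambda>k. x (Inr k)" "\<lambda>j. x (Inl j)"])
        (use hom t' eq x in \<open>auto simp: pairs_iff\<close>)
    moreover have "x (Inr k) = 0" if "k < m" for k
      by (rule low_degree_derivation_zero(1)[of "t - 1" "\<lambda>k. x (Inr k)" "\<lambda>j. x (Inl j)"])
        (use hom t' eq x that in \<open>auto simp: pairs_iff\<close>)
    moreover have "x (Inr k) = 0" if "\<not> k < m" for k using x that by (simp add: pairs_iff)
    ultimately have "x b = 0" for b by (cases b) blast+
    then show "x \<in> {0}" by (auto simp: fun_eq_iff)
  qed
  moreover have "graded_pieces annihilators"
    unfolding annihilators_def[abs_def]
    by (rule graded_pieces_kernel[OF graded_pieces_pairs quotient_deriv_add quotient_deriv_mult])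
  moreover have "\<exists>Y. finite Y \<and> annihilators e \<subseteq> vec_space.span Y"
  proof (intro exI conjI subsetI)
    let ?B = "range Inl \<union> Inr ` {..<m} :: ('n + nat) set"
    show "finite ((\<lambda>(b, u). monomial_vec b u :: 'n + nat \<Rightarrow> ('n, 'k) mpoly) ` (SIGMA b:?B. monomials (nat (e - pair_degree b))))"
      by auto
    fix x assume "x \<in> annihilators e"
    then show "x \<in> vec_space.span ((\<lambda>(b, u). monomial_vec b u) ` (SIGMA b:?B. monomials (nat (e - pair_degree b))))"
      by (intro vec_in_span_monomials) (auto simp: annihilators_def pairs_def free_pieces_def)
  qed
  moreover have "koszul_exact annihilators i t" if "t > e \<or> CARD('n) - 1 \<le> i" for i t
    unfolding annihilators_def[abs_def]
  proof (rule koszul_exact_kernel[OF graded_pieces_pairs quotient_deriv_add quotient_deriv_mult quotient_deriv_pairs])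
    show "koszul_exact pairs i t" using that e dim_ge_2 by (intro koszul_exact_pairs) auto
    show "koszul_exact (free_pieces {..<m} (\<lambda>_. 0) :: int \<Rightarrow> (nat \<Rightarrow> ('n, 'k) mpoly) set) (Suc i) (t - 1)"
      by (rule koszul_exact_free) simp
    fix y :: "nat \<Rightarrow> ('n, 'k) mpoly"
    assume i: "Suc (Suc i) \<le> CARD('n)" and y: "y \<in> free_pieces {..<m} (\<lambda>_. 0) (t - 1 - 1)"
    then have "t - 1 - 1 \<ge> int (m - CARD('n))" using that size_gt_dim by (auto simp: e_def)
    then obtain \<theta> a where *: "\<And>j. homogeneous (t - 1 - 1) (\<theta> j)" "\<And>k. homogeneous (t - 1 - 1 - 1) (a k)"
        "(\<Sum>k<m. a k) = 0" "\<And>k. k < m \<Longrightarrow> y k = deriv_form \<theta> k - l k * a k"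
      using quotient_deriv_surjective[of "t - 1 - 1" y] y by (auto simp: free_pieces_def)
    define x where "x b = (case b of Inl j \<Rightarrow> \<theta> j | Inr k \<Rightarrow> if k < m then a k else 0)" for b
    have "x \<in> pairs (t - 1 - 1)" using * by (simp add: pairs_iff x_def)
    moreover have "quotient_deriv x = y"
      using *(4) y by (auto simp: quotient_deriv_def x_def fun_eq_iff free_pieces_def)
    ultimately show "\<exists>x\<in>pairs (t - 1 - 1). quotient_deriv x = y" by blast
  qed
  ultimately show ?thesis unfolding linear_module_def e_def by blast
qed

end

section \<open>Depth\<close>

lemma in_jacobian_ideal_iff:
  fixes f :: "('n::finite, 'k::comm_ring_1) mpoly"
  shows "p \<in> jacobian_ideal f \<longleftrightarrow> (\<exists>r. p = (\<Sum>j\<in>UNIV. r j * mpderiv j f))"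
proof
  have "ideal.span (range (\<lambda>i. mpderiv i f)) \<subseteq> {p. \<exists>r. p = (\<Sum>j\<in>UNIV. r j * mpderiv j f)}"
  proof (rule ideal.span_minimal)
    show "range (\<lambda>i. mpderiv i f) \<subseteq> {p. \<exists>r. p = (\<Sum>j\<in>UNIV. r j * mpderiv j f)}"
    proof clarify
      fix i
      have "mpderiv i f = (\<Sum>j\<in>UNIV. (if j = i then 1 else 0) * mpderiv j f)"
        by (simp add: if_distrib[of "\<lambda>x. x * _"] cong: if_cong)
      then show "\<exists>r. mpderiv i f = (\<Sum>j\<in>UNIV. r j * mpderiv j f)"
        by (rule exI[of _ "\<lambda>j. if j = i then 1 else 0"])
    qed
    show "ideal.subspace {p. \<exists>r. p = (\<Sum>j\<in>UNIV. r j * mpderiv j f)}"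
    proof (rule ideal.subspaceI; clarify)
      show "\<exists>r. 0 = (\<Sum>j\<in>UNIV. r j * mpderiv j f)" by (intro exI[of _ "\<lambda>_. 0"]) simp
      fix r r' :: "'n \<Rightarrow> ('n, 'k) mpoly" and c
      show "\<exists>q. (\<Sum>j\<in>UNIV. r j * mpderiv j f) + (\<Sum>j\<in>UNIV. r' j * mpderiv j f) = (\<Sum>j\<in>UNIV. q j * mpderiv j f)"
        by (intro exI[of _ "\<lambda>j. r j + r' j"]) (simp add: distrib_right sum.distrib)
      show "\<exists>q. c * (\<Sum>j\<in>UNIV. r j * mpderiv j f) = (\<Sum>j\<in>UNIV. q j * mpderiv j f)"
        by (intro exI[of _ "\<lambda>j. c * r j"]) (simp add: sum_distrib_left mult.assoc)
    qed
  qed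
  then show "p \<in> jacobian_ideal f \<Longrightarrow> \<exists>r. p = (\<Sum>j\<in>UNIV. r j * mpderiv j f)"
    by (auto simp: jacobian_ideal_def)
  show "\<exists>r. p = (\<Sum>j\<in>UNIV. r j * mpderiv j f) \<Longrightarrow> p \<in> jacobian_ideal f"
    unfolding jacobian_ideal_def by clarify (intro ideal.span_sum ideal.span_scale ideal.span_base rangeI)
qed

lemma homogeneous_in_irrelevant_ideal:
  assumes "homogeneous d p" "d > 0" shows "p \<in> irrelevant_ideal"
proof -
  have "(\<Sum>j\<in>UNIV. shift j p * Var j) \<in> irrelevant_ideal"
    unfolding irrelevant_ideal_def by (intro ideal.span_sum ideal.span_scale ideal.span_base) auto
  moreover have "p = (\<Sum>j\<in>UNIV. shift j p * Var j)"
    using homogeneous_Var_shift[OF assms] by (simp only: mult.commute)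
  ultimately show ?thesis by simp
qed

lemma eval_at_origin: "eval_at (\<lambda>_. 0) p = coef p 0"
  by (induction p rule: mpoly_var_induct) (auto simp: lookup_Const lookup_add lookup_Var_mult)

lemma span_vanishing_at_origin:
  fixes S :: "('n::finite, 'k::comm_ring_1) mpoly set"
  assumes "\<And>p. p \<in> S \<Longrightarrow> coef p 0 = 0" "p \<in> ideal.span S" shows "coef p 0 = 0"
proof -
  have "ideal.span S \<subseteq> {p. eval_at (\<lambda>_. 0) p = 0}"
    using assms(1) by (intro ideal.span_minimal) (auto simp: ideal.subspace_def eval_at_origin[symmetric])
  then show ?thesis using assms(2) by (auto simp: eval_at_origin)
qed

lemma irrelevant_ideal_coef_0:
  fixes p :: "('n::finite, 'k::comm_ring_1) mpoly"
  shows "p \<in> irrelevant_ideal \<Longrightarrow> coef p 0 = 0"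
  unfolding irrelevant_ideal_def
proof (erule span_vanishing_at_origin[rotated])
  fix p :: "('n, 'k) mpoly" assume "p \<in> range Var"
  then obtain j where "p = Var j" by auto
  then show "coef p 0 = 0" using lookup_Var_mult[of j "1 :: ('n, 'k) mpoly" 0] by simp
qed

lemma power_of_irrelevant:
  fixes r :: "('n::finite, 'k::comm_ring_1) mpoly"
  assumes "coef r 0 = 0" "u \<in> Poly_Mapping.keys (r ^ N)" shows "N \<le> monom_degree u"
  using assms(2)
proof (induction N arbitrary: u)
  case (Suc N)
  then obtain a b where ab: "u = a + b" "a \<in> Poly_Mapping.keys r" "b \<in> Poly_Mapping.keys (r ^ N)"
    using keys_mult[of r "r ^ N"] by auto
  have "a \<noteq> 0" using ab(2) assms(1) by (auto simp: in_keys_iff)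
  then have "monom_degree a > 0" using monom_degree_eq_0_iff[of a] by simp
  then show ?case using Suc.IH[OF ab(3)] ab(1) by (simp add: monom_degree_add)
qed simp

context generic_forms
begin

text \<open>
  A vector \<open>w = (\<theta>(l\<^sub>k) - l\<^sub>k a\<^sub>k)\<^sub>k\<close> with \<open>\<Sum>\<^sub>k a\<^sub>k = 0\<close> has \<open>\<Sum>\<^sub>k w\<^sub>k f/l\<^sub>k = \<theta>(f) \<in> J\<close>. By surjectivity
  \<open>w = (q, 0, \<dots>, 0)\<close> is of this form.
\<close>

lemma homogeneous_mult_cofactor:
  assumes "homogeneous t q" "t \<ge> int (m - CARD('n))"
  shows "q * cofactor 0 \<in> jacobian_ideal (defining_polynomial m l)"
proof -
  define w where "w k = (if k = 0 then q else 0)" for k :: nat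
  have "homogeneous t (w k)" for k using assms(1) by (simp add: w_def)
  from quotient_deriv_surjective[of t w, OF assms(2) this]
  obtain \<theta> a where *: "(\<Sum>k<m. a k) = 0" "\<forall>k<m. w k = deriv_form \<theta> k - l k * a k" by blast
  have "(\<Sum>j\<in>UNIV. \<theta> j * mpderiv j (defining_polynomial m l)) = (\<Sum>k<m. w k * cofactor k)"
    using *(2) by (simp add: derivation_with_quotients[OF *(1)])
  also have "\<dots> = (\<Sum>k<m. if k = 0 then q * cofactor 0 else 0)" by (intro sum.cong) (auto simp: w_def)
  also have "\<dots> = q * cofactor 0" using size_gt_dim by simp
  finally show ?thesis unfolding in_jacobian_ideal_iff by metis
qed

text \<open>
  The class of the cofactor \<open>f / l\<^sub>0\<close> in \<open>R/J\<close> is nonzero and killed by a power of the irrelevant ideal, so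
  no element of that ideal is regular on \<open>R/J\<close>.
\<close>

lemma depth_zero: "depth_quotient irrelevant_ideal (jacobian_ideal (defining_polynomial m l)) = 0"
proof -
  let ?J = "jacobian_ideal (defining_polynomial m l)"
  have span_J: "ideal.span ?J = ?J" by (simp add: jacobian_ideal_def ideal.span_span)
  have cof: "cofactor 0 \<notin> ?J" using cofactor_not_combination by (auto simp: in_jacobian_ideal_iff)
  have J0: "coef p 0 = 0" if "p \<in> ?J" for p
    using that unfolding jacobian_ideal_def
  proof (rule span_vanishing_at_origin[rotated])
    fix p assume "p \<in> range (\<lambda>i. mpderiv i (defining_polynomial m l))"
    then obtain i where p: "p = mpderiv i (defining_polynomial m l)" by auto
    have "homogeneous (int m - 1) p" unfolding p by (rule homogeneous_mpderiv_defining_polynomial)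
    moreover have "int m - 1 \<noteq> int (monom_degree (0 :: 'n \<Rightarrow>\<^sub>0 nat))" using size_gt_dim dim_ge_2 by simp
    ultimately show "coef p 0 = 0" unfolding homogeneous_iff by metis
  qed
  have "coef p 0 = 0" if "p \<in> ideal.span (irrelevant_ideal \<union> ?J)" for p
    by (rule span_vanishing_at_origin[OF _ that]) (use J0 irrelevant_ideal_coef_0 in blast)
  then have "(1 :: ('n, 'k) mpoly) \<notin> ideal.span (irrelevant_ideal \<union> ?J)" by (metis lookup_one_zero zero_neq_one)
  then have proper: "ideal.span (irrelevant_ideal \<union> ?J) \<noteq> UNIV" by blast
  have "rs = []" if rs: "set rs \<subseteq> irrelevant_ideal" "regular_sequence_on_quotient ?J rs" for rs
  proof (rule ccontr)
    assume "rs \<noteq> []"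
    then obtain r rs' where rs': "rs = r # rs'" by (cases rs) auto
    have "\<forall>i<length rs. \<forall>p. rs ! i * p \<in> ideal.span (?J \<union> set (take i rs)) \<longrightarrow>
        p \<in> ideal.span (?J \<union> set (take i rs))"
      using rs(2) by (simp add: regular_sequence_on_quotient_def)
    from spec[OF this, of 0] have "\<forall>p. r * p \<in> ideal.span ?J \<longrightarrow> p \<in> ideal.span ?J"
      by (simp add: rs')
    then have reg: "p \<in> ?J" if "r * p \<in> ?J" for p using that by (simp add: span_J)
    have reg_power: "p \<in> ?J" if "r ^ N * p \<in> ?J" for N p
      using that by (induction N) (auto simp: mult.assoc intro: reg)
    define N where "N = m - CARD('n)"
    define D where "D = (\<lambda>u. int (monom_degree u)) ` Poly_Mapping.keys (r ^ N)"
    have "coef r 0 = 0" using rs(1) by (intro irrelevant_ideal_coef_0) (simp add: rs')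
    then have D: "d \<ge> int N" if "d \<in> D" for d
      using that power_of_irrelevant[of r] by (auto simp: D_def)
    have "(\<Sum>d\<in>D. hcomp d (r ^ N)) = r ^ N" by (rule hcomp_decomp) (auto simp: D_def)
    then have "r ^ N * cofactor 0 = (\<Sum>d\<in>D. hcomp d (r ^ N) * cofactor 0)"
      by (metis sum_distrib_right)
    also have "\<dots> \<in> ?J"
      unfolding jacobian_ideal_def
    proof (intro ideal.span_sum)
      fix d assume "d \<in> D"
      then show "hcomp d (r ^ N) * cofactor 0 \<in> ideal.span (range (\<lambda>i. mpderiv i (defining_polynomial m l)))"
        using homogeneous_mult_cofactor[OF homogeneous_hcomp, of d] D N_def by (simp add: jacobian_ideal_def)
    qed
    finally show False using reg_power cof by blast
  qed
  then have "{enat (length rs) | rs. set rs \<subseteq> irrelevant_ideal \<and> regular_sequence_on_quotient ?J rs} \<subseteq> {0}"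
    by (auto simp: zero_enat_def)
  then have "Sup {enat (length rs) | rs. set rs \<subseteq> irrelevant_ideal \<and> regular_sequence_on_quotient ?J rs} \<le> 0"
    by (intro Sup_least) auto
  then show ?thesis using proper by (simp add: depth_quotient_def)
qed

end

section \<open>The minimal graded free resolution\<close>

text \<open>Exactness in every degree implies exactness, since the entries of \<open>v\<close> all have the same degree.\<close>

lemma syzygies_generated:
  fixes v :: "nat \<Rightarrow> 'b \<Rightarrow> ('n::finite, 'k::field) mpoly"
  assumes hom: "\<And>j i. j < \<beta> \<Longrightarrow> homogeneous \<delta> (v j i)"
    and gen: "\<And>t y. y \<in> syzygies \<beta> v e t \<Longrightarrow> \<exists>w\<in>free_pieces {..<\<beta>'} (\<lambda>_. e') t. combination \<beta>' v' w = y"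
    and w: "\<And>j. \<not> j < \<beta> \<Longrightarrow> w j = 0" and zero: "combination \<beta> v w = 0"
  shows "\<exists>w'. (\<forall>j. \<not> j < \<beta>' \<longrightarrow> w' j = 0) \<and> combination \<beta>' v' w' = w"
proof -
  define D where "D = (\<lambda>u. int (monom_degree u)) ` (\<Union>j<\<beta>. Poly_Mapping.keys (w j))"
  have "finite D" by (auto simp: D_def)
  have w_decomp: "w j = (\<Sum>d\<in>D. hcomp d (w j))" for j
  proof (cases "j < \<beta>")
    case True
    show ?thesis by (rule hcomp_decomp[symmetric]) (use True \<open>finite D\<close> in \<open>auto simp: D_def\<close>)
  qed (simp add: w)
  have "(\<lambda>j. hcomp d (w j)) \<in> syzygies \<beta> v e (d + e)" for d
  proof -
    have "(\<Sum>j<\<beta>. hcomp d (w j) * v j i) = 0" for i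
    proof -
      have "(\<Sum>j<\<beta>. hcomp d (w j) * v j i) = hcomp (\<delta> + d) (\<Sum>j<\<beta>. v j i * w j)"
        unfolding hcomp_sum
        by (intro sum.cong refl, subst hcomp_mult[OF hom]) (simp_all only: lessThan_iff mult.commute)
      also have "(\<Sum>j<\<beta>. v j i * w j) = 0"
        using fun_cong[OF zero, of i] by (simp add: combination_def mult.commute)
      finally show ?thesis by simp
    qed
    then show ?thesis by (simp add: syzygies_def free_pieces_def w combination_def fun_eq_iff)
  qed
  then have "\<forall>d. \<exists>w'. w' \<in> free_pieces {..<\<beta>'} (\<lambda>_. e') (d + e) \<and> combination \<beta>' v' w' = (\<lambda>j. hcomp d (w j))"
    using gen by blast
  then obtain w' where w': "\<And>d. w' d \<in> free_pieces {..<\<beta>'} (\<lambda>_. e') (d + e)"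
      "\<And>d. combination \<beta>' v' (w' d) = (\<lambda>j. hcomp d (w j))" by metis
  have "combination \<beta>' v' (\<lambda>j. \<Sum>d\<in>D. w' d j) = w"
  proof
    fix i
    have "combination \<beta>' v' (\<lambda>j. \<Sum>d\<in>D. w' d j) i = (\<Sum>d\<in>D. combination \<beta>' v' (w' d) i)"
      unfolding combination_def sum_distrib_right by (rule sum.swap)
    also have "\<dots> = w i" unfolding w'(2) using w_decomp[of i] by simp
    finally show "combination \<beta>' v' (\<lambda>j. \<Sum>d\<in>D. w' d j) i = w i" .
  qed
  moreover have "(\<Sum>d\<in>D. w' d j) = 0" if "\<not> j < \<beta>'" for j
    using w'(1) that by (intro sum.neutral) (simp add: free_pieces_def)
  ultimately show ?thesis by (intro exI[of _ "\<lambda>j. \<Sum>d\<in>D. w' d j"]) simp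
qed

definition column_matrix :: "nat \<Rightarrow> nat \<Rightarrow> (nat \<Rightarrow> nat \<Rightarrow> 'a::comm_ring_1) \<Rightarrow> 'a mat" where
  "column_matrix r c v = mat r c (\<lambda>(i, j). v j i)"

definition vec_fun :: "'a::comm_ring_1 vec \<Rightarrow> nat \<Rightarrow> 'a" where
  "vec_fun x i = (if i < dim_vec x then x $ i else 0)"

lemma column_matrix_mult:
  assumes "x \<in> carrier_vec c"
  shows "column_matrix r c v *\<^sub>v x = vec r (combination c v (vec_fun x))"
proof (rule eq_vecI)
  fix i assume "i < dim_vec (vec r (combination c v (vec_fun x)))"
  then show "(column_matrix r c v *\<^sub>v x) $ i = vec r (combination c v (vec_fun x)) $ i"
    using assms by (auto simp: column_matrix_def combination_def scalar_prod_def vec_fun_def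
        lessThan_atLeast0 mult.commute intro!: sum.cong)
qed (simp add: column_matrix_def)

lemma kernel_eq_image_column_matrix:
  fixes v v' :: "nat \<Rightarrow> nat \<Rightarrow> 'a::comm_ring_1"
  assumes supp: "\<And>j i. j < c \<Longrightarrow> \<not> i < r \<Longrightarrow> v j i = 0" "\<And>j i. j < c' \<Longrightarrow> \<not> i < c \<Longrightarrow> v' j i = 0"
    and complex: "\<And>j. j < c' \<Longrightarrow> combination c v (v' j) = 0"
    and lift: "\<And>w. (\<And>j. \<not> j < c \<Longrightarrow> w j = 0) \<Longrightarrow> combination c v w = 0 \<Longrightarrow>
      \<exists>w'. (\<forall>j. \<not> j < c' \<longrightarrow> w' j = 0) \<and> combination c' v' w' = w"
  shows "mat_kernel (column_matrix r c v) = mat_image (column_matrix c c' v')"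
proof (intro subset_antisym subsetI)
  fix x assume "x \<in> mat_kernel (column_matrix r c v)"
  then have x: "x \<in> carrier_vec c" and "column_matrix r c v *\<^sub>v x = 0\<^sub>v r"
    by (auto simp: mat_kernel_def column_matrix_def)
  then have ker: "vec r (combination c v (vec_fun x)) = 0\<^sub>v r" by (simp add: column_matrix_mult)
  have "combination c v (vec_fun x) i = 0" for i
  proof (cases "i < r")
    case True
    then show ?thesis using arg_cong[OF ker, of "\<lambda>x. x $ i"] by simp
  next
    case False
    then show ?thesis by (simp add: combination_def supp)
  qed
  then have "combination c v (vec_fun x) = 0" by (simp add: fun_eq_iff)
  then obtain w' where w': "\<forall>j. \<not> j < c' \<longrightarrow> w' j = 0" "combination c' v' w' = vec_fun x"
    using lift[of "vec_fun x"] x by (auto simp: vec_fun_def)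
  have "vec_fun (vec c' w') = w'" using w'(1) by (auto simp: vec_fun_def)
  then have "column_matrix c c' v' *\<^sub>v vec c' w' = vec c (vec_fun x)"
    by (simp add: column_matrix_mult w'(2))
  also have "\<dots> = x" using x by (auto simp: vec_fun_def)
  finally show "x \<in> mat_image (column_matrix c c' v')"
    by (auto simp: mat_image_def column_matrix_def intro!: image_eqI[of _ _ "vec c' w'"])
next
  fix x assume "x \<in> mat_image (column_matrix c c' v')"
  then obtain y where y: "y \<in> carrier_vec c'" "x = column_matrix c c' v' *\<^sub>v y"
    by (auto simp: mat_image_def column_matrix_def)
  then have x: "x = vec c (combination c' v' (vec_fun y))" by (simp add: column_matrix_mult)
  have "combination c v (vec_fun x) i = 0" for i
  proof -
    have "combination c v (vec_fun x) i = (\<Sum>j<c. (\<Sum>k<c'. vec_fun y k * v' k j) * v j i)"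
      by (simp add: combination_def x vec_fun_def)
    also have "\<dots> = (\<Sum>k<c'. vec_fun y k * (\<Sum>j<c. v' k j * v j i))"
      unfolding sum_distrib_left sum_distrib_right by (subst sum.swap) (simp add: mult.assoc)
    also have "\<dots> = (\<Sum>k<c'. vec_fun y k * combination c v (v' k) i)" by (simp add: combination_def)
    finally show ?thesis by (simp add: complex)
  qed
  then have "column_matrix r c v *\<^sub>v x = 0\<^sub>v r"
    using x by (simp add: column_matrix_mult) (auto intro: eq_vecI)
  then show "x \<in> mat_kernel (column_matrix r c v)"
    using x by (simp add: mat_kernel_def column_matrix_def)
qed

text \<open>
  The number \<open>p\<close> that bounds the length drops by one in every step, and one step after it has reached \<open>0\<close>
  there are no generators left.
\<close>

lemma linear_resolution:
  fixes v0 :: "nat \<Rightarrow> nat \<Rightarrow> ('n::finite, 'k::field) mpoly"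
  assumes "linear_module (syzygies \<beta>0 v0 e) (e + 1) p"
  obtains \<beta> v where "\<beta> 0 = \<beta>0" "v 0 = v0"
    "\<And>k j. j < \<beta> (Suc k) \<Longrightarrow> v (Suc k) j \<in> syzygies (\<beta> k) (v k) (e + int k) (e + int k + 1)"
    "\<And>k t y. y \<in> syzygies (\<beta> k) (v k) (e + int k) t \<Longrightarrow>
      \<exists>w\<in>free_pieces {..<\<beta> (Suc k)} (\<lambda>_. e + int k + 1) t. combination (\<beta> (Suc k)) (v (Suc k)) w = y"
    "\<And>k. k > p \<Longrightarrow> \<beta> k = 0"
proof -
  define P where "P k x \<longleftrightarrow> (k = 0 \<longrightarrow> x = (\<beta>0, v0)) \<and>
      linear_module (syzygies (fst x) (snd x) (e + int k)) (e + int k + 1) (p - k)"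
    for k and x :: "nat \<times> (nat \<Rightarrow> nat \<Rightarrow> ('n, 'k) mpoly)"
  define Q where "Q k x y \<longleftrightarrow>
      (\<forall>j<fst y. snd y j \<in> syzygies (fst x) (snd x) (e + int k) (e + int k + 1)) \<and>
      (\<forall>t z. z \<in> syzygies (fst x) (snd x) (e + int k) t \<longrightarrow>
        (\<exists>w\<in>free_pieces {..<fst y} (\<lambda>_. e + int k + 1) t. combination (fst y) (snd y) w = z)) \<and>
      (k \<ge> p \<longrightarrow> fst y = 0)"
    for k and x y :: "nat \<times> (nat \<Rightarrow> nat \<Rightarrow> ('n, 'k) mpoly)"
  have "\<exists>f. \<forall>k. P k (f k) \<and> Q k (f k) (f (Suc k))"
  proof (rule dependent_nat_choice)
    show "\<exists>x. P 0 x" using assms by (intro exI[of _ "(\<beta>0, v0)"]) (simp add: P_def)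
    fix x k assume "P k x"
    then have "linear_module (syzygies (fst x) (snd x) (e + int k)) (e + int k + 1) (p - k)" by (simp add: P_def)
    from linear_module_step[OF this] obtain \<beta> v where *:
      "(\<forall>j<\<beta>. v j \<in> syzygies (fst x) (snd x) (e + int k) (e + int k + 1)) \<and>
       (\<forall>t. \<forall>y\<in>syzygies (fst x) (snd x) (e + int k) t.
         \<exists>w\<in>free_pieces {..<\<beta>} (\<lambda>_. e + int k + 1) t. combination \<beta> v w = y) \<and>
       linear_module (syzygies \<beta> v (e + int k + 1)) (e + int k + 1 + 1) (p - k - 1) \<and>
       (p - k = 0 \<longrightarrow> \<beta> = 0)"
      by (elim exE)
    have "P (Suc k) (\<beta>, v)" using * by (simp add: P_def add_ac)
    moreover have "Q k x (\<beta>, v)" using * by (simp add: Q_def)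
    ultimately show "\<exists>y. P (Suc k) y \<and> Q k x y" by blast
  qed
  then obtain f where f: "\<And>k. P k (f k)" "\<And>k. Q k (f k) (f (Suc k))" by blast
  have "fst (f k) = 0" if "k > p" for k using f(2)[of "k - 1"] that by (simp add: Q_def)
  moreover have "f 0 = (\<beta>0, v0)" using f(1)[of 0] by (simp add: P_def)
  ultimately show thesis
    using f(2) unfolding Q_def
    by (intro that[of "\<lambda>k. fst (f k)" "\<lambda>k. snd (f k)"]) auto
qed

subsection \<open>Resolving the Jacobian ideal\<close>

context generic_forms
begin

lemma annihilators_iff: "x \<in> annihilators t \<longleftrightarrow> x \<in> pairs t \<and>
    (\<forall>k<m. deriv_form (\<lambda>j. x (Inl j)) k = l k * x (Inr k))"
  by (auto simp: annihilators_def quotient_deriv_def fun_eq_iff)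

text \<open>Quotients are determined by the derivation, so relations among annihilating derivations ignore them.\<close>

lemma combination_annihilators_eq_0_iff:
  assumes v: "\<And>j. j < \<beta> \<Longrightarrow> v j \<in> annihilators t"
  shows "combination \<beta> v w = 0 \<longleftrightarrow> (\<forall>i. combination \<beta> v w (Inl i) = 0)"
proof
  assume L: "\<forall>i. combination \<beta> v w (Inl i) = 0"
  have "combination \<beta> v w (Inr k) = 0" for k
  proof (cases "k < m")
    case True
    have "l k * combination \<beta> v w (Inr k) = (\<Sum>j<\<beta>. w j * deriv_form (\<lambda>i. v j (Inl i)) k)"
      unfolding combination_def sum_distrib_left
      by (intro sum.cong refl) (use v True in \<open>simp add: annihilators_iff mult.left_commute\<close>)
    also have "\<dots> = deriv_form (\<lambda>i. combination \<beta> v w (Inl i)) k"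
      unfolding combination_def deriv_form_def sum_distrib_left
      by (subst sum.swap) (simp add: mult.left_commute)
    also have "\<dots> = 0" by (simp add: L deriv_form_def)
    finally show ?thesis using linear_form_mult_cancel[OF infinite_field] True by (metis form)
  next
    case False
    then have "v j (Inr k) = 0" if "j < \<beta>" for j using v[OF that] by (simp add: annihilators_def pairs_iff)
    then show ?thesis by (simp add: combination_def)
  qed
  with L show "combination \<beta> v w = 0" by (auto simp: fun_eq_iff split_sum_all)
qed simp

lemma annihilators_annihilate:
  assumes "x \<in> annihilators t"
  shows "(\<Sum>j\<in>UNIV. x (Inl j) * mpderiv j (defining_polynomial m l)) = 0"
  using assms derivation_with_quotients[of "\<lambda>k. x (Inr k)" "\<lambda>j. x (Inl j)"]
  by (simp add: annihilators_iff pairs_iff)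

lemma annihilating_derivation_in_annihilators:
  assumes "\<And>j. homogeneous t (\<theta> j)" "(\<Sum>j\<in>UNIV. \<theta> j * mpderiv j (defining_polynomial m l)) = 0"
  shows "\<exists>x\<in>annihilators t. \<forall>j. x (Inl j) = \<theta> j"
proof -
  obtain a where a: "\<forall>k<m. homogeneous (t - 1) (a k) \<and> deriv_form \<theta> k = l k * a k" "(\<Sum>k<m. a k) = 0"
    using annihilating_derivation_quotients[OF assms(2,1)] by blast
  define x where "x b = (case b of Inl j \<Rightarrow> \<theta> j | Inr k \<Rightarrow> if k < m then a k else 0)" for b
  have "x \<in> annihilators t" using a assms(1) by (simp add: annihilators_iff pairs_iff x_def)
  then show ?thesis by (intro bexI[of _ x]) (simp_all add: x_def)
qed

lemma minimal_resolution:
  "\<exists>b s g d. minimal_graded_free_resolution (jacobian_ideal (defining_polynomial m l)) s g d \<and>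
     s 0 = replicate (CARD('n)) (int m - 1) \<and>
     (\<forall>k\<in>{1..CARD('n) - 1}. s k = replicate (b k) (2 * int m - int (CARD('n)) + int k - 1)) \<and>
     (\<forall>k\<ge>CARD('n). s k = [])"
proof -
  let ?n = "CARD('n)" and ?f = "defining_polynomial m l"
  \<comment> \<open>The degree of the generating syzygies as derivations; in the grading of \<open>J\<close> it is \<open>m - 1\<close> higher.\<close>
  define E where "E = int m - int ?n + 1"
  have E: "E > 0" using size_gt_dim by (simp add: E_def)
  obtain en where en: "bij_betw en {0..<?n} (UNIV :: 'n set)"
    using ex_bij_betw_nat_finite[of "UNIV :: 'n set"] by auto
  have reindex: "(\<Sum>i<?n. h (en i)) = (\<Sum>j\<in>UNIV. h j)" for h :: "'n \<Rightarrow> ('n, 'k) mpoly"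
    using sum.reindex_bij_betw[OF en, of h] by (simp add: lessThan_atLeast0)
  define ne where "ne = inv_into {0..<?n} en"
  have ne: "ne j < ?n" "en (ne j) = j" for j
    using en inv_into_into[of j en "{0..<?n}"] f_inv_into_f[of j en "{0..<?n}"]
    by (auto simp: ne_def bij_betw_def)
  have ne_en: "ne (en i) = i" if "i < ?n" for i
    using en that by (auto simp: ne_def bij_betw_def inv_into_f_f)

  from linear_module_step[OF linear_module_annihilators] obtain \<beta>1 v1 where v1:
    "(\<forall>j<\<beta>1. v1 j \<in> annihilators E) \<and>
     (\<forall>t. \<forall>y\<in>annihilators t. \<exists>w\<in>free_pieces {..<\<beta>1} (\<lambda>_. E) t. combination \<beta>1 v1 w = y) \<and>
     linear_module (syzygies \<beta>1 v1 E) (E + 1) (?n - 1 - 1) \<and> (?n - 1 = 0 \<longrightarrow> \<beta>1 = 0)"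
    unfolding E_def by (elim exE)
  define \<theta>1 where "\<theta>1 j i = (if i < ?n then v1 j (Inl (en i)) else 0)" for j i
  have comb_\<theta>1: "combination \<beta>1 \<theta>1 w i = (if i < ?n then combination \<beta>1 v1 w (Inl (en i)) else 0)" for w i
    by (simp add: combination_def \<theta>1_def)
  \<comment> \<open>Forgetting the quotients does not change the syzygies.\<close>
  have "combination \<beta>1 v1 w = 0 \<longleftrightarrow> combination \<beta>1 \<theta>1 w = 0" for w
  proof -
    have "combination \<beta>1 v1 w = 0 \<longleftrightarrow> (\<forall>i. combination \<beta>1 v1 w (Inl i) = 0)"
      using v1 by (intro combination_annihilators_eq_0_iff) blast
    also have "\<dots> \<longleftrightarrow> combination \<beta>1 \<theta>1 w = 0"
      unfolding fun_eq_iff comb_\<theta>1 by (metis ne zero_fun_apply)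
    finally show ?thesis .
  qed
  then have "syzygies \<beta>1 v1 E = syzygies \<beta>1 \<theta>1 E" by (simp add: syzygies_def fun_eq_iff)
  then have "linear_module (syzygies \<beta>1 \<theta>1 E) (E + 1) (?n - 2)" using v1 by (simp add: numeral_2_eq_2)
  then obtain \<beta> v where res: "\<beta> 0 = \<beta>1" "v 0 = \<theta>1"
    "\<And>k j. j < \<beta> (Suc k) \<Longrightarrow> v (Suc k) j \<in> syzygies (\<beta> k) (v k) (E + int k) (E + int k + 1)"
    "\<And>k t y. y \<in> syzygies (\<beta> k) (v k) (E + int k) t \<Longrightarrow>
      \<exists>w\<in>free_pieces {..<\<beta> (Suc k)} (\<lambda>_. E + int k + 1) t. combination (\<beta> (Suc k)) (v (Suc k)) w = y"
    "\<And>k. k > ?n - 2 \<Longrightarrow> \<beta> k = 0"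
    using linear_resolution by blast

  define s where "s k = (if k = 0 then replicate ?n (int m - 1)
    else replicate (\<beta> (k - 1)) (2 * int m - int ?n + int k - 1))" for k
  define g where "g = vec ?n (\<lambda>i. mpderiv (en i) ?f)"
  define d where "d k = column_matrix (length (s k)) (length (s (Suc k))) (v k)" for k
  have len: "length (s 0) = ?n" "length (s (Suc k)) = \<beta> k" for k by (auto simp: s_def)

  have hom: "homogeneous (if k = 0 then E else 1) (v k j i)" if "j < \<beta> k" for k j i
  proof (cases k)
    case 0
    then show ?thesis using v1 that res(1,2) by (auto simp: \<theta>1_def annihilators_def pairs_iff)
  next
    case (Suc k')
    then have "v k j \<in> syzygies (\<beta> k') (v k') (E + int k') (E + int k' + 1)" using res(3) that by blast
    then show ?thesis using Suc by (cases "i < \<beta> k'") (auto simp: syzygies_def free_pieces_def)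
  qed
  have supp: "v k j i = 0" if "j < \<beta> k" "\<not> i < length (s k)" for k j i
  proof (cases k)
    case 0
    then show ?thesis using that res(2) by (simp add: \<theta>1_def len)
  next
    case (Suc k')
    then have "v k j \<in> syzygies (\<beta> k') (v k') (E + int k') (E + int k' + 1)" using res(3) that by blast
    then show ?thesis using Suc that by (simp add: syzygies_def free_pieces_def len)
  qed

  have exact: "mat_kernel (d k) = mat_image (d (Suc k))" for k
    unfolding d_def len(2)
  proof (rule kernel_eq_image_column_matrix)
    show "v k j i = 0" if "j < \<beta> k" "\<not> i < length (s k)" for j i using supp that by blast
    show "v (Suc k) j i = 0" if "j < \<beta> (Suc k)" "\<not> i < \<beta> k" for j i using supp[of j "Suc k" i] that by (simp add: len)
    show "combination (\<beta> k) (v k) (v (Suc k) j) = 0" if "j < \<beta> (Suc k)" for j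
      using res(3)[OF that] by (simp add: syzygies_def)
    show "\<exists>w'. (\<forall>j. \<not> j < \<beta> (Suc k) \<longrightarrow> w' j = 0) \<and> combination (\<beta> (Suc k)) (v (Suc k)) w' = w"
      if "\<And>j. \<not> j < \<beta> k \<Longrightarrow> w j = 0" "combination (\<beta> k) (v k) w = 0" for w
      by (rule syzygies_generated[OF hom res(4) that])
  qed

  \<comment> \<open>As a matrix with one row, the augmentation is treated like the differentials.\<close>
  define v0 where "v0 j i = (if i = 0 then mpderiv (en j) ?f else 0)" for j and i :: nat
  have g_prod: "g \<bullet> x = combination ?n v0 (vec_fun x) 0" if "x \<in> carrier_vec ?n" for x
    using that by (auto simp: scalar_prod_def g_def combination_def v0_def vec_fun_def
        lessThan_atLeast0 mult.commute intro!: sum.cong)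
  have "{x \<in> carrier_vec ?n. g \<bullet> x = 0} = mat_kernel (column_matrix 1 ?n v0)"
  proof (intro subset_antisym subsetI)
    fix x assume "x \<in> {x \<in> carrier_vec ?n. g \<bullet> x = 0}"
    then have x: "x \<in> carrier_vec ?n" "combination ?n v0 (vec_fun x) 0 = 0" using g_prod by auto
    then have "column_matrix 1 ?n v0 *\<^sub>v x = 0\<^sub>v 1" by (simp add: column_matrix_mult) (auto intro: eq_vecI)
    then show "x \<in> mat_kernel (column_matrix 1 ?n v0)" using x by (simp add: mat_kernel_def column_matrix_def)
  next
    fix x assume "x \<in> mat_kernel (column_matrix 1 ?n v0)"
    then have x: "x \<in> carrier_vec ?n" and "column_matrix 1 ?n v0 *\<^sub>v x = 0\<^sub>v 1"
      by (auto simp: mat_kernel_def column_matrix_def)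
    then have x: "x \<in> carrier_vec ?n" "vec 1 (combination ?n v0 (vec_fun x)) = 0\<^sub>v 1"
      by (simp_all add: column_matrix_mult)
    from arg_cong[OF x(2), of "\<lambda>y. y $ 0"] show "x \<in> {x \<in> carrier_vec ?n. g \<bullet> x = 0}"
      using x(1) g_prod by simp
  qed
  also have "\<dots> = mat_image (column_matrix ?n (\<beta> 0) (v 0))"
  proof (rule kernel_eq_image_column_matrix)
    show "v0 j i = 0" if "j < ?n" "\<not> i < 1" for j i using that by (simp add: v0_def)
    show "v 0 j i = 0" if "j < \<beta> 0" "\<not> i < ?n" for j i using supp[of j 0 i] that by (simp add: len)
    show "combination ?n v0 (v 0 j) = 0" if "j < \<beta> 0" for j
    proof
      fix i
      have "(\<Sum>i<?n. v1 j (Inl (en i)) * mpderiv (en i) ?f) = 0"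
        using reindex[of "\<lambda>j'. v1 j (Inl j') * mpderiv j' ?f"] annihilators_annihilate[of "v1 j" E] v1 that
        by (simp add: res(1))
      then show "combination ?n v0 (v 0 j) i = 0 i"
        by (cases "i = 0") (simp_all add: combination_def v0_def res(2) \<theta>1_def)
    qed
    have gen: "\<exists>w\<in>free_pieces {..<\<beta> 0} (\<lambda>_. E) t. combination (\<beta> 0) (v 0) w = y"
      if y: "y \<in> syzygies ?n v0 0 t" for t y
    proof -
      have hom_y: "homogeneous t (y i)" for i
        using y by (cases "i < ?n") (auto simp: syzygies_def free_pieces_def)
      have "(\<Sum>i<?n. y i * mpderiv (en i) ?f) = combination ?n v0 y 0" by (simp add: combination_def v0_def)
      also have "\<dots> = 0" using y by (simp add: syzygies_def)
      finally have "(\<Sum>i<?n. y (ne (en i)) * mpderiv (en i) ?f) = 0" by (simp add: ne_en)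
      then have "(\<Sum>j\<in>UNIV. y (ne j) * mpderiv j ?f) = 0"
        using reindex[of "\<lambda>j. y (ne j) * mpderiv j ?f"] by simp
      then obtain x where x: "x \<in> annihilators t" "\<forall>j. x (Inl j) = y (ne j)"
        using annihilating_derivation_in_annihilators[of t "\<lambda>j. y (ne j)"] hom_y by blast
      then obtain w where w: "w \<in> free_pieces {..<\<beta>1} (\<lambda>_. E) t" "combination \<beta>1 v1 w = x" using v1 by blast
      have "y i = 0" if "\<not> i < ?n" for i using y that by (simp add: syzygies_def free_pieces_def)
      then have "combination \<beta>1 \<theta>1 w = y" by (simp add: fun_eq_iff comb_\<theta>1 w(2) x(2) ne_en)
      then show ?thesis using w(1) res(1,2) by auto
    qed
    show "\<exists>w'. (\<forall>j. \<not> j < \<beta> 0 \<longrightarrow> w' j = 0) \<and> combination (\<beta> 0) (v 0) w' = w"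
      if "\<And>j. \<not> j < ?n \<Longrightarrow> w j = 0" "combination ?n v0 w = 0" for w
    proof (rule syzygies_generated[OF _ gen that])
      show "homogeneous (int m - 1) (v0 j i)" for j i
        by (simp add: v0_def homogeneous_mpderiv_defining_polynomial)
    qed
  qed
  finally have exact0: "{x \<in> carrier_vec ?n. g \<bullet> x = 0} = mat_image (d 0)" by (simp add: d_def len)

  have image: "(\<lambda>x. g \<bullet> x) ` carrier_vec ?n = jacobian_ideal ?f"
  proof (intro subset_antisym subsetI)
    fix p assume "p \<in> (\<lambda>x. g \<bullet> x) ` carrier_vec ?n"
    then obtain x where x: "x \<in> carrier_vec ?n" "p = g \<bullet> x" by blast
    have "p = (\<Sum>i<?n. vec_fun x (ne (en i)) * mpderiv (en i) ?f)"
      using x by (simp add: g_prod combination_def v0_def ne_en)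
    also have "\<dots> = (\<Sum>j\<in>UNIV. vec_fun x (ne j) * mpderiv j ?f)"
      by (rule reindex)
    finally show "p \<in> jacobian_ideal ?f"
      unfolding in_jacobian_ideal_iff by (rule exI[of _ "\<lambda>j. vec_fun x (ne j)"])
  next
    fix p assume "p \<in> jacobian_ideal ?f"
    then obtain r where "p = (\<Sum>j\<in>UNIV. r j * mpderiv j ?f)" unfolding in_jacobian_ideal_iff by blast
    also have "\<dots> = (\<Sum>i<?n. r (en i) * mpderiv (en i) ?f)" by (rule reindex[symmetric])
    also have "\<dots> = g \<bullet> vec ?n (\<lambda>i. r (en i))"
      by (subst g_prod) (auto simp: combination_def v0_def vec_fun_def)
    finally show "p \<in> (\<lambda>x. g \<bullet> x) ` carrier_vec ?n" by (auto intro!: image_eqI)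
  qed

  have entry: "d k $$ (i, j) = v k j i" if "i < length (s k)" "j < length (s (Suc k))" for k i j
    using that by (simp add: d_def column_matrix_def)
  have "graded_hom (s (Suc k)) (s k) (d k)" for k
    unfolding graded_hom_def
  proof (intro conjI allI impI)
    show "d k \<in> carrier_mat (length (s k)) (length (s (Suc k)))" by (simp add: d_def column_matrix_def)
    fix i j assume ij: "i < length (s k)" "j < length (s (Suc k))"
    then have "j < \<beta> k" by (simp add: len)
    moreover have "s (Suc k) ! j - s k ! i = (if k = 0 then E else 1)"
      using ij by (cases k) (simp_all add: s_def E_def)
    ultimately show "homogeneous (s (Suc k) ! j - s k ! i) (d k $$ (i, j))" using hom entry[OF ij] by metis
  qed
  moreover have "homogeneous (s 0 ! j) (g $ j)" if "j < ?n" for j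
    using that homogeneous_mpderiv_defining_polynomial by (simp add: s_def g_def)
  ultimately have "graded_free_resolution (jacobian_ideal ?f) s g d"
    unfolding graded_free_resolution_def len using image exact0 exact by (simp add: g_def)
  moreover have "d k $$ (i, j) \<in> irrelevant_ideal" if "i < length (s k)" "j < length (s (Suc k))" for k i j
    unfolding entry[OF that]
    by (rule homogeneous_in_irrelevant_ideal[OF hom]) (use that E in \<open>auto simp: len\<close>)
  ultimately have "minimal_graded_free_resolution (jacobian_ideal ?f) s g d"
    by (simp add: minimal_graded_free_resolution_def)
  moreover have "s 0 = replicate ?n (int m - 1)" by (simp add: s_def)
  moreover have "\<forall>k\<in>{1..?n - 1}. s k = replicate (\<beta> (k - 1)) (2 * int m - int ?n + int k - 1)"
    by (auto simp: s_def)
  moreover have "s k = []" if "k \<ge> ?n" for k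
    using that dim_ge_2 res(5)[of "k - 1"] by (simp add: s_def)
  ultimately show ?thesis by (intro exI[of _ "\<lambda>k. \<beta> (k - 1)"] exI[of _ s] exI[of _ g] exI[of _ d]) blast
qed

end

theorem theorem1p4:
  fixes n m :: nat
    and l :: "nat \<Rightarrow> ('n::finite, 'k::field) mpoly"
    and f :: "('n, 'k) mpoly"
  assumes "CARD('n) = n"
    and "n \<ge> 2"
    and "m \<ge> n + 1"
    and "infinite (UNIV :: 'k set)"
    and "\<not> CHAR('k) dvd m"
    and "generic_arrangement m l"
    and "f = defining_polynomial m l"
  shows "depth_quotient irrelevant_ideal (jacobian_ideal f) = 0 \<and>
    (\<exists>b :: nat \<Rightarrow> nat. \<exists>s g d.
       minimal_graded_free_resolution (jacobian_ideal f) s g d \<and>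
       s 0 = replicate n (int m - 1) \<and>
       (\<forall>k\<in>{1..n-1}. s k = replicate (b k) (2 * int m - int n + int k - 1)) \<and>
       (\<forall>k\<ge>n. s k = []))"
proof -
  have "generic_forms m l"
    by unfold_locales (use assms of_nat_eq_0_iff_char_dvd[of m, where 'a = 'k] in auto)
  then interpret generic_forms m l .
  show ?thesis using depth_zero minimal_resolution unfolding assms(1,7) by blast
qed

end
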